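(* Let $n\geq 3$ and let $(M,g)$ be an $n$-dimensional asymptotically flat manifold (with one end) with metric $g$ of class $C^3$, with integrable scalar curvature $\mathrm{Scal}^g$ and decay rate $\tau>\frac{n-2}{2}$. Then the classical and Ricci definitions of the mass agree (in particular the limit defining $m_R(g)$ exists): $$m(g)=m_R(g).$$ If moreover $m(g)\neq 0$ and the Regge–Teitelboim (RT) conditions hold, then the same is true for the center of mass, i.e. for every $\alpha\in\{1,\dots,n\}$ (the limit defining $c^\alpha_R(g)$ exists and) $$c^{\alpha}(g)=c^{\alpha}_R(g).$$
   Context: **Asymptotically flat.** A complete Riemannian manifold $(M,g)$ of dimension $n$ is asymptotically flat (with one end) with decay rate $\tau>0$ if there is a diffeomorphism (chart at infinity) from the complement of a compact set in $M$ onto the complement of a ball in $\mathbb{R}^n$ such that, in the resulting coordinates $x=(x^1,\dots,x^n)$ with $r=|x|$ the Euclidean radius, $$|g_{ij}-\delta_{ij}|=O(r^{-\tau}),\quad |\partial_k g_{ij}|=O(r^{-\tau-1}),\quad |\partial_k\partial_\ell g_{ij}|=O(r^{-\tau-2}).$$ All quantities below are computed in this fixed chart. $S_r$ is the coordinate sphere of radius $r$, $e$ is the Euclidean metric of the chart, $\nu^e$ is the Euclidean outer unit normal to $S_r$, $d\mathrm{vol}^e_{S_r}$ is the Euclidean area element, and $\omega_{n-1}$ is the volume of the unit round sphere of dimension $n-1$. The divergence $\delta^e$ carries the adjoint sign convention: for a symmetric 2-tensor, $(\delta^e g)_j=-\sum_i\partial_i g_{ij}$. $\mathrm{tr}_e$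 is the Euclidean trace. **Classical mass.** If $\tau>\frac{n-2}{2}$ and $\mathrm{Scal}^g$ is integrable, the mass is defined by the following limit, which exists and is independent of the chart at infinity: $$m(g)=\frac{1}{2(n-1)\omega_{n-1}}\lim_{r\to\infty}\int_{S_r}\left(-\delta^e g-d\,\mathrm{tr}_e g\right)(\nu^e)\,d\mathrm{vol}^e_{S_r}.$$ **RT conditions.** Writing $f^{\mathrm{odd}}(x)=\frac12(f(x)-f(-x))$ for the odd part of a function $f$ on the chart at infinity, the RT conditions are $$|g_{ij}^{\mathrm{odd}}|=O(r^{-\tau-1}),\quad |\partial_k(g_{ij}^{\mathrm{odd}})|=O(r^{-\tau-2}),\quad (\mathrm{Scal}^g)^{\mathrm{odd}}=O(r^{-2\tau-2}).$$ **Classical center of mass.** If $\tau>\frac{n-2}{2}$, $\mathrm{Scal}^g$ is integrable, $m(g)\neq0$ and the RT conditions hold, the center of mass is the vector with components given, for each $\alpha\in\{1,\dots,n\}$, by the following limit, which is stated to exist under these conditions: $$c^\alpha(g)=\frac{1}{2(n-1)\omega_{n-1}m(g)}\lim_{r\to\infty}\int_{S_r}\Big[x^\alpha(-\delta^e g-d\,\mathrm{tr}_e g)-(g-e)(\partial_\alpha,\cdot)+\mathrm{tr}_e(g-e)\,dx^\alpha\Big](\nu^e)\,d\mathrm{vol}^e_{S_r}.$$ **Ricci versions.** Let $\nu$ be the outer unit normal to $S_r$ with respect to $g$ and $d\mathrm{vol}^g$ the area element of $S_r$ induced by $g$. With $X=r\partial_r=x^i\partial_i$, $$m_R(g)=-\frac{1}{(n-1)(n-2)\omega_{n-1}}\lim_{r\to\infty}\int_{S_r}\left(\mathrm{Ric}^g-\tfrac12\mathrm{Scal}^g\,g\right)(X,\nu)\,d\mathrm{vol}^g,$$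 and with $X^{(\alpha)}=r^2\partial_\alpha-2x^\alpha x^i\partial_i$ (summation over $i$), $$c_R^\alpha(g)=\frac{1}{2(n-1)(n-2)\omega_{n-1}m(g)}\lim_{r\to\infty}\int_{S_r}\left(\mathrm{Ric}^g-\tfrac12\mathrm{Scal}^g\,g\right)(X^{(\alpha)},\nu)\,d\mathrm{vol}^g,$$ whenever these limits converge.
   Formalization: For the center of mass, the limit defining the classical c^α(g) is assumed to exist, for each α separately, because the stated conditions, including the RT conditions, do not guarantee it; then the limit defining c_R^α(g) exists and the two are equal. *)

theory Defs
  imports "HOL-Analysis.Analysis" "HOL-Library.Landau_Symbols"
begin

section \<open>Calculus in coordinates\<close>

definition partial :: "'n::finite \<Rightarrow> (real^'n \<Rightarrow> real) \<Rightarrow> real^'n \<Rightarrow> real" where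
  "partial i f x = frechet_derivative f (at x) (axis i 1)"

text \<open>Class \<open>C\<^sup>k\<close>; only meant for open sets.\<close>

primrec Ck_on :: "nat \<Rightarrow> (real^'n::finite \<Rightarrow> real) \<Rightarrow> (real^'n) set \<Rightarrow> bool" where
  "Ck_on 0 f S = continuous_on S f"
| "Ck_on (Suc k) f S = ((\<forall>x\<in>S. f differentiable (at x)) \<and> (\<forall>i. Ck_on k (partial i f) S))"

section \<open>Riemannian manifolds\<close>

text \<open>The manifold is the whole Hausdorff, second countable space \<open>'m\<close>. A chart is a domain
  together with a map, of which only the values on the domain matter. A smooth structure is a
  maximal smooth atlas, so its members are exactly the diffeomorphisms from open subsets
  of \<open>'m\<close> onto open subsets of \<open>real^'n\<close>.\<close>

type_synonym ('m, 'n) chart = "'m set \<times> ('m \<Rightarrow> real^'n)"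

definition chart_image :: "('m, 'n::finite) chart \<Rightarrow> (real^'n) set" where
  "chart_image c = snd c ` fst c"

definition chart_inv :: "('m, 'n::finite) chart \<Rightarrow> real^'n \<Rightarrow> 'm" where
  "chart_inv c = inv_into (fst c) (snd c)"

definition is_chart :: "('m::topological_space, 'n::finite) chart \<Rightarrow> bool" where
  "is_chart c \<longleftrightarrow> open (fst c) \<and> open (chart_image c) \<and>
     homeomorphism (fst c) (chart_image c) (snd c) (chart_inv c)"

definition transition :: "('m, 'n::finite) chart \<Rightarrow> ('m, 'n) chart \<Rightarrow> real^'n \<Rightarrow> real^'n" where
  "transition c d x = snd d (chart_inv c x)"

definition smooth_transition :: "('m, 'n::finite) chart \<Rightarrow> ('m, 'n) chart \<Rightarrow> bool" where
  "smooth_transition c d \<longleftrightarrow>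
     (\<forall>k i. Ck_on k (\<lambda>x. transition c d x $ i) (snd c ` (fst c \<inter> fst d)))"

definition smooth_structure :: "('m::topological_space, 'n::finite) chart set \<Rightarrow> bool" where
  "smooth_structure \<A> \<longleftrightarrow>
     (\<forall>c\<in>\<A>. is_chart c) \<and>
     (\<Union>c\<in>\<A>. fst c) = UNIV \<and>
     (\<forall>c\<in>\<A>. \<forall>d\<in>\<A>. smooth_transition c d) \<and>
     (\<forall>c. is_chart c \<and> (\<forall>d\<in>\<A>. smooth_transition c d \<and> smooth_transition d c) \<longrightarrow> c \<in> \<A>)"

text \<open>A metric is given by its component matrix in every chart; the third condition is the
  transformation law of a covariant 2-tensor.\<close>

definition C3_metric ::
  "('m::topological_space, 'n::finite) chart set \<Rightarrow> (('m, 'n) chart \<Rightarrow> real^'n \<Rightarrow> real^'n^'n) \<Rightarrow> bool"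
where
  "C3_metric \<A> g \<longleftrightarrow>
     (\<forall>c\<in>\<A>. \<forall>x\<in>chart_image c. transpose (g c x) = g c x \<and> (\<forall>v. v \<noteq> 0 \<longrightarrow> v \<bullet> (g c x *v v) > 0)) \<and>
     (\<forall>c\<in>\<A>. \<forall>i j. Ck_on 3 (\<lambda>x. g c x $ i $ j) (chart_image c)) \<and>
     (\<forall>c\<in>\<A>. \<forall>d\<in>\<A>. \<forall>x\<in>snd c ` (fst c \<inter> fst d). \<forall>i j.
        g c x $ i $ j =
          (\<Sum>k\<in>UNIV. \<Sum>l\<in>UNIV. partial i (\<lambda>y. transition c d y $ k) x *
             partial j (\<lambda>y. transition c d y $ l) x * g d (transition c d x) $ k $ l))"

text \<open>Pointwise invariants are evaluated in an arbitrarily chosen chart around the point.\<close>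

definition chart_at :: "('m, 'n::finite) chart set \<Rightarrow> 'm \<Rightarrow> ('m, 'n) chart" where
  "chart_at \<A> p = (SOME c. c \<in> \<A> \<and> p \<in> fst c)"

definition piecewise_C1_curve :: "('m::topological_space, 'n::finite) chart set \<Rightarrow> (real \<Rightarrow> 'm) \<Rightarrow> bool"
where
  "piecewise_C1_curve \<A> \<gamma> \<longleftrightarrow> continuous_on {0..1} \<gamma> \<and>
     (\<forall>c\<in>\<A>. \<forall>a b. 0 \<le> a \<and> a \<le> b \<and> b \<le> 1 \<and> \<gamma> ` {a..b} \<subseteq> fst c \<longrightarrow>
        (snd c \<circ> \<gamma>) piecewise_C1_differentiable_on {a..b})"

definition speed ::
  "('m, 'n::finite) chart set \<Rightarrow> (('m, 'n) chart \<Rightarrow> real^'n \<Rightarrow> real^'n^'n) \<Rightarrow> (real \<Rightarrow> 'm) \<Rightarrow> real \<Rightarrow> real"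
where
  "speed \<A> g \<gamma> t =
     (let c = chart_at \<A> (\<gamma> t); v = vector_derivative (snd c \<circ> \<gamma>) (at t)
      in sqrt (v \<bullet> (g c (snd c (\<gamma> t)) *v v)))"

definition curve_length ::
  "('m, 'n::finite) chart set \<Rightarrow> (('m, 'n) chart \<Rightarrow> real^'n \<Rightarrow> real^'n^'n) \<Rightarrow> (real \<Rightarrow> 'm) \<Rightarrow> ennreal"
where
  "curve_length \<A> g \<gamma> = (\<integral>\<^sup>+t\<in>{0..1}. ennreal (speed \<A> g \<gamma> t) \<partial>lborel)"

definition riemannian_dist ::
  "('m::topological_space, 'n::finite) chart set \<Rightarrow> (('m, 'n) chart \<Rightarrow> real^'n \<Rightarrow> real^'n^'n) \<Rightarrow>
   'm \<Rightarrow> 'm \<Rightarrow> ennreal"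
where
  "riemannian_dist \<A> g p q =
     (INF \<gamma>\<in>{\<gamma>. piecewise_C1_curve \<A> \<gamma> \<and> \<gamma> 0 = p \<and> \<gamma> 1 = q}. curve_length \<A> g \<gamma>)"

definition complete_metric ::
  "('m::topological_space, 'n::finite) chart set \<Rightarrow> (('m, 'n) chart \<Rightarrow> real^'n \<Rightarrow> real^'n^'n) \<Rightarrow> bool"
where
  "complete_metric \<A> g \<longleftrightarrow>
     (\<forall>s :: nat \<Rightarrow> 'm. (\<forall>e>0. \<exists>N. \<forall>i\<ge>N. \<forall>j\<ge>N. riemannian_dist \<A> g (s i) (s j) < e) \<longrightarrow> convergent s)"

section \<open>Curvature\<close>

definition christoffel ::
  "(real^'n::finite \<Rightarrow> real^'n^'n) \<Rightarrow> 'n \<Rightarrow> 'n \<Rightarrow> 'n \<Rightarrow> real^'n \<Rightarrow> real"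
where
  "christoffel G k i j x = (1/2) * (\<Sum>l\<in>UNIV. matrix_inv (G x) $ k $ l *
     (partial i (\<lambda>y. G y $ j $ l) x + partial j (\<lambda>y. G y $ i $ l) x - partial l (\<lambda>y. G y $ i $ j) x))"

definition ricci :: "(real^'n::finite \<Rightarrow> real^'n^'n) \<Rightarrow> real^'n \<Rightarrow> real^'n^'n" where
  "ricci G x = (\<chi> i j.
     (\<Sum>k\<in>UNIV. partial k (christoffel G k i j) x - partial j (christoffel G k i k) x) +
     (\<Sum>k\<in>UNIV. \<Sum>l\<in>UNIV. christoffel G k k l x * christoffel G l i j x
                        - christoffel G k j l x * christoffel G l i k x))"

definition scal :: "(real^'n::finite \<Rightarrow> real^'n^'n) \<Rightarrow> real^'n \<Rightarrow> real" where
  "scal G x = (\<Sum>i\<in>UNIV. \<Sum>j\<in>UNIV. matrix_inv (G x) $ i $ j * ricci G x $ i $ j)"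

definition einstein :: "(real^'n::finite \<Rightarrow> real^'n^'n) \<Rightarrow> real^'n \<Rightarrow> real^'n^'n" where
  "einstein G x = ricci G x - (scal G x / 2) *\<^sub>R G x"

text \<open>The Riemannian volume measure is uniquely determined by these conditions.\<close>

definition riemannian_volume ::
  "('m::topological_space, 'n::finite) chart set \<Rightarrow> (('m, 'n) chart \<Rightarrow> real^'n \<Rightarrow> real^'n^'n) \<Rightarrow>
   'm measure \<Rightarrow> bool"
where
  "riemannian_volume \<A> g \<mu> \<longleftrightarrow> sets \<mu> = sets borel \<and>
     (\<forall>c\<in>\<A>. \<forall>A\<in>sets borel. A \<subseteq> fst c \<longrightarrow>
        emeasure \<mu> A = (\<integral>\<^sup>+x\<in>snd c ` A. ennreal (sqrt (det (g c x))) \<partial>lborel))"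

definition integrable_scal ::
  "('m::topological_space, 'n::finite) chart set \<Rightarrow> (('m, 'n) chart \<Rightarrow> real^'n \<Rightarrow> real^'n^'n) \<Rightarrow> bool"
where
  "integrable_scal \<A> g \<longleftrightarrow>
     (\<exists>\<mu>. riemannian_volume \<A> g \<mu> \<and>
        integrable \<mu> (\<lambda>p. scal (g (chart_at \<A> p)) (snd (chart_at \<A> p) p)))"

section \<open>Asymptotically flat manifolds\<close>

definition asymptotically_flat ::
  "('m::{t2_space,second_countable_topology}, 'n::finite) chart set \<Rightarrow>
   (('m, 'n) chart \<Rightarrow> real^'n \<Rightarrow> real^'n^'n) \<Rightarrow> ('m, 'n) chart \<Rightarrow> real \<Rightarrow> bool"
where
  "asymptotically_flat \<A> g \<Phi> \<tau> \<longleftrightarrow>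
     smooth_structure \<A> \<and> C3_metric \<A> g \<and> complete_metric \<A> g \<and> \<tau> > 0 \<and>
     \<Phi> \<in> \<A> \<and> compact (- fst \<Phi>) \<and> (\<exists>p R. R > 0 \<and> chart_image \<Phi> = - cball p R) \<and>
     (\<forall>i j. (\<lambda>x. g \<Phi> x $ i $ j - mat 1 $ i $ j) \<in> O[at_infinity](\<lambda>x. norm x powr (-\<tau>))) \<and>
     (\<forall>k i j. partial k (\<lambda>x. g \<Phi> x $ i $ j) \<in> O[at_infinity](\<lambda>x. norm x powr (-\<tau> - 1))) \<and>
     (\<forall>k l i j. partial k (partial l (\<lambda>x. g \<Phi> x $ i $ j))
        \<in> O[at_infinity](\<lambda>x. norm x powr (-\<tau> - 2)))"

definition odd_part :: "(real^'n::finite \<Rightarrow> real) \<Rightarrow> real^'n \<Rightarrow> real" where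
  "odd_part f x = (f x - f (- x)) / 2"

definition RT_conditions :: "(real^'n::finite \<Rightarrow> real^'n^'n) \<Rightarrow> real \<Rightarrow> bool" where
  "RT_conditions G \<tau> \<longleftrightarrow>
     (\<forall>i j. odd_part (\<lambda>x. G x $ i $ j) \<in> O[at_infinity](\<lambda>x. norm x powr (-\<tau> - 1))) \<and>
     (\<forall>k i j. partial k (odd_part (\<lambda>x. G x $ i $ j)) \<in> O[at_infinity](\<lambda>x. norm x powr (-\<tau> - 2))) \<and>
     odd_part (scal G) \<in> O[at_infinity](\<lambda>x. norm x powr (-2*\<tau> - 2))"

section \<open>Integration over coordinate spheres\<close>

text \<open>Euclidean area measure of the sphere of radius \<open>r\<close>, in polar coordinates: the area of
  a subset is \<open>n / r\<close> times the volume of the cone over it with apex the origin.\<close>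

definition sphere_measure :: "real \<Rightarrow> (real^'n::finite) measure" where
  "sphere_measure r = scale_measure (ennreal (real CARD('n) / r))
     (distr (restrict_space lborel (cball 0 r)) borel (\<lambda>x. (r / norm x) *\<^sub>R x))"

text \<open>The restriction to the sphere keeps the values of \<open>f\<close> off the sphere, where it may be
  unspecified, from affecting measurability.\<close>

definition sphere_integral :: "real \<Rightarrow> (real^'n::finite \<Rightarrow> real) \<Rightarrow> real" where
  "sphere_integral r f = (LINT x:sphere 0 r|sphere_measure r. f x)"

definition unit_sphere_area :: "'n::finite itself \<Rightarrow> real" where
  "unit_sphere_area _ = measure (sphere_measure 1 :: (real^'n) measure) (sphere 0 1)"

definition euclidean_normal :: "real^'n::finite \<Rightarrow> real^'n" where
  "euclidean_normal x = x /\<^sub>R norm x"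

definition outer_normal :: "(real^'n::finite \<Rightarrow> real^'n^'n) \<Rightarrow> real^'n \<Rightarrow> real^'n" where
  "outer_normal G x = (THE v. (\<forall>w. w \<bullet> x = 0 \<longrightarrow> v \<bullet> (G x *v w) = 0) \<and>
      v \<bullet> (G x *v v) = 1 \<and> v \<bullet> x > 0)"

text \<open>Density of the area element induced by \<open>G\<close> on the coordinate sphere through \<open>x\<close> with
  respect to the Euclidean one: the square root of the Gram determinant of \<open>G\<close> on a Euclidean
  orthonormal basis of the tangent space, which is the orthogonal complement of \<open>x\<close>. With \<open>N\<close> and
  \<open>P\<close> the orthogonal projections to the normal line and to the tangent space, the bilinear
  form \<open>P G P + N\<close> is \<open>G\<close> on the tangent space, plus the standard form on the normal line.\<close>

definition area_density :: "(real^'n::finite \<Rightarrow> real^'n^'n) \<Rightarrow> real^'n \<Rightarrow> real" where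
  "area_density G x =
     (let N = (\<chi> i j. euclidean_normal x $ i * euclidean_normal x $ j); P = mat 1 - N
      in sqrt (det (P ** G x ** P + N)))"

section \<open>Mass and center of mass\<close>

definition euclidean_delta :: "(real^'n::finite \<Rightarrow> real^'n^'n) \<Rightarrow> real^'n \<Rightarrow> real^'n" where
  "euclidean_delta G x = (\<chi> j. - (\<Sum>i\<in>UNIV. partial i (\<lambda>y. G y $ i $ j) x))"

definition d_trace :: "(real^'n::finite \<Rightarrow> real^'n^'n) \<Rightarrow> real^'n \<Rightarrow> real^'n" where
  "d_trace G x = (\<chi> j. partial j (\<lambda>y. trace (G y)) x)"

definition mass_flux :: "(real^'n::finite \<Rightarrow> real^'n^'n) \<Rightarrow> real \<Rightarrow> real" where
  "mass_flux G r = sphere_integral r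
     (\<lambda>x. (- euclidean_delta G x - d_trace G x) \<bullet> euclidean_normal x)"

definition mass :: "(real^'n::finite \<Rightarrow> real^'n^'n) \<Rightarrow> real" where
  "mass G = 1 / (2 * (real CARD('n) - 1) * unit_sphere_area TYPE('n)) * Lim at_top (mass_flux G)"

definition center_flux :: "(real^'n::finite \<Rightarrow> real^'n^'n) \<Rightarrow> 'n \<Rightarrow> real \<Rightarrow> real" where
  "center_flux G \<alpha> r = sphere_integral r
     (\<lambda>x. ((x $ \<alpha>) *\<^sub>R (- euclidean_delta G x - d_trace G x)
           - (G x - mat 1) $ \<alpha>
           + trace (G x - mat 1) *\<^sub>R axis \<alpha> 1) \<bullet> euclidean_normal x)"

definition center_of_mass :: "(real^'n::finite \<Rightarrow> real^'n^'n) \<Rightarrow> 'n \<Rightarrow> real" where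
  "center_of_mass G \<alpha> = 1 / (2 * (real CARD('n) - 1) * unit_sphere_area TYPE('n) * mass G) *
     Lim at_top (center_flux G \<alpha>)"

definition einstein_flux ::
  "(real^'n::finite \<Rightarrow> real^'n^'n) \<Rightarrow> (real^'n \<Rightarrow> real^'n) \<Rightarrow> real \<Rightarrow> real"
where
  "einstein_flux G X r = sphere_integral r
     (\<lambda>x. X x \<bullet> (einstein G x *v outer_normal G x) * area_density G x)"

definition ricci_mass_flux :: "(real^'n::finite \<Rightarrow> real^'n^'n) \<Rightarrow> real \<Rightarrow> real" where
  "ricci_mass_flux G = einstein_flux G (\<lambda>x. x)"

definition ricci_mass :: "(real^'n::finite \<Rightarrow> real^'n^'n) \<Rightarrow> real" where
  "ricci_mass G = - 1 / ((real CARD('n) - 1) * (real CARD('n) - 2) * unit_sphere_area TYPE('n)) *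
     Lim at_top (ricci_mass_flux G)"

definition ricci_center_flux :: "(real^'n::finite \<Rightarrow> real^'n^'n) \<Rightarrow> 'n \<Rightarrow> real \<Rightarrow> real" where
  "ricci_center_flux G \<alpha> = einstein_flux G
     (\<lambda>x. (norm x)\<^sup>2 *\<^sub>R axis \<alpha> 1 - (2 * x $ \<alpha>) *\<^sub>R x)"

definition ricci_center_of_mass :: "(real^'n::finite \<Rightarrow> real^'n^'n) \<Rightarrow> 'n \<Rightarrow> real" where
  "ricci_center_of_mass G \<alpha> =
     1 / (2 * (real CARD('n) - 1) * (real CARD('n) - 2) * unit_sphere_area TYPE('n) * mass G) *
     Lim at_top (ricci_center_flux G \<alpha>)"

definition limit_exists :: "(real \<Rightarrow> real) \<Rightarrow> bool" where
  "limit_exists F \<longleftrightarrow> (\<exists>l. (F \<longlongrightarrow> l) at_top)"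

end

(* Multiplied by sqrt (det G), the curvature tensor with two indices raised is the exterior
   derivative of a potential of first order in G, up to terms quadratic in the first derivatives.
   Hence the flux density of the Einstein tensor in direction X is the divergence of a skew field,
   which integrates to zero over a sphere, plus the contraction of the potential with the
   derivatives of X, plus a quadratic remainder. For X = x the second term is -(n - 2)/2 times the
   classical mass density. For the conformal fields of the center of mass, one integration by parts along
   rotations turns it into n - 2 times the classical density. The remainder vanishes in the limit because
   2 tau + 1 > n - 1; for the center this decay is one order short, and the missing order comes from
   parity under the RT conditions. The classical mass flux converges because its derivative in the
   radius is the sphere integral of sqrt (det G) Scal plus an integrable remainder. *)

theory Submission
  imports Defs
begin

section \<open>Partial derivatives\<close>

text \<open>The potential is kept nonlinear and linearised only at the end, so second derivatives of
  the metric enter only through exact divergences or through \<open>scal\<close> itself, which is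
  integrable. The weight sqrt (det G) is forced by geometry: area density times unit normal of a
  coordinate sphere is sqrt (det G) times the inverse metric applied to the Euclidean normal. All
  integration by parts on spheres rests on one fact: the integral of x_i d_j f - x_j d_i f over a
  sphere vanishes, since the sphere measure is invariant under rotations. The vanishing of skew
  divergences and the radial derivative of a flux are combinations of such terms. Integrability of
  the scalar curvature is posed on the manifold, through an arbitrary choice of a chart at each
  point, so its use in the chart at infinity requires invariance of the scalar curvature under
  coordinate changes. A parameter \<open>\<delta>\<close> measures the order gained by parity: 0 in
  general, 1 under the RT conditions. Decay of every quantity is thus derived once, and the center
  density, of order 2 \<tau>, acts on spheres as one of order 2 \<tau> + \<delta>.\<close>

lemma partial_eqI: "(f has_derivative D) (at x) \<Longrightarrow> partial i f x = D (axis i 1)"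
  unfolding partial_def by (metis frechet_derivative_at)

lemma has_derivative_partial:
  "f differentiable at x \<Longrightarrow> (f has_derivative (\<lambda>v. \<Sum>i\<in>UNIV. v $ i * partial i f x)) (at x)"
proof -
  assume "f differentiable at x"
  then have d: "(f has_derivative frechet_derivative f (at x)) (at x)"
    by (simp add: frechet_derivative_works)
  then have lin: "linear (frechet_derivative f (at x))"
    using has_derivative_linear by blast
  have "frechet_derivative f (at x) v = (\<Sum>i\<in>UNIV. v $ i * partial i f x)" for v
  proof -
    have "frechet_derivative f (at x) v = frechet_derivative f (at x) (\<Sum>i\<in>UNIV. (v $ i) *\<^sub>R axis i 1)"
      by (simp add: basis_expansion flip: scalar_mult_eq_scaleR)
    also have "\<dots> = (\<Sum>i\<in>UNIV. v $ i * partial i f x)"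
      by (simp add: linear_sum[OF lin] linear_cmul[OF lin] partial_def)
    finally show ?thesis .
  qed
  then have "frechet_derivative f (at x) = (\<lambda>v. \<Sum>i\<in>UNIV. v $ i * partial i f x)"
    by (rule ext)
  then show ?thesis using d by metis
qed

lemma has_derivative_cong_open:
  assumes "open S" "x \<in> S" "\<And>y. y \<in> S \<Longrightarrow> f y = g y"
  shows "(f has_derivative D) (at x) \<longleftrightarrow> (g has_derivative D) (at x)"
  using assms has_derivative_transform_within_open[of f D x UNIV S g]
    has_derivative_transform_within_open[of g D x UNIV S f] by auto

text \<open>Holds also at points where the functions are not differentiable:
  \<open>frechet_derivative\<close> chooses among the derivatives at the point, and locally equal
  functions have the same ones.\<close>

lemma partial_cong:
  assumes "open S" "x \<in> S" "\<And>y. y \<in> S \<Longrightarrow> f y = g y"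
  shows "partial i f x = partial i g x"
  unfolding partial_def frechet_derivative_def
  by (simp add: has_derivative_cong_open[OF assms])

lemma differentiable_cong_open:
  assumes "open S" "x \<in> S" "\<And>y. y \<in> S \<Longrightarrow> f y = g y"
  shows "f differentiable at x \<longleftrightarrow> g differentiable at x"
  unfolding differentiable_def by (simp add: has_derivative_cong_open[OF assms])

lemma partial_const [simp]: "partial i (\<lambda>x. c) x = 0"
  by (rule partial_eqI) (rule has_derivative_const)

lemma differentiable_coord [simp]: "(\<lambda>x::real^'n. x $ j) differentiable at x"
  by (rule bounded_linear_imp_differentiable[OF bounded_linear_vec_nth])

lemma partial_coord: "partial i (\<lambda>x. x $ j) x = (if i = j then 1 else 0)"
  by (subst partial_eqI[OF bounded_linear_imp_has_derivative[OF bounded_linear_vec_nth]])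
     (simp add: axis_def)

lemma partial_add:
  assumes "f differentiable at x" "g differentiable at x"
  shows "partial i (\<lambda>x. f x + g x) x = partial i f x + partial i g x"
  unfolding partial_def
  by (subst frechet_derivative_at[OF has_derivative_add, symmetric])
     (use assms in \<open>auto simp: frechet_derivative_works\<close>)

lemma partial_diff:
  assumes "f differentiable at x" "g differentiable at x"
  shows "partial i (\<lambda>x. f x - g x) x = partial i f x - partial i g x"
  unfolding partial_def
  by (subst frechet_derivative_at[OF has_derivative_diff, symmetric])
     (use assms in \<open>auto simp: frechet_derivative_works\<close>)

lemma partial_mult:
  assumes "f differentiable at x" "g differentiable at x"
  shows "partial i (\<lambda>x. f x * g x) x = partial i f x * g x + f x * partial i g x"
  unfolding partial_def
  by (subst frechet_derivative_at[OF has_derivative_mult, symmetric])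
     (use assms in \<open>auto simp: frechet_derivative_works\<close>)

lemma partial_cmult:
  assumes "f differentiable at x"
  shows "partial i (\<lambda>x. c * f x) x = c * partial i f x"
  by (subst partial_mult) (use assms in auto)

lemma partial_minus:
  assumes "f differentiable at x"
  shows "partial i (\<lambda>x. - f x) x = - partial i f x"
  using partial_cmult[OF assms, of i "-1"] by simp

lemma partial_sum:
  assumes "\<And>j. j \<in> A \<Longrightarrow> f j differentiable at x"
  shows "partial i (\<lambda>x. \<Sum>j\<in>A. f j x) x = (\<Sum>j\<in>A. partial i (f j) x)"
  unfolding partial_def
  by (subst frechet_derivative_at[OF has_derivative_sum, symmetric])
     (use assms in \<open>auto simp: frechet_derivative_works\<close>)

lemma partial_inverse:
  assumes "f differentiable at x" "f x \<noteq> 0"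
  shows "partial i (\<lambda>x. inverse (f x)) x = - (partial i f x * (inverse (f x) * inverse (f x)))"
proof -
  have "(f has_derivative frechet_derivative f (at x)) (at x)"
    using assms by (simp add: frechet_derivative_works)
  from partial_eqI[OF Deriv.has_derivative_inverse[OF assms(2) this]]
  show ?thesis by (simp add: partial_def)
qed

lemma has_derivative_sqrt_comp:
  assumes "(f has_derivative D) (at x)" "f x > 0"
  shows "((\<lambda>x. sqrt (f x)) has_derivative (\<lambda>v. D v * (inverse (sqrt (f x)) / 2))) (at x)"
  using has_derivative_real_sqrt[OF assms(2,1)] by simp

lemma partial_sqrt:
  assumes "f differentiable at x" "f x > 0"
  shows "partial i (\<lambda>x. sqrt (f x)) x = partial i f x * (inverse (sqrt (f x)) / 2)"
proof -
  have "(f has_derivative frechet_derivative f (at x)) (at x)"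
    using assms by (simp add: frechet_derivative_works)
  from partial_eqI[OF has_derivative_sqrt_comp[OF this assms(2)]]
  show ?thesis by (simp add: partial_def)
qed

lemma differentiable_sqrt_comp:
  assumes "f differentiable at x" "f x > (0::real)"
  shows "(\<lambda>x. sqrt (f x)) differentiable at x"
  using assms has_derivative_sqrt_comp unfolding differentiable_def by blast

lemma has_derivative_vec_componentwise:
  assumes "\<And>k. (\<lambda>x. T x $ k) differentiable at x"
  shows "(T has_derivative (\<lambda>v. \<chi> k. \<Sum>i\<in>UNIV. v $ i * partial i (\<lambda>x. T x $ k) x)) (at x)"
  unfolding has_derivative_componentwise_within[of T]
  using has_derivative_partial[OF assms] by (auto simp: Basis_vec_def inner_axis)

lemma partial_chain:
  fixes T :: "real^'n::finite \<Rightarrow> real^'m::finite"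
  assumes T: "\<And>k. (\<lambda>x. T x $ k) differentiable at x" and f: "f differentiable at (T x)"
  shows "partial i (\<lambda>x. f (T x)) x = (\<Sum>k\<in>UNIV. partial i (\<lambda>x. T x $ k) x * partial k f (T x))"
proof -
  have "((\<lambda>x. f (T x)) has_derivative (\<lambda>v. \<Sum>k\<in>UNIV. (\<chi> k. \<Sum>i\<in>UNIV. v $ i * partial i (\<lambda>x. T x $ k) x) $ k * partial k f (T x))) (at x)"
    by (rule has_derivative_compose[OF has_derivative_vec_componentwise[of T x, OF T] has_derivative_partial[OF f]])
  from partial_eqI[OF this, of i] show ?thesis
    by (simp add: axis_def if_distrib[of "\<lambda>a. a * _"] cong: if_cong)
qed

lemma differentiable_chain:
  fixes T :: "real^'n::finite \<Rightarrow> real^'m::finite" and f :: "real^'m \<Rightarrow> real"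
  assumes T: "\<And>k. (\<lambda>x. T x $ k) differentiable at x" and f: "f differentiable at (T x)"
  shows "(\<lambda>x. f (T x)) differentiable at x"
  using has_derivative_compose[OF has_derivative_vec_componentwise[of T x, OF T] has_derivative_partial[OF f]]
  unfolding differentiable_def by blast

lemma partial_reflect:
  fixes f :: "real^'n::finite \<Rightarrow> real"
  assumes "f differentiable at (- x)"
  shows "partial i (\<lambda>x. f (- x)) x = - partial i f (- x)"
proof -
  have "partial i (\<lambda>x. f (- x)) x = (\<Sum>k\<in>UNIV. partial i (\<lambda>x. (- x) $ k) x * partial k f (- x))"
    by (intro partial_chain) (use assms in auto)
  also have "\<dots> = (\<Sum>k\<in>UNIV. (if k = i then - partial i f (-x) else 0))"
    by (intro sum.cong) (auto simp: partial_minus partial_coord)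
  finally show ?thesis by simp
qed

lemma line_derivative:
  fixes f :: "real^'n::finite \<Rightarrow> real"
  assumes "f differentiable at (x + t *\<^sub>R axis i 1)"
  shows "((\<lambda>t. f (x + t *\<^sub>R axis i 1)) has_real_derivative partial i f (x + t *\<^sub>R axis i 1)) (at t)"
proof -
  have "((\<lambda>t. x + t *\<^sub>R axis i 1) has_derivative (\<lambda>s. s *\<^sub>R axis i (1::real))) (at t)"
    by (auto intro!: derivative_eq_intros)
  note has_derivative_compose[OF this has_derivative_partial[OF assms]]
  moreover have "(\<Sum>k\<in>UNIV. (s *\<^sub>R axis i 1 :: real^'n) $ k * partial k f y) = partial i f y * s" for s y
  proof -
    have "(\<Sum>k\<in>UNIV. (s *\<^sub>R axis i 1 :: real^'n) $ k * partial k f y) = (\<Sum>k\<in>UNIV. if k = i then partial i f y * s else 0)"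
      by (intro sum.cong) (auto simp: axis_def)
    then show ?thesis by simp
  qed
  ultimately show ?thesis
    unfolding has_field_derivative_def by simp
qed

section \<open>Symmetry of second partial derivatives\<close>

text \<open>The second difference of \<open>f\<close> in directions \<open>i, j\<close> is \<open>t\<^sup>2\<close> times a value of the mixed
  derivative near \<open>x\<close>, for both orders of differentiation.\<close>

lemma second_difference:
  fixes f :: "real^'n::finite \<Rightarrow> real"
  assumes t: "t > 0" and ball: "cball x (2 * t) \<subseteq> S"
    and f: "\<And>y. y \<in> S \<Longrightarrow> f differentiable at y"
    and df: "\<And>y. y \<in> S \<Longrightarrow> partial i f differentiable at y"
  shows "\<exists>y\<in>cball x (2 * t). f (x + t *\<^sub>R axis i 1 + t *\<^sub>R axis j 1) - f (x + t *\<^sub>R axis i 1) - f (x + t *\<^sub>R axis j 1) + f x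
      = t\<^sup>2 * partial j (partial i f) y"
proof -
  \<comment> \<open>Two displacements of length at most \<open>t\<close> each account for the radius
    \<open>2 * t\<close>.\<close>
  have near: "dist x (x + a *\<^sub>R axis i 1 + b *\<^sub>R axis j 1) \<le> 2 * t"
    if "0 \<le> a" "a \<le> t" "0 \<le> b" "b \<le> t" for a b
  proof -
    have "dist x (x + a *\<^sub>R axis i 1 + b *\<^sub>R axis j 1) = norm (a *\<^sub>R axis i (1::real) + b *\<^sub>R axis j 1)"
      by (metis add.assoc add_diff_cancel_left' dist_commute dist_norm)
    also have "\<dots> \<le> norm (a *\<^sub>R axis i (1::real)) + norm (b *\<^sub>R axis j (1::real))"
      by (rule norm_triangle_ineq)
    also have "\<dots> \<le> 2 * t" using that by simp
    finally show ?thesis .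
  qed
  have inS: "x + a *\<^sub>R axis i 1 + b *\<^sub>R axis j 1 \<in> S" if "0 \<le> a" "a \<le> t" "0 \<le> b" "b \<le> t" for a b
    using near[OF that] ball by (simp add: subset_eq)
  \<comment> \<open>The second difference is \<open>h t - h 0\<close>. The mean value theorem
    applies twice, because the value \<open>h' a\<close> it yields is again an increment, now of
    \<open>partial i f\<close> in direction \<open>j\<close>.\<close>
  define h where "h a = f (x + t *\<^sub>R axis j 1 + a *\<^sub>R axis i 1) - f (x + a *\<^sub>R axis i 1)" for a
  define h' where "h' a = partial i f (x + t *\<^sub>R axis j 1 + a *\<^sub>R axis i 1) - partial i f (x + a *\<^sub>R axis i 1)" for a
  have hd: "(h has_real_derivative h' a) (at a)" if "0 \<le> a" "a \<le> t" for a
  proof -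
    have "x + t *\<^sub>R axis j 1 + a *\<^sub>R axis i 1 \<in> S" "x + a *\<^sub>R axis i 1 \<in> S"
      using inS[of a t] inS[of a 0] that t by (simp_all add: add.assoc add.commute[of "t *\<^sub>R _"])
    then show ?thesis
      unfolding h_def h'_def by (intro DERIV_diff[OF line_derivative[OF f] line_derivative[OF f]])
  qed
  obtain a where a: "0 < a" "a < t" "h t - h 0 = (t - 0) * h' a"
    using MVT2[OF t hd] by auto
  define k where "k b = partial i f (x + a *\<^sub>R axis i 1 + b *\<^sub>R axis j 1)" for b
  define k' where "k' b = partial j (partial i f) (x + a *\<^sub>R axis i 1 + b *\<^sub>R axis j 1)" for b
  have kd: "(k has_real_derivative k' b) (at b)" if "0 \<le> b" "b \<le> t" for b
  proof -
    have "x + a *\<^sub>R axis i 1 + b *\<^sub>R axis j 1 \<in> S"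
      using inS[of a b] that a by simp
    then show ?thesis unfolding k_def k'_def by (rule line_derivative[OF df])
  qed
  obtain b where b: "0 < b" "b < t" "k t - k 0 = (t - 0) * k' b"
    using MVT2[OF t kd] by auto
  have "h' a = k t - k 0"
    by (simp add: h'_def k_def add.assoc add.commute[of "t *\<^sub>R _"])
  then have "h t - h 0 = t\<^sup>2 * partial j (partial i f) (x + a *\<^sub>R axis i 1 + b *\<^sub>R axis j 1)"
    using a b by (simp add: k'_def power2_eq_square)
  moreover have "f (x + t *\<^sub>R axis i 1 + t *\<^sub>R axis j 1) - f (x + t *\<^sub>R axis i 1) - f (x + t *\<^sub>R axis j 1) + f x = h t - h 0"
    by (simp add: h_def add.assoc add.commute[of "t *\<^sub>R axis j _"])
  moreover have "dist x (x + a *\<^sub>R axis i 1 + b *\<^sub>R axis j 1) \<le> 2 * t"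
    using near a b by simp
  ultimately show ?thesis by (metis mem_cball)
qed

text \<open>The second difference is symmetric in the two directions, so the two mixed derivatives
  agree when each is taken at a suitable point within distance \<open>2 * t n\<close> of
  \<open>x\<close>; continuity moves both points to \<open>x\<close>.\<close>

lemma partial_commute:
  fixes f :: "real^'n::finite \<Rightarrow> real"
  assumes S: "open S" "x \<in> S" and f: "Ck_on 2 f S"
  shows "partial i (partial j f) x = partial j (partial i f) x"
proof -
  have d: "\<And>y. y \<in> S \<Longrightarrow> f differentiable at y" "\<And>y i. y \<in> S \<Longrightarrow> partial i f differentiable at y"
    and c: "\<And>i j. continuous_on S (partial i (partial j f))"
    using f by (auto simp: numeral_2_eq_2)
  obtain e where e: "e > 0" "ball x e \<subseteq> S" using S open_contains_ball by blast
  \<comment> \<open>The divisor 3 keeps \<open>cball x (2 * t n)\<close> strictly inside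
    \<open>ball x e\<close>.\<close>
  define t where "t n = e / 3 * inverse (real (Suc n))" for n
  have t: "t n > 0" "2 * t n < e" for n
  proof -
    have "inverse (real (Suc n)) \<le> 1" "inverse (real (Suc n)) > 0"
      by (simp_all add: inverse_eq_divide)
    then have "e * inverse (real (Suc n)) \<le> e" "e * inverse (real (Suc n)) > 0" 
      using e(1) mult_left_le[of "inverse (real (Suc n))" e] by (simp_all del: of_nat_Suc)
    then show "t n > 0" "2 * t n < e"
      using e(1) by (simp_all add: t_def del: of_nat_Suc)
  qed
  have t0: "t \<longlonglongrightarrow> 0"
    unfolding t_def by (rule tendsto_mult_right_zero[OF LIMSEQ_inverse_real_of_nat])
  have ball: "cball x (2 * t n) \<subseteq> S" for n using e t[of n] by (auto simp: subset_eq)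
  have lim: "\<exists>y. (\<lambda>n. partial l (partial k f) (y n)) \<longlonglongrightarrow> partial l (partial k f) x \<and>
      (\<forall>n. f (x + t n *\<^sub>R axis k 1 + t n *\<^sub>R axis l 1) - f (x + t n *\<^sub>R axis k 1) - f (x + t n *\<^sub>R axis l 1) + f x
      = (t n)\<^sup>2 * partial l (partial k f) (y n))" for k l
  proof -
    have "\<exists>y\<in>cball x (2 * t n). f (x + t n *\<^sub>R axis k 1 + t n *\<^sub>R axis l 1) - f (x + t n *\<^sub>R axis k 1) - f (x + t n *\<^sub>R axis l 1) + f x
      = (t n)\<^sup>2 * partial l (partial k f) y" for n
      by (rule second_difference[OF t(1) ball d(1) d(2)])
    then obtain y where y: "\<And>n. dist x (y n) \<le> 2 * t n" "\<And>n. f (x + t n *\<^sub>R axis k 1 + t n *\<^sub>R axis l 1) - f (x + t n *\<^sub>R axis k 1) - f (x + t n *\<^sub>R axis l 1) + f x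
      = (t n)\<^sup>2 * partial l (partial k f) (y n)" unfolding Bex_def mem_cball by metis
    have "(\<lambda>n. dist (y n) x) \<longlonglongrightarrow> 0"
    proof (rule tendsto_sandwich[OF _ _ tendsto_const])
      show "(\<lambda>n. 2 * t n) \<longlonglongrightarrow> 0" using tendsto_mult_right_zero[OF t0] .
    qed (use y(1) in \<open>auto simp: dist_commute\<close>)
    then have "y \<longlonglongrightarrow> x" by (rule tendsto_dist_iff[THEN iffD2])
    moreover have "isCont (partial l (partial k f)) x"
      using c S by (simp add: continuous_on_eq_continuous_at)
    ultimately have "(\<lambda>n. partial l (partial k f) (y n)) \<longlonglongrightarrow> partial l (partial k f) x"
      using isCont_tendsto_compose by blast
    then show ?thesis using y(2) by (intro exI[of _ y] conjI allI)
  qed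
  from lim[of i j] obtain y where y: "(\<lambda>n. partial i (partial j f) (y n)) \<longlonglongrightarrow> partial i (partial j f) x"
      "\<forall>n. f (x + t n *\<^sub>R axis j 1 + t n *\<^sub>R axis i 1) - f (x + t n *\<^sub>R axis j 1) - f (x + t n *\<^sub>R axis i 1) + f x
      = (t n)\<^sup>2 * partial i (partial j f) (y n)" by (elim exE conjE)
  from lim[of j i] obtain z where z: "(\<lambda>n. partial j (partial i f) (z n)) \<longlonglongrightarrow> partial j (partial i f) x"
      "\<forall>n. f (x + t n *\<^sub>R axis i 1 + t n *\<^sub>R axis j 1) - f (x + t n *\<^sub>R axis i 1) - f (x + t n *\<^sub>R axis j 1) + f x
      = (t n)\<^sup>2 * partial j (partial i f) (z n)" by (elim exE conjE)
  have "(t n)\<^sup>2 * partial i (partial j f) (y n) = (t n)\<^sup>2 * partial j (partial i f) (z n)" for n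
  proof -
    have "f (x + t n *\<^sub>R axis j 1 + t n *\<^sub>R axis i 1) = f (x + t n *\<^sub>R axis i 1 + t n *\<^sub>R axis j 1)"
      by (simp add: add_ac)
    then show ?thesis
      using spec[OF y(2), of n] spec[OF z(2), of n] by linarith
  qed
  then have "partial i (partial j f) (y n) = partial j (partial i f) (z n)" for n
    using t(1)[of n] by (metis less_irrefl mult_cancel_left power_not_zero)
  then show ?thesis using y(1) z(1) LIMSEQ_unique by simp
qed

section \<open>Continuously differentiable functions\<close>

lemma Ck_on_Suc_imp: "Ck_on (Suc k) f S \<Longrightarrow> Ck_on k f S"
proof (induction k arbitrary: f)
  case 0
  then show ?case
    by (auto intro!: continuous_at_imp_continuous_on differentiable_imp_continuous_within)
qed auto

lemma Ck_on_mono: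
  assumes "Ck_on m f S" "k \<le> m" shows "Ck_on k f S"
  using assms(2,1) by (induction rule: dec_induct) (auto dest: Ck_on_Suc_imp simp del: Ck_on.simps)

lemma Ck_on_subset: "Ck_on k f S \<Longrightarrow> T \<subseteq> S \<Longrightarrow> Ck_on k f T"
  by (induction k arbitrary: f) (auto intro: continuous_on_subset)

text \<open>Coincides with \<open>Ck_on 1\<close>, unfolded once, so that closure under algebraic
  operations follows from the product and quotient rules without induction on the order of
  differentiability.\<close>

definition C1_on :: "(real^'n::finite \<Rightarrow> real) \<Rightarrow> (real^'n) set \<Rightarrow> bool" where
  C1_iff: "C1_on f S \<longleftrightarrow> (\<forall>x\<in>S. f differentiable at x) \<and> (\<forall>i. continuous_on S (partial i f))"

lemma Ck_on_imp_C1: "Ck_on (Suc k) f S \<Longrightarrow> C1_on f S"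
  using Ck_on_mono[of "Suc k" f S 1] by (auto simp: C1_iff)

lemma C1D:
  assumes "C1_on f S"
  shows "x \<in> S \<Longrightarrow> f differentiable at x" "continuous_on S (partial i f)" "continuous_on S f"
  using assms by (auto simp: C1_iff intro!: continuous_at_imp_continuous_on differentiable_imp_continuous_within)

lemma C1_cong:
  assumes "open S" "\<And>x. x \<in> S \<Longrightarrow> f x = g x"
  shows "C1_on f S \<longleftrightarrow> C1_on g S"
  unfolding C1_iff using assms partial_cong[OF assms(1), of _ f g] differentiable_cong_open[OF assms(1), of _ f g]
  by (auto cong: continuous_on_cong)

lemma C1_const [simp]: "C1_on (\<lambda>x. c) S"
  by (simp add: C1_iff)

lemma C1_coord [simp]: "C1_on (\<lambda>x. x $ i) S"
  by (simp add: C1_iff partial_coord[abs_def])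

lemma C1_add: "C1_on f S \<Longrightarrow> C1_on g S \<Longrightarrow> C1_on (\<lambda>x. f x + g x) S"
  unfolding C1_iff by (auto simp: partial_add cong: continuous_on_cong intro!: continuous_intros)

lemma C1_diff: "C1_on f S \<Longrightarrow> C1_on g S \<Longrightarrow> C1_on (\<lambda>x. f x - g x) S"
  unfolding C1_iff by (auto simp: partial_diff cong: continuous_on_cong intro!: continuous_intros)

lemma C1_mult:
  assumes "C1_on f S" "C1_on g S" shows "C1_on (\<lambda>x. f x * g x) S"
  unfolding C1_iff using C1D[OF assms(1)] C1D[OF assms(2)]
  by (auto simp: partial_mult cong: continuous_on_cong intro!: continuous_intros)

lemma C1_sum: "(\<And>i. i \<in> A \<Longrightarrow> C1_on (f i) S) \<Longrightarrow> C1_on (\<lambda>x. \<Sum>i\<in>A. f i x) S"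
  by (induction A rule: infinite_finite_induct) (simp_all add: C1_add)

lemma C1_prod: "(\<And>i. i \<in> A \<Longrightarrow> C1_on (f i) S) \<Longrightarrow> C1_on (\<lambda>x. \<Prod>i\<in>A. f i x) S"
  by (induction A rule: infinite_finite_induct) (simp_all add: C1_mult)

lemma C1_inverse:
  assumes "C1_on f S" "\<And>x. x \<in> S \<Longrightarrow> f x \<noteq> 0" shows "C1_on (\<lambda>x. inverse (f x)) S"
  unfolding C1_iff using C1D[OF assms(1)] assms(2)
  by (auto simp: partial_inverse cong: continuous_on_cong intro!: continuous_intros)

lemma C1_sqrt:
  assumes "C1_on f S" "\<And>x. x \<in> S \<Longrightarrow> f x > 0" shows "C1_on (\<lambda>x. sqrt (f x)) S"
  unfolding C1_iff using C1D[OF assms(1)] assms(2)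
  by (auto simp: partial_sqrt differentiable_sqrt_comp less_imp_neq[THEN not_sym] cong: continuous_on_cong intro!: continuous_intros)

lemma C1_det: "(\<And>i j. C1_on (\<lambda>x. M x $ i $ j) S) \<Longrightarrow> C1_on (\<lambda>x. det (M x)) S"
  unfolding det_def by (intro C1_sum C1_mult C1_prod C1_const)

section \<open>Matrices\<close>

lemma matrix_inv_mult:
  fixes A :: "real^'n^'n"
  assumes "invertible A"
  shows "A ** matrix_inv A = mat 1" "matrix_inv A ** A = mat 1"
  using assms unfolding invertible_def matrix_inv_def
  by (metis (mono_tags, lifting) someI_ex)+

text \<open>Cramer's rule for the column \<open>axis l 1\<close>. Entries of the inverse become
  rational in the entries of the matrix, so regularity and decay pass from the metric to its inverse
  through sums, products and reciprocals.\<close>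

lemma matrix_inv_entry:
  fixes A :: "real^'n^'n"
  assumes "det A \<noteq> 0"
  shows "matrix_inv A $ k $ l = det (\<chi> i j. if j = k then (if i = l then 1 else 0) else A $ i $ j) * inverse (det A)"
proof -
  have "invertible A" using assms invertible_det_nz by blast
  then have "A *v (matrix_inv A *v axis l 1) = axis l 1"
    by (simp add: matrix_vector_mul_assoc matrix_inv_mult)
  then have "matrix_inv A *v axis l 1 = (\<chi> k. det (\<chi> i j. if j = k then axis l 1 $ i else A $ i $ j) / det A)"
    using cramer[OF assms] by blast
  moreover have "(matrix_inv A *v axis l 1) $ k = matrix_inv A $ k $ l"
    by (simp add: matrix_vector_mult_basis column_def)
  ultimately show ?thesis
    by (simp add: axis_def divide_inverse eq_commute cong: if_cong)
qed

lemma C1_matrix_inv: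
  assumes "\<And>i j. C1_on (\<lambda>x. M x $ i $ j) S" "\<And>x. x \<in> S \<Longrightarrow> det (M x) \<noteq> 0" "open S"
  shows "C1_on (\<lambda>x. matrix_inv (M x) $ k $ l) S"
proof -
  have "C1_on (\<lambda>x. det (\<chi> i j. if j = k then (if i = l then 1 else 0) else M x $ i $ j) * inverse (det (M x))) S"
  proof (intro C1_mult C1_inverse C1_det assms)
    show "C1_on (\<lambda>x. (\<chi> i j. if j = k then if i = l then 1 else 0 else M x $ i $ j) $ i $ j) S" for i j
      using assms(1)[of i j] by (cases "j = k"; cases "i = l") auto
  qed auto
  then show ?thesis
    by (subst C1_cong[OF assms(3)]) (auto simp: matrix_inv_entry assms(2))
qed

section \<open>Positive definite matrices and determinants\<close>

definition sym_posdef :: "real^'n^'n::finite \<Rightarrow> bool" where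
  "sym_posdef A \<longleftrightarrow> transpose A = A \<and> (\<forall>v. v \<noteq> 0 \<longrightarrow> v \<bullet> (A *v v) > 0)"

lemma sym_posdef_invertible:
  assumes "sym_posdef A" shows "invertible A"
proof -
  have "A *v x = 0 \<Longrightarrow> x = 0" for x
    using assms unfolding sym_posdef_def by (metis inner_zero_right less_irrefl)
  then show ?thesis
    by (simp add: invertible_left_inverse matrix_left_invertible_ker)
qed

lemma sym_posdef_inv:
  assumes "sym_posdef A" shows "sym_posdef (matrix_inv A)"
proof -
  note inv = matrix_inv_mult[OF sym_posdef_invertible[OF assms]]
  have t: "transpose A = A" using assms by (simp add: sym_posdef_def)
  have "transpose (matrix_inv A) ** A = mat 1"
    using arg_cong[OF inv(1), of transpose] by (simp add: matrix_transpose_mul t)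
  then have "transpose (matrix_inv A) = matrix_inv A"
    by (metis inv(1) matrix_mul_assoc matrix_mul_lid matrix_mul_rid)
  moreover have "v \<bullet> (matrix_inv A *v v) > 0" if "v \<noteq> 0" for v
  proof -
    define u where "u = matrix_inv A *v v"
    have v: "v = A *v u" by (simp add: u_def matrix_vector_mul_assoc inv)
    then have "u \<noteq> 0" using that by auto
    then have "u \<bullet> (A *v u) > 0" using assms by (simp add: sym_posdef_def)
    then have "u \<bullet> v > 0" using v by metis
    then show ?thesis by (simp add: u_def inner_commute)
  qed
  ultimately show ?thesis by (simp add: sym_posdef_def)
qed

lemma segment_matrix_posdef:
  assumes "sym_posdef A" "0 \<le> t" "t \<le> 1"
  shows "sym_posdef ((1 - t) *\<^sub>R mat 1 + t *\<^sub>R A)"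
proof -
  have tr: "transpose (a + b) = transpose a + transpose b" for a b :: "real^'n^'n"
    by (simp add: transpose_def vec_eq_iff)
  have "v \<bullet> (((1 - t) *\<^sub>R mat 1 + t *\<^sub>R A) *v v) > 0" if "v \<noteq> 0" for v
  proof -
    have "v \<bullet> (((1 - t) *\<^sub>R mat 1 + t *\<^sub>R A) *v v) = (1 - t) * (v \<bullet> v) + t * (v \<bullet> (A *v v))"
      unfolding matrix_vector_mult_add_rdistrib inner_add_right scaleR_matrix_vector_assoc[symmetric] by simp
    moreover have "v \<bullet> v > 0" "v \<bullet> (A *v v) > 0" using that assms by (auto simp: sym_posdef_def)
    ultimately show ?thesis using assms
      by (cases "t = 0") (auto intro!: add_nonneg_pos)
  qed
  then show ?thesis using assms by (simp add: sym_posdef_def tr transpose_scalar)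
qed

text \<open>Every matrix on the segment from the identity to \<open>A\<close> is positive definite,
  hence invertible, so the determinant cannot change sign along it.\<close>

lemma det_sym_posdef:
  assumes "sym_posdef A" shows "det A > 0"
proof (rule ccontr)
  assume "\<not> det A > 0"
  define f where "f t = det ((1 - t) *\<^sub>R mat 1 + t *\<^sub>R A)" for t
  have "continuous_on {0..1} f"
    unfolding f_def det_def by (intro continuous_intros) 
  moreover have "f 0 = 1" "f 1 \<le> 0" using \<open>\<not> det A > 0\<close> by (auto simp: f_def)
  ultimately obtain t where "0 \<le> t" "t \<le> 1" "f t = 0"
    using IVT2'[of f 1 0 0] by auto
  then show False
    using segment_matrix_posdef[OF assms, of t] sym_posdef_invertible invertible_det_nz f_def by fastforce
qed

lemma matrix_algebra_simps:
  fixes A B C :: "real^'n^'n"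
  shows "A ** (B + C) = A ** B + A ** C" "(B + C) ** A = B ** A + C ** A"
    "A ** (B - C) = A ** B - A ** C" "(B - C) ** A = B ** A - C ** A"
    "(- B) ** A = - (B ** A)" "A ** (- B) = - (A ** B)"
    "A ** (c *\<^sub>R B) = c *\<^sub>R (A ** B)" "(c *\<^sub>R A) ** B = c *\<^sub>R (A ** B)"
    "transpose (A + B) = transpose A + transpose B" "transpose (A - B) = transpose A - transpose B"
    "transpose (- A) = - transpose A" "transpose (c *\<^sub>R A) = c *\<^sub>R transpose A"
  by (simp_all add: vec_eq_iff matrix_matrix_mult_def transpose_def sum.distrib sum_subtractf sum_negf
      distrib_left distrib_right left_diff_distrib right_diff_distrib sum_distrib_left mult_ac)

lemmas matrix_ring_simps = matrix_algebra_simps matrix_mul_assoc matrix_transpose_mul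

text \<open>The matrix determinant lemma. With \<open>S\<close> the identity whose row
  \<open>k\<close> is replaced by \<open>v\<close>, conjugation by \<open>S\<close> turns the rank
  one update into \<open>C\<close>, the identity with only column \<open>k\<close> altered; its
  determinant is the diagonal entry there. An index with \<open>v $ k \<noteq> 0\<close> makes
  \<open>S\<close> invertible.\<close>

lemma det_rank_one:
  fixes u v :: "real^'n"
  shows "det (mat 1 + (\<chi> i j. u $ i * v $ j)) = 1 + u \<bullet> v"
proof (cases "v = 0")
  case True
  then have "(\<chi> i j. u $ i * v $ j) = (0::real^'n^'n)" by (simp add: vec_eq_iff)
  then show ?thesis using True by simp
next
  case False
  then obtain k where k: "v $ k \<noteq> 0" by (auto simp: vec_eq_iff)
  define S :: "real^'n^'n" where "S = (\<chi> i. if i = k then v else axis i 1)"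
  have "S = (\<chi> i. if i = k then (\<Sum>j\<in>UNIV. v $ j *s row j (mat 1)) else row i (mat 1))"
    by (simp add: S_def vec_eq_iff row_def mat_def axis_def if_distrib[of "\<lambda>a. _ * a"] cong: if_cong)
  then have detS: "det S = v $ k"
    using cramer_lemma_transpose[of k v "mat 1"] by simp
  define C :: "real^'n^'n" where "C = (\<chi> i j. if j = k then (axis k 1 + S *v u) $ i else mat 1 $ i $ j)"
  have "det C = (axis k 1 + S *v u) $ k"
    using cramer_lemma[of k "mat 1" "axis k 1 + S *v u"] unfolding C_def matrix_vector_mul_lid det_I by simp
  also have "\<dots> = 1 + u \<bullet> v"
    by (simp add: S_def matrix_vector_mult_def inner_vec_def mult.commute)
  finally have detC: "det C = 1 + u \<bullet> v" .
  have Suv: "S ** (\<chi> i j. u $ i * v $ j) = (\<chi> i j. (S *v u) $ i * v $ j)"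
    by (simp add: matrix_matrix_mult_def matrix_vector_mult_def vec_eq_iff sum_distrib_right mult.assoc)
  have Cd: "C = mat 1 + (\<chi> i j. (S *v u) $ i * (if j = k then 1 else 0))"
    by (auto simp: C_def vec_eq_iff mat_def axis_def)
  have "(\<chi> i j. (S *v u) $ i * (if j = k then 1 else 0)) ** S = (\<chi> i j. (S *v u) $ i * v $ j)"
    by (simp add: matrix_matrix_mult_def vec_eq_iff S_def if_distrib[of "\<lambda>a. _ * a"] if_distrib[of "\<lambda>a. a * _"] cong: if_cong)
  then have "S ** (mat 1 + (\<chi> i j. u $ i * v $ j)) = C ** S"
    by (simp add: Cd matrix_ring_simps Suv)
  then have "det S * det (mat 1 + (\<chi> i j. u $ i * v $ j)) = det C * det S"
    by (metis det_mul)
  then show ?thesis using k detS detC by simp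
qed

section \<open>Matrix fields\<close>

definition dmat :: "'n \<Rightarrow> (real^'n::finite \<Rightarrow> real^'n^'n) \<Rightarrow> real^'n \<Rightarrow> real^'n^'n" where
  "dmat k M x = (\<chi> i j. partial k (\<lambda>y. M y $ i $ j) x)"

definition mdiff :: "(real^'n::finite \<Rightarrow> real^'n^'n) \<Rightarrow> real^'n \<Rightarrow> bool" where
  "mdiff M x \<longleftrightarrow> (\<forall>i j. (\<lambda>y. M y $ i $ j) differentiable at x)"

lemma dmat_cong:
  assumes "open S" "x \<in> S" "\<And>y. y \<in> S \<Longrightarrow> M y = N y"
  shows "dmat k M x = dmat k N x"
  unfolding dmat_def using partial_cong[OF assms(1,2), of "\<lambda>y. M y $ _ $ _" "\<lambda>y. N y $ _ $ _"] assms(3)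
  by (simp add: vec_eq_iff)

lemma mdiff_mult: "mdiff M x \<Longrightarrow> mdiff N x \<Longrightarrow> mdiff (\<lambda>y. M y ** N y) x"
  by (simp add: mdiff_def matrix_matrix_mult_def)

lemma mdiff_transpose: "mdiff M x \<Longrightarrow> mdiff (\<lambda>y. transpose (M y)) x"
  by (simp add: mdiff_def transpose_def)

lemma mdiff_scale: "w differentiable at x \<Longrightarrow> mdiff M x \<Longrightarrow> mdiff (\<lambda>y. w y *\<^sub>R M y) x"
  by (simp add: mdiff_def)

lemma dmat_mult:
  assumes "mdiff M x" "mdiff N x"
  shows "dmat k (\<lambda>y. M y ** N y) x = dmat k M x ** N x + M x ** dmat k N x"
  using assms by (simp add: dmat_def mdiff_def matrix_matrix_mult_def vec_eq_iff partial_sum partial_mult sum.distrib)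

lemma dmat_add:
  assumes "mdiff M x" "mdiff N x"
  shows "dmat k (\<lambda>y. M y + N y) x = dmat k M x + dmat k N x"
  using assms by (simp add: dmat_def mdiff_def vec_eq_iff partial_add)

lemma dmat_diff:
  assumes "mdiff M x" "mdiff N x"
  shows "dmat k (\<lambda>y. M y - N y) x = dmat k M x - dmat k N x"
  using assms by (simp add: dmat_def mdiff_def vec_eq_iff partial_diff)

lemma dmat_transpose: "dmat k (\<lambda>y. transpose (M y)) x = transpose (dmat k M x)"
  by (simp add: dmat_def transpose_def vec_eq_iff)

lemma dmat_commute:
  assumes "open S" "x \<in> S" "\<And>i j. Ck_on 2 (\<lambda>y. M y $ i $ j) S"
  shows "dmat a (dmat b M) x = dmat b (dmat a M) x"
  using partial_commute[OF assms] by (simp add: dmat_def vec_eq_iff)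

lemma transpose_component [simp]: "transpose A $ i $ j = A $ j $ i"
  by (simp add: transpose_def)

section \<open>The Levi-Civita connection\<close>

text \<open>\<open>Gam G i\<close> is the connection matrix in direction \<open>i\<close>, with rows indexed by the upper index.\<close>

definition Gam :: "(real^'n::finite \<Rightarrow> real^'n^'n) \<Rightarrow> 'n \<Rightarrow> real^'n \<Rightarrow> real^'n^'n" where
  "Gam G i x = (\<chi> k l. christoffel G k i l x)"

text \<open>The Christoffel symbols of the first kind: lowering the upper index removes the inverse
  metric from the formula.\<close>

lemma metric_mult_Gam:
  assumes "invertible (G x)"
  shows "(G x ** Gam G k x) $ j $ i =
    (dmat k G x $ i $ j + dmat i G x $ k $ j - dmat j G x $ k $ i) / 2"
proof -
  define L where "L l = (dmat k G x $ i $ l + dmat i G x $ k $ l - dmat l G x $ k $ i) / 2" for l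
  have "Gam G k x $ m $ i = (matrix_inv (G x) *v (\<chi> l. L l)) $ m" for m
    by (simp add: Gam_def christoffel_def L_def dmat_def matrix_vector_mult_def sum_divide_distrib)
  then have "(G x ** Gam G k x) $ j $ i = (G x *v (matrix_inv (G x) *v (\<chi> l. L l))) $ j"
    by (simp add: matrix_matrix_mult_def matrix_vector_mult_def)
  also have "\<dots> = L j"
    by (simp add: matrix_vector_mul_assoc matrix_inv_mult[OF assms])
  finally show ?thesis by (simp add: L_def)
qed

text \<open>Uniqueness of the torsion-free (\<open>sym\<close>) metric (\<open>compat\<close>)
  connection: with the index lowered, the assumptions are linear equations solved only by Koszul's
  formula. It serves to recognise the pulled back connection in \<open>J_Gam\<close>.\<close>

lemma levi_civita_unique:
  assumes inv: "invertible (G x)" and sym: "\<And>k i j. L k $ i $ j = L j $ i $ k"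
    and compat: "\<And>k. dmat k G x = transpose (L k) ** G x + G x ** L k"
    and G: "transpose (G x) = G x"
  shows "L k = Gam G k x"
proof -
  have tG: "(transpose (L k) ** G x) $ i $ j = (G x ** L k) $ j $ i" for k i j
    using matrix_transpose_mul[of "G x" "L k"] G by (metis transpose_component)
  have swap: "(G x ** L k) $ i $ j = (G x ** L j) $ i $ k" for k i j
    by (simp add: matrix_matrix_mult_def sym[of k _ j])
  \<comment> \<open>The six index swaps are the ones that enter the alternating sum of Koszul's
    formula.\<close>
  have "(G x ** L k) $ j $ i = (G x ** Gam G k x) $ j $ i" for i j
    unfolding metric_mult_Gam[where G=G and x=x, OF inv] compat vector_add_component tG
    using swap[of k i j] swap[of k j i] swap[of i k j] swap[of j k i] swap[of i j k] swap[of j i k] by argo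
  then have "G x ** L k = G x ** Gam G k x" by (simp add: vec_eq_iff)
  then have "matrix_inv (G x) ** G x ** L k = matrix_inv (G x) ** G x ** Gam G k x"
    by (simp add: matrix_mul_assoc[symmetric])
  then show ?thesis by (simp add: matrix_inv_mult[OF inv])
qed

text \<open>The curvature as a matrix-valued 2-form with form indices \<open>a\<close> and
  \<open>b\<close>: entry \<open>c\<close>, \<open>d\<close> is R^c_dab.\<close>

definition curv :: "(real^'n::finite \<Rightarrow> real^'n^'n) \<Rightarrow> 'n \<Rightarrow> 'n \<Rightarrow> real^'n \<Rightarrow> real^'n^'n" where
  "curv G a b x = dmat a (Gam G b) x - dmat b (Gam G a) x
     + Gam G a x ** Gam G b x - Gam G b x ** Gam G a x"

locale metric_field =
  fixes G :: "real^'n::finite \<Rightarrow> real^'n^'n" and S :: "(real^'n) set"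
  assumes open_S: "open S"
    and spd: "x \<in> S \<Longrightarrow> sym_posdef (G x)"
    and C2: "Ck_on 2 (\<lambda>x. G x $ i $ j) S"
begin

lemma invertible_G: "x \<in> S \<Longrightarrow> invertible (G x)"
  using spd sym_posdef_invertible by blast

lemma transpose_G: "x \<in> S \<Longrightarrow> transpose (G x) = G x"
  using spd by (simp add: sym_posdef_def)

lemma transpose_Ginv: "x \<in> S \<Longrightarrow> transpose (matrix_inv (G x)) = matrix_inv (G x)"
  using sym_posdef_inv[OF spd] by (simp add: sym_posdef_def)

lemma det_pos: "x \<in> S \<Longrightarrow> det (G x) > 0"
  using spd det_sym_posdef by blast

lemma C1_G: "C1_on (\<lambda>x. G x $ i $ j) S"
  by (rule Ck_on_imp_C1[of 1]) (use C2[of i j] in \<open>simp add: numeral_2_eq_2\<close>)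

lemma C1_dG: "C1_on (partial k (\<lambda>x. G x $ i $ j)) S"
  by (rule Ck_on_imp_C1[of 0]) (use C2[of i j] in \<open>simp add: numeral_2_eq_2\<close>)

lemma C1_Ginv: "C1_on (\<lambda>x. matrix_inv (G x) $ i $ j) S"
  by (intro C1_matrix_inv C1_G open_S) (use det_pos in force)

lemma C1_Gam: "C1_on (\<lambda>x. Gam G k x $ i $ j) S"
  unfolding Gam_def christoffel_def vec_lambda_beta
  by (intro C1_mult C1_const C1_sum C1_Ginv C1_dG C1_add C1_diff)

lemma C1_sqrt_det: "C1_on (\<lambda>x. sqrt (det (G x))) S"
  by (intro C1_sqrt C1_det C1_G det_pos)

lemma mdiff_G: "x \<in> S \<Longrightarrow> mdiff G x"
  unfolding mdiff_def using C1D(1)[OF C1_G] by blast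

lemma mdiff_Ginv: "x \<in> S \<Longrightarrow> mdiff (\<lambda>x. matrix_inv (G x)) x"
  unfolding mdiff_def using C1D(1)[OF C1_Ginv] by blast

lemma mdiff_Gam: "x \<in> S \<Longrightarrow> mdiff (Gam G k) x"
  unfolding mdiff_def using C1D(1)[OF C1_Gam] by blast

lemma dmat_G_sym: "x \<in> S \<Longrightarrow> dmat k G x $ i $ j = dmat k G x $ j $ i"
  using dmat_cong[OF open_S, of x "\<lambda>y. transpose (G y)" G k] transpose_G
  by (metis dmat_transpose transpose_component)

lemma Gam_sym: "x \<in> S \<Longrightarrow> Gam G k x $ i $ j = Gam G j x $ i $ k"
  using dmat_G_sym[of x _ j k]
  by (simp add: Gam_def christoffel_def dmat_def add.commute)

lemma compatible:
  assumes "x \<in> S"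
  shows "dmat k G x = transpose (Gam G k x) ** G x + G x ** Gam G k x"
proof -
  have tG: "(transpose (Gam G k x) ** G x) $ i $ j = (G x ** Gam G k x) $ j $ i" for i j
    using matrix_transpose_mul[of "G x" "Gam G k x"] transpose_G[OF assms] by (metis transpose_component)
  have "dmat k G x $ i $ j = (transpose (Gam G k x) ** G x + G x ** Gam G k x) $ i $ j" for i j
    unfolding vector_add_component tG metric_mult_Gam[where G=G and x=x, OF invertible_G[OF assms]]
    using dmat_G_sym[OF assms, of k i j] by (simp add: field_simps)
  then show ?thesis by (simp add: vec_eq_iff)
qed

text \<open>The two orders of the second derivative of the metric agree. Expanded through
  compatibility, the products that have the metric between a transposed and a plain connection
  matrix are symmetric in \<open>a\<close> and \<open>b\<close> and cancel, leaving the curvature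
  and its transpose.\<close>

lemma curv_skew:
  assumes x: "x \<in> S"
  shows "transpose (curv G a b x) ** G x + G x ** curv G a b x = 0"
proof -
  have dd: "dmat a (dmat b G) x =
      transpose (dmat a (Gam G b) x) ** G x
      + transpose (Gam G b x) ** (transpose (Gam G a x) ** G x + G x ** Gam G a x)
      + (transpose (Gam G a x) ** G x + G x ** Gam G a x) ** Gam G b x
      + G x ** dmat a (Gam G b) x" for a b
  proof -
    have "dmat a (dmat b G) x = dmat a (\<lambda>x. transpose (Gam G b x) ** G x + G x ** Gam G b x) x"
      by (rule dmat_cong[OF open_S x compatible])
    then show ?thesis
      using x by (simp add: dmat_add dmat_mult dmat_transpose mdiff_mult mdiff_transpose mdiff_G
          mdiff_Gam add.assoc flip: compatible)
  qed
  have "dmat a (dmat b G) x = dmat b (dmat a G) x"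
    by (rule dmat_commute[OF open_S x C2])
  then show ?thesis
    unfolding dd curv_def matrix_ring_simps by (simp add: algebra_simps)
qed

text \<open>The curvature with one index raised, R^cd_ab. Skewness in \<open>c\<close> and
  \<open>d\<close>, which \<open>curv\<close> has only relative to the metric, becomes skewness of
  the matrix itself.\<close>

definition riem :: "'n \<Rightarrow> 'n \<Rightarrow> real^'n \<Rightarrow> real^'n^'n" where
  "riem a b x = curv G a b x ** matrix_inv (G x)"

lemma riem_antisym:
  assumes x: "x \<in> S"
  shows "riem a b x $ c $ d = - riem a b x $ d $ c" "riem a b x = - riem b a x"
proof -
  let ?H = "matrix_inv (G x)"
  have "?H ** (transpose (curv G a b x) ** G x + G x ** curv G a b x) ** ?H = 0"
    by (simp add: curv_skew[OF x])
  then have "?H ** transpose (curv G a b x) ** (G x ** ?H) + ?H ** G x ** curv G a b x ** ?H = 0"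
    unfolding matrix_ring_simps .
  then have "?H ** transpose (curv G a b x) + curv G a b x ** ?H = 0"
    by (simp add: matrix_inv_mult[OF invertible_G[OF x]])
  then have "transpose (riem a b x) = - riem a b x"
    unfolding riem_def matrix_transpose_mul transpose_Ginv[OF x] by (simp add: eq_neg_iff_add_eq_0)
  then show "riem a b x $ c $ d = - riem a b x $ d $ c"
    by (metis transpose_component vector_uminus_component)
  show "riem a b x = - riem b a x"
  proof -
    have "curv G a b x = - curv G b a x" by (simp add: curv_def)
    then show ?thesis unfolding riem_def by (metis matrix_algebra_simps(5))
  qed
qed

text \<open>The trace is the contraction of a skew matrix with the symmetric metric. It is the one
  term of the traced Bianchi identity that is not a Ricci component.\<close>

lemma curv_trace:
  assumes x: "x \<in> S" shows "(\<Sum>k\<in>UNIV. curv G a b x $ k $ k) = 0"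
proof -
  have t: "trace (A ** B) = trace (B ** A)" for A B :: "real^'n^'n"
    by (rule trace_mul_sym)
  have "curv G a b x = riem a b x ** G x"
    by (simp add: riem_def matrix_inv_mult[OF invertible_G[OF x]] flip: matrix_mul_assoc)
  then have "trace (curv G a b x) = (\<Sum>i\<in>UNIV. \<Sum>j\<in>UNIV. riem a b x $ i $ j * G x $ j $ i)"
    by (simp add: trace_def matrix_matrix_mult_def)
  also have "\<dots> = (\<Sum>i\<in>UNIV. \<Sum>j\<in>UNIV. - riem a b x $ j $ i * G x $ i $ j)"
  proof (intro sum.cong refl)
    fix i j show "riem a b x $ i $ j * G x $ j $ i = - riem a b x $ j $ i * G x $ i $ j"
      using riem_antisym(1)[OF x, of a b i j] transpose_G[OF x] by (metis transpose_component)
  qed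
  also have "\<dots> = - (\<Sum>i\<in>UNIV. \<Sum>j\<in>UNIV. riem a b x $ i $ j * G x $ j $ i)"
    by (subst sum.swap) (simp add: sum_negf)
  finally have "trace (curv G a b x) = - (\<Sum>i\<in>UNIV. \<Sum>j\<in>UNIV. riem a b x $ i $ j * G x $ j $ i)" .
  then show ?thesis using \<open>trace (curv G a b x) = (\<Sum>i\<in>UNIV. \<Sum>j\<in>UNIV. riem a b x $ i $ j * G x $ j $ i)\<close>
    by (simp add: trace_def)
qed

lemma dmat_Gam_sym: "x \<in> S \<Longrightarrow> dmat a (Gam G k) x $ i $ j = dmat a (Gam G j) x $ i $ k"
  unfolding dmat_def vec_lambda_beta by (rule partial_cong[OF open_S]) (simp_all add: Gam_sym[of _ k i j])

text \<open>A consequence of torsion-freeness: once symmetric lower indices of the connection are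
  exchanged, every term of the cyclic sum meets its negative.\<close>

lemma bianchi:
  assumes x: "x \<in> S"
  shows "curv G a b x $ c $ d + curv G b d x $ c $ a + curv G d a x $ c $ b = 0"
proof -
  have s: "(Gam G a x ** Gam G b x) $ c $ d = (Gam G a x ** Gam G d x) $ c $ b" for a b d
    by (simp add: matrix_matrix_mult_def Gam_sym[OF x, of b _ d])
  show ?thesis
    unfolding curv_def vector_add_component vector_minus_component
    using s[of a b d] s[of b a d] s[of d a b] dmat_Gam_sym[OF x, of a b c d]
      dmat_Gam_sym[OF x, of b a c d] dmat_Gam_sym[OF x, of d a c b] by simp
qed

lemma ricci_curv:
  assumes x: "x \<in> S"
  shows "ricci G x $ i $ j = (\<Sum>k\<in>UNIV. curv G k j x $ k $ i)"
proof -
  have d1: "partial k (christoffel G k i j) x = dmat k (Gam G j) x $ k $ i" for k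
    using dmat_Gam_sym[OF x, of k j k i] by (simp add: dmat_def Gam_def)
  have d2: "partial j (christoffel G k i k) x = dmat j (Gam G k) x $ k $ i" for k
    using dmat_Gam_sym[OF x, of j k k i] by (simp add: dmat_def Gam_def)
  have g1: "christoffel G l i j x = Gam G j x $ l $ i" "christoffel G l i k x = Gam G k x $ l $ i" for l k
    using Gam_sym[OF x, of _ l i] by (simp_all add: Gam_def)
  show ?thesis
    unfolding ricci_def vec_lambda_beta d1 d2 g1 curv_def
    by (simp add: Gam_def matrix_matrix_mult_def sum.distrib sum_subtractf)
qed

text \<open>The first Bianchi identity traced over its upper index: one term is the trace of the
  curvature, which vanishes, and the other two are the Ricci components in the two index orders,
  with opposite signs.\<close>

lemma ricci_sym:
  assumes x: "x \<in> S" shows "ricci G x $ i $ j = ricci G x $ j $ i"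
proof -
  have "(\<Sum>k\<in>UNIV. curv G i j x $ k $ k + curv G j k x $ k $ i + curv G k i x $ k $ j) = 0"
    using bianchi[OF x, of i j _ _] by simp
  moreover have "curv G j k x $ k $ i = - curv G k j x $ k $ i" for k
    by (simp add: curv_def)
  ultimately show ?thesis
    by (simp add: ricci_curv[OF x] sum.distrib sum_subtractf curv_trace[OF x])
qed

lemma scal_riem:
  assumes x: "x \<in> S"
  shows "scal G x = (\<Sum>k\<in>UNIV. \<Sum>j\<in>UNIV. riem k j x $ k $ j)"
proof -
  have "scal G x = (\<Sum>i\<in>UNIV. \<Sum>j\<in>UNIV. \<Sum>k\<in>UNIV. curv G k j x $ k $ i * matrix_inv (G x) $ i $ j)"
    unfolding scal_def ricci_curv[OF x] by (simp add: sum_distrib_left mult.commute)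
  also have "\<dots> = (\<Sum>j\<in>UNIV. \<Sum>i\<in>UNIV. \<Sum>k\<in>UNIV. curv G k j x $ k $ i * matrix_inv (G x) $ i $ j)"
    by (rule sum.swap)
  also have "\<dots> = (\<Sum>j\<in>UNIV. \<Sum>k\<in>UNIV. \<Sum>i\<in>UNIV. curv G k j x $ k $ i * matrix_inv (G x) $ i $ j)"
    by (intro sum.cong refl sum.swap)
  also have "\<dots> = (\<Sum>k\<in>UNIV. \<Sum>j\<in>UNIV. \<Sum>i\<in>UNIV. curv G k j x $ k $ i * matrix_inv (G x) $ i $ j)"
    by (rule sum.swap)
  finally show ?thesis by (simp add: riem_def matrix_matrix_mult_def)
qed

section \<open>The divergence structure of the Einstein tensor\<close>

text \<open>Since the curvature is \<open>d\<Gamma> + \<Gamma> \<and> \<Gamma>\<close> for the matrix of 1-forms \<open>\<Gamma>\<close>, raising an index and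
  multiplying by \<open>wt\<close> before differentiating only costs terms quadratic in first derivatives.
  They are collected in \<open>Qrem\<close>.\<close>

definition wt :: "real^'n \<Rightarrow> real" where "wt x = sqrt (det (G x))"

definition Bpot :: "'n \<Rightarrow> real^'n \<Rightarrow> real^'n^'n" where
  "Bpot b x = Gam G b x ** (wt x *\<^sub>R matrix_inv (G x))"

text \<open>\<open>riem\<close> is skew in its raised pair, so its potential may be made skew as
  well. No factor 1/2 is taken here; it reappears as the 2 in
  \<open>riem_divergence\<close>.\<close>

definition Apot :: "'n \<Rightarrow> real^'n \<Rightarrow> real^'n^'n" where
  "Apot b x = Bpot b x - transpose (Bpot b x)"

definition qrem :: "'n \<Rightarrow> 'n \<Rightarrow> real^'n \<Rightarrow> real^'n^'n" where
  "qrem a b x = (Gam G a x ** Gam G b x - Gam G b x ** Gam G a x) ** (wt x *\<^sub>R matrix_inv (G x))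
     - Gam G b x ** dmat a (\<lambda>y. wt y *\<^sub>R matrix_inv (G y)) x
     + Gam G a x ** dmat b (\<lambda>y. wt y *\<^sub>R matrix_inv (G y)) x"

definition Qrem :: "'n \<Rightarrow> 'n \<Rightarrow> real^'n \<Rightarrow> real^'n^'n" where
  "Qrem a b x = qrem a b x - transpose (qrem a b x)"

lemma C1_wt: "C1_on wt S"
  using C1_sqrt_det by (simp add: wt_def[abs_def])

lemma C1_Apot: "C1_on (\<lambda>x. Apot b x $ i $ j) S"
  unfolding Apot_def Bpot_def matrix_matrix_mult_def transpose_def vector_minus_component vec_lambda_beta
    vector_scaleR_component real_scaleR_def
  by (intro C1_diff C1_sum C1_mult C1_Gam C1_wt C1_Ginv)

lemma mdiff_wtGinv: "x \<in> S \<Longrightarrow> mdiff (\<lambda>y. wt y *\<^sub>R matrix_inv (G y)) x"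
  using C1D(1)[OF C1_wt] by (intro mdiff_scale mdiff_Ginv) auto

lemma mdiff_Bpot: "x \<in> S \<Longrightarrow> mdiff (Bpot b) x"
  unfolding Bpot_def[abs_def] by (intro mdiff_mult mdiff_Gam mdiff_wtGinv)

lemma Apot_antisym: "Apot b x $ i $ j = - Apot b x $ j $ i"
  by (simp add: Apot_def)

lemma dmat_Apot_antisym: "x \<in> S \<Longrightarrow> dmat a (Apot b) x $ i $ j = - dmat a (Apot b) x $ j $ i"
proof -
  assume "x \<in> S"
  have "partial a (\<lambda>y. Apot b y $ i $ j) x = partial a (\<lambda>y. - Apot b y $ j $ i) x"
    using Apot_antisym[of b _ i j] by simp
  also have "\<dots> = - partial a (\<lambda>y. Apot b y $ j $ i) x"
    by (rule partial_minus[OF C1D(1)[OF C1_Apot \<open>x \<in> S\<close>]])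
  finally show ?thesis by (simp add: dmat_def)
qed

text \<open>Up to \<open>qrem\<close>, \<open>wt x *\<^sub>R riem a b x\<close> is the exterior
  derivative of \<open>Bpot\<close>: with K the weighted inverse metric, d(\<Gamma> K) and
  (d\<Gamma>) K differ by products of \<Gamma> with derivatives of K. Subtracting the equation with
  \<open>c\<close> and \<open>d\<close> exchanged doubles the left side and makes the potential
  skew.\<close>

lemma riem_divergence:
  assumes x: "x \<in> S"
  shows "2 * wt x * riem a b x $ c $ d
    = dmat a (Apot b) x $ c $ d - dmat b (Apot a) x $ c $ d + Qrem a b x $ c $ d"
proof -
  have dB: "dmat a (Bpot b) x = dmat a (Gam G b) x ** (wt x *\<^sub>R matrix_inv (G x))
      + Gam G b x ** dmat a (\<lambda>y. wt y *\<^sub>R matrix_inv (G y)) x" for a b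
    unfolding Bpot_def[abs_def] by (rule dmat_mult[OF mdiff_Gam[OF x] mdiff_wtGinv[OF x]])
  have r: "wt x *\<^sub>R riem a b x = dmat a (Bpot b) x - dmat b (Bpot a) x + qrem a b x"
    unfolding dB qrem_def riem_def curv_def matrix_ring_simps by (simp add: algebra_simps)
  have dA: "dmat a (Apot b) x = dmat a (Bpot b) x - transpose (dmat a (Bpot b) x)" for a b
    unfolding Apot_def[abs_def]
    by (simp add: dmat_diff mdiff_Bpot[OF x] mdiff_transpose dmat_transpose)
  have e: "wt x * riem a b x $ c $ d = dmat a (Bpot b) x $ c $ d - dmat b (Bpot a) x $ c $ d + qrem a b x $ c $ d" for c d
    using arg_cong[OF r, of "\<lambda>m. m $ c $ d"] by simp
  have "wt x * riem a b x $ d $ c = - (wt x * riem a b x $ c $ d)"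
    using riem_antisym(1)[OF x, of a b d c] by simp
  then show ?thesis
    using e[of c d] e[of d c] by (simp add: dA Qrem_def)
qed

text \<open>The two derivative sums obtained by tracing \<open>riem_divergence\<close> are negatives
  of each other by skewness of \<open>Apot\<close>, which absorbs the factor 2. The weighted scalar
  curvature is thereby the divergence of a vector potential plus a quadratic term.\<close>

lemma scal_divergence:
  assumes x: "x \<in> S"
  shows "wt x * scal G x = (\<Sum>a\<in>UNIV. \<Sum>d\<in>UNIV. dmat a (Apot d) x $ a $ d)
    + (\<Sum>a\<in>UNIV. \<Sum>d\<in>UNIV. Qrem a d x $ a $ d) / 2"
proof -
  have "2 * (wt x * scal G x) = (\<Sum>a\<in>UNIV. \<Sum>d\<in>UNIV. 2 * wt x * riem a d x $ a $ d)"
    by (simp add: scal_riem[OF x] sum_distrib_left mult.assoc)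
  also have "\<dots> = (\<Sum>a\<in>UNIV. \<Sum>d\<in>UNIV. dmat a (Apot d) x $ a $ d) - (\<Sum>a\<in>UNIV. \<Sum>d\<in>UNIV. dmat d (Apot a) x $ a $ d)
     + (\<Sum>a\<in>UNIV. \<Sum>d\<in>UNIV. Qrem a d x $ a $ d)"
    by (simp add: riem_divergence[OF x] sum.distrib sum_subtractf)
  also have "(\<Sum>a\<in>UNIV. \<Sum>d\<in>UNIV. dmat d (Apot a) x $ a $ d) = - (\<Sum>a\<in>UNIV. \<Sum>d\<in>UNIV. dmat a (Apot d) x $ a $ d)"
  proof -
    have "(\<Sum>a\<in>UNIV. \<Sum>d\<in>UNIV. dmat d (Apot a) x $ a $ d) = (\<Sum>d\<in>UNIV. \<Sum>a\<in>UNIV. dmat d (Apot a) x $ a $ d)"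
      by (rule sum.swap)
    also have "\<dots> = (\<Sum>d\<in>UNIV. \<Sum>a\<in>UNIV. - dmat d (Apot a) x $ d $ a)"
      by (intro sum.cong refl dmat_Apot_antisym x)
    finally show ?thesis by (simp add: sum_negf)
  qed
  finally show ?thesis by simp
qed

text \<open>The normal is entered as the inverse metric applied to a covector \<open>\<nu>\<close>,
  the form in which normal times area density occurs; the metric in the scalar term then cancels and
  leaves \<open>X \<bullet> \<nu>\<close>.\<close>

lemma einstein_riem:
  assumes x: "x \<in> S"
  shows "X \<bullet> (einstein G x *v (matrix_inv (G x) *v \<nu>)) =
    (\<Sum>i\<in>UNIV. \<Sum>k\<in>UNIV. \<Sum>l\<in>UNIV. X $ i * riem k i x $ k $ l * \<nu> $ l) - scal G x / 2 * (X \<bullet> \<nu>)"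
proof -
  have "(ricci G x ** matrix_inv (G x)) $ i $ l = (\<Sum>k\<in>UNIV. riem k i x $ k $ l)" for i l
  proof -
    have "(ricci G x ** matrix_inv (G x)) $ i $ l = (\<Sum>j\<in>UNIV. (\<Sum>k\<in>UNIV. curv G k i x $ k $ j) * matrix_inv (G x) $ j $ l)"
      by (simp add: matrix_matrix_mult_def ricci_sym[OF x, of i] ricci_curv[OF x, of _ i])
    also have "\<dots> = (\<Sum>k\<in>UNIV. riem k i x $ k $ l)"
      unfolding sum_distrib_right riem_def matrix_matrix_mult_def vec_lambda_beta by (rule sum.swap)
    finally show ?thesis .
  qed
  then have r: "X \<bullet> (ricci G x *v (matrix_inv (G x) *v \<nu>)) = (\<Sum>i\<in>UNIV. \<Sum>l\<in>UNIV. \<Sum>k\<in>UNIV. X $ i * riem k i x $ k $ l * \<nu> $ l)"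
    unfolding matrix_vector_mul_assoc
    by (simp add: inner_vec_def matrix_vector_mult_def sum_distrib_left sum_distrib_right mult.assoc)
  have "(\<Sum>i\<in>UNIV. \<Sum>l\<in>UNIV. \<Sum>k\<in>UNIV. X $ i * riem k i x $ k $ l * \<nu> $ l) = (\<Sum>i\<in>UNIV. \<Sum>k\<in>UNIV. \<Sum>l\<in>UNIV. X $ i * riem k i x $ k $ l * \<nu> $ l)"
    by (intro sum.cong refl sum.swap)
  moreover have "einstein G x *v (matrix_inv (G x) *v \<nu>) = ricci G x *v (matrix_inv (G x) *v \<nu>) - (scal G x / 2) *\<^sub>R \<nu>"
    by (simp add: einstein_def matrix_vector_mul_assoc matrix_algebra_simps matrix_inv_mult[OF invertible_G[OF x]]
       matrix_vector_mult_diff_rdistrib scaleR_matrix_vector_assoc[symmetric])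
  ultimately show ?thesis using r by (simp add: inner_diff_right)
qed

text \<open>The large bracket is the divergence over \<open>a\<close> of the skew field X^k W^a -
  X^a W^k + X^i A_i^ka, with A the potential \<open>Apot\<close> and W its trace, as far as
  derivatives fall on the potentials. Only the terms that differentiate \<open>X\<close> are missing
  from the full divergence.\<close>

lemma einstein_divergence:
  fixes X \<nu> :: "real^'n"
  assumes x: "x \<in> S"
  shows "wt x * (X \<bullet> (einstein G x *v (matrix_inv (G x) *v \<nu>))) =
    - (\<Sum>k\<in>UNIV. \<nu> $ k * (X $ k * (\<Sum>a\<in>UNIV. \<Sum>d\<in>UNIV. dmat a (Apot d) x $ a $ d)
         - (\<Sum>a\<in>UNIV. \<Sum>d\<in>UNIV. X $ a * dmat a (Apot d) x $ k $ d)
         + (\<Sum>a\<in>UNIV. \<Sum>d\<in>UNIV. X $ a * dmat d (Apot a) x $ k $ d))) / 2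
    - (X \<bullet> \<nu>) * (\<Sum>a\<in>UNIV. \<Sum>d\<in>UNIV. Qrem a d x $ a $ d) / 4
    + (\<Sum>k\<in>UNIV. \<Sum>a\<in>UNIV. \<Sum>d\<in>UNIV. \<nu> $ k * X $ a * Qrem a d x $ k $ d) / 2"
proof -
  define P where "P = (\<Sum>a\<in>UNIV. \<Sum>d\<in>UNIV. dmat a (Apot d) x $ a $ d)"
  define Q where "Q = (\<Sum>a\<in>UNIV. \<Sum>d\<in>UNIV. Qrem a d x $ a $ d)"
  have ws: "wt x * scal G x = P + Q / 2"
    using scal_divergence[OF x] by (simp add: P_def Q_def)
  \<comment> \<open>Each of the two antisymmetric pairs contributes one sign.\<close>
  have sw: "riem k a x $ k $ l = riem a k x $ l $ k" for k a l
    using riem_antisym[OF x] by (metis add.inverse_inverse vector_uminus_component)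
  have k: "(\<Sum>a\<in>UNIV. \<Sum>d\<in>UNIV. X $ a * dmat a (Apot d) x $ k $ d)
         - (\<Sum>a\<in>UNIV. \<Sum>d\<in>UNIV. X $ a * dmat d (Apot a) x $ k $ d)
       = 2 * wt x * (\<Sum>a\<in>UNIV. \<Sum>d\<in>UNIV. X $ a * riem a d x $ k $ d)
         - (\<Sum>a\<in>UNIV. \<Sum>d\<in>UNIV. X $ a * Qrem a d x $ k $ d)" for k
  proof -
    have "X $ a * dmat a (Apot d) x $ k $ d - X $ a * dmat d (Apot a) x $ k $ d
      = 2 * wt x * (X $ a * riem a d x $ k $ d) - X $ a * Qrem a d x $ k $ d" for a d
      using arg_cong[OF riem_divergence[OF x, of a d k d], of "\<lambda>t. X $ a * t"]
      by (simp add: algebra_simps)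
    then show ?thesis
      unfolding sum_distrib_left sum_subtractf[symmetric] by simp
  qed
  have "(\<Sum>i\<in>UNIV. \<Sum>k\<in>UNIV. \<Sum>l\<in>UNIV. X $ i * riem k i x $ k $ l * \<nu> $ l)
      = (\<Sum>i\<in>UNIV. \<Sum>l\<in>UNIV. \<Sum>k\<in>UNIV. X $ i * riem i k x $ l $ k * \<nu> $ l)"
    unfolding sw by (intro sum.cong refl sum.swap)
  also have "\<dots> = (\<Sum>l\<in>UNIV. \<Sum>i\<in>UNIV. \<Sum>k\<in>UNIV. X $ i * riem i k x $ l $ k * \<nu> $ l)"
    by (rule sum.swap)
  also have "\<dots> = (\<Sum>l\<in>UNIV. \<nu> $ l * (\<Sum>i\<in>UNIV. \<Sum>k\<in>UNIV. X $ i * riem i k x $ l $ k))"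
    by (simp add: sum_distrib_left mult_ac)
  finally have r: "(\<Sum>i\<in>UNIV. \<Sum>k\<in>UNIV. \<Sum>l\<in>UNIV. X $ i * riem k i x $ k $ l * \<nu> $ l)
      = (\<Sum>l\<in>UNIV. \<nu> $ l * (\<Sum>i\<in>UNIV. \<Sum>k\<in>UNIV. X $ i * riem i k x $ l $ k))" .
  define R where "R k = (\<Sum>a\<in>UNIV. \<Sum>d\<in>UNIV. X $ a * riem a d x $ k $ d)" for k
  define Z where "Z k = (\<Sum>a\<in>UNIV. \<Sum>d\<in>UNIV. X $ a * Qrem a d x $ k $ d)" for k
  have "(\<Sum>k\<in>UNIV. \<nu> $ k * (X $ k * P
         - (\<Sum>a\<in>UNIV. \<Sum>d\<in>UNIV. X $ a * dmat a (Apot d) x $ k $ d)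
         + (\<Sum>a\<in>UNIV. \<Sum>d\<in>UNIV. X $ a * dmat d (Apot a) x $ k $ d)))
     = (\<Sum>k\<in>UNIV. P * (X $ k * \<nu> $ k) - 2 * wt x * (\<nu> $ k * R k) + \<nu> $ k * Z k)"
  proof (intro sum.cong refl)
    fix k
    have e: "X $ k * P
         - (\<Sum>a\<in>UNIV. \<Sum>d\<in>UNIV. X $ a * dmat a (Apot d) x $ k $ d)
         + (\<Sum>a\<in>UNIV. \<Sum>d\<in>UNIV. X $ a * dmat d (Apot a) x $ k $ d) = X $ k * P - 2 * wt x * R k + Z k"
      using k[of k] unfolding R_def Z_def by linarith
    show "\<nu> $ k * (X $ k * P
         - (\<Sum>a\<in>UNIV. \<Sum>d\<in>UNIV. X $ a * dmat a (Apot d) x $ k $ d)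
         + (\<Sum>a\<in>UNIV. \<Sum>d\<in>UNIV. X $ a * dmat d (Apot a) x $ k $ d))
       = P * (X $ k * \<nu> $ k) - 2 * wt x * (\<nu> $ k * R k) + \<nu> $ k * Z k"
      unfolding e by (simp add: algebra_simps)
  qed
  also have "\<dots> = P * (X \<bullet> \<nu>) - 2 * wt x * (\<Sum>k\<in>UNIV. \<nu> $ k * R k) + (\<Sum>k\<in>UNIV. \<nu> $ k * Z k)"
    by (simp add: sum.distrib sum_subtractf sum_distrib_left inner_vec_def)
  finally have main: "(\<Sum>k\<in>UNIV. \<nu> $ k * (X $ k * P
         - (\<Sum>a\<in>UNIV. \<Sum>d\<in>UNIV. X $ a * dmat a (Apot d) x $ k $ d)
         + (\<Sum>a\<in>UNIV. \<Sum>d\<in>UNIV. X $ a * dmat d (Apot a) x $ k $ d)))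
     = P * (X \<bullet> \<nu>) - 2 * wt x * (\<Sum>k\<in>UNIV. \<nu> $ k * R k) + (\<Sum>k\<in>UNIV. \<nu> $ k * Z k)" .
  have zz: "(\<Sum>k\<in>UNIV. \<Sum>a\<in>UNIV. \<Sum>d\<in>UNIV. \<nu> $ k * X $ a * Qrem a d x $ k $ d) = (\<Sum>k\<in>UNIV. \<nu> $ k * Z k)"
    by (simp add: Z_def sum_distrib_left mult.assoc)
  have "wt x * (X \<bullet> (einstein G x *v (matrix_inv (G x) *v \<nu>))) = wt x * (\<Sum>k\<in>UNIV. \<nu> $ k * R k) - (wt x * scal G x) * (X \<bullet> \<nu>) / 2"
    unfolding einstein_riem[OF x] r R_def by (simp add: algebra_simps)
  also have "\<dots> = - (P * (X \<bullet> \<nu>) - 2 * wt x * (\<Sum>k\<in>UNIV. \<nu> $ k * R k) + (\<Sum>k\<in>UNIV. \<nu> $ k * Z k)) / 2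
      - (X \<bullet> \<nu>) * Q / 4 + (\<Sum>k\<in>UNIV. \<nu> $ k * Z k) / 2"
    unfolding ws by (simp add: field_simps)
  finally show ?thesis
    unfolding P_def[symmetric] Q_def[symmetric] main zz .
qed

end

section \<open>Invariance of the scalar curvature\<close>

text \<open>Models a transition map between two charts. Three derivatives of \<open>T\<close> serve
  to commute second derivatives of its Jacobian \<open>J\<close> in the curvature argument.\<close>

locale isometric_map = G: metric_field G S + H: metric_field H U
  for G H :: "real^'n::finite \<Rightarrow> real^'n^'n" and S U +
  fixes T :: "real^'n \<Rightarrow> real^'n"
  assumes T_in: "x \<in> S \<Longrightarrow> T x \<in> U"
    and C3_T: "Ck_on 3 (\<lambda>x. T x $ k) S"
    and pullback: "x \<in> S \<Longrightarrow> G x $ i $ j =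
      (\<Sum>k\<in>UNIV. \<Sum>l\<in>UNIV. partial i (\<lambda>y. T y $ k) x * partial j (\<lambda>y. T y $ l) x * H (T x) $ k $ l)"
begin

definition J :: "real^'n \<Rightarrow> real^'n^'n" where
  "J x = (\<chi> m l. partial l (\<lambda>y. T y $ m) x)"

text \<open>The connection of \<open>H\<close> in the direction of column \<open>k\<close> of
  \<open>J\<close>. Its matrix indices still refer to the target frame; \<open>J_Gam\<close>
  performs the change of frame.\<close>

definition pullback_Gam :: "'n \<Rightarrow> real^'n \<Rightarrow> real^'n^'n" where
  "pullback_Gam k x = (\<Sum>p\<in>UNIV. J x $ p $ k *\<^sub>R Gam H p (T x))"

lemma C2_T: "Ck_on 2 (\<lambda>x. T x $ k) S"
  by (rule Ck_on_mono[OF C3_T]) simp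

lemma C2_J: "Ck_on 2 (\<lambda>x. J x $ i $ j) S"
  using C3_T[of i] by (simp add: J_def numeral_3_eq_3 numeral_2_eq_2)

lemma diff_T: "x \<in> S \<Longrightarrow> (\<lambda>y. T y $ k) differentiable at x"
  using C3_T[of k] by (simp add: numeral_3_eq_3)

lemma diff_J: "x \<in> S \<Longrightarrow> (\<lambda>y. J y $ i $ j) differentiable at x"
  using C2_J[of i j] by (simp add: numeral_2_eq_2)

lemma mdiff_J: "x \<in> S \<Longrightarrow> mdiff J x"
  by (simp add: mdiff_def diff_J)

lemma G_eq: "x \<in> S \<Longrightarrow> G x = transpose (J x) ** H (T x) ** J x"
  by (simp add: vec_eq_iff pullback J_def matrix_matrix_mult_def sum_distrib_left sum_distrib_right mult_ac)
     (subst sum.swap, simp add: mult_ac)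

lemma invertible_J: "x \<in> S \<Longrightarrow> invertible (J x)"
  using G.det_pos[of x] G_eq[of x] by (auto simp: det_mul invertible_det_nz)

lemma J_inv:
  assumes "x \<in> S"
  shows "J x ** matrix_inv (J x) = mat 1" "matrix_inv (J x) ** J x = mat 1"
  using matrix_inv_mult[OF invertible_J[OF assms]] by auto

lemma mdiff_compose:
  assumes "x \<in> S" "mdiff M (T x)"
  shows "mdiff (\<lambda>y. M (T y)) x"
    "dmat k (\<lambda>y. M (T y)) x = (\<Sum>p\<in>UNIV. J x $ p $ k *\<^sub>R dmat p M (T x))"
proof -
  have d: "(\<lambda>y. M y $ i $ j) differentiable at (T x)" for i j
    using assms(2) by (simp add: mdiff_def)
  show "mdiff (\<lambda>y. M (T y)) x"
    unfolding mdiff_def using differentiable_chain[OF diff_T[OF assms(1)] d] by blast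
  show "dmat k (\<lambda>y. M (T y)) x = (\<Sum>p\<in>UNIV. J x $ p $ k *\<^sub>R dmat p M (T x))"
    using partial_chain[OF diff_T[OF assms(1)] d] by (simp add: dmat_def vec_eq_iff J_def)
qed

lemma matrix_mult_sum:
  fixes A :: "real^'n^'n"
  shows "A ** (\<Sum>i\<in>I. M i) = (\<Sum>i\<in>I. A ** M i)" "(\<Sum>i\<in>I. M i) ** A = (\<Sum>i\<in>I. M i ** A)"
    "transpose (\<Sum>i\<in>I. M i) = (\<Sum>i\<in>I. transpose (M i))"
proof -
  show "A ** (\<Sum>i\<in>I. M i) = (\<Sum>i\<in>I. A ** M i)" "(\<Sum>i\<in>I. M i) ** A = (\<Sum>i\<in>I. M i ** A)"
    by (induction I rule: infinite_finite_induct) (simp_all add: matrix_algebra_simps)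
  show "transpose (\<Sum>i\<in>I. M i) = (\<Sum>i\<in>I. transpose (M i))"
    by (simp add: transpose_def vec_eq_iff)
qed

lemma dmat_HT:
  assumes "x \<in> S"
  shows "dmat k (\<lambda>y. H (T y)) x = transpose (pullback_Gam k x) ** H (T x) + H (T x) ** pullback_Gam k x"
  by (simp add: mdiff_compose(2)[OF assms H.mdiff_G[OF T_in[OF assms]]] pullback_Gam_def matrix_mult_sum
      H.compatible[OF T_in[OF assms]] matrix_algebra_simps scaleR_right_distrib sum.distrib)

lemma dmat_J_sym: "x \<in> S \<Longrightarrow> dmat k J x $ m $ l = dmat l J x $ m $ k"
  using partial_commute[OF G.open_S _ C2_T] by (simp add: dmat_def J_def)

lemma pullback_Gam_J_sym:
  assumes "x \<in> S" shows "(pullback_Gam k x ** J x) $ m $ l = (pullback_Gam l x ** J x) $ m $ k"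
proof -
  have e: "(pullback_Gam k x ** J x) $ m $ l = (\<Sum>q\<in>UNIV. \<Sum>p\<in>UNIV. J x $ p $ k * J x $ q $ l * Gam H p (T x) $ m $ q)" for k l
    by (simp add: pullback_Gam_def matrix_matrix_mult_def sum_distrib_left sum_distrib_right mult_ac)
  have "(pullback_Gam k x ** J x) $ m $ l = (\<Sum>p\<in>UNIV. \<Sum>q\<in>UNIV. J x $ p $ k * J x $ q $ l * Gam H p (T x) $ m $ q)"
    unfolding e by (rule sum.swap)
  also have "\<dots> = (\<Sum>p\<in>UNIV. \<Sum>q\<in>UNIV. J x $ q $ l * J x $ p $ k * Gam H q (T x) $ m $ p)"
  proof (intro sum.cong refl)
    fix p q
    show "J x $ p $ k * J x $ q $ l * Gam H p (T x) $ m $ q = J x $ q $ l * J x $ p $ k * Gam H q (T x) $ m $ p"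
      unfolding H.Gam_sym[OF T_in[OF assms], of p m q] by (simp only: mult_ac)
  qed
  also have "\<dots> = (pullback_Gam l x ** J x) $ m $ k" unfolding e ..
  finally show ?thesis .
qed

text \<open>The right side multiplied by the inverse of \<open>J\<close> is a connection for
  \<open>G\<close>: torsion-free because second derivatives of \<open>T\<close> commute and
  \<open>Gam H\<close> is symmetric, and metric by differentiating \<open>G_eq\<close>. Uniqueness
  identifies it with \<open>Gam G\<close>.\<close>

lemma J_Gam:
  assumes x: "x \<in> S"
  shows "J x ** Gam G k x = dmat k J x + pullback_Gam k x ** J x"
proof -
  define M where "M k = dmat k J x + pullback_Gam k x ** J x" for k
  define L where "L k = matrix_inv (J x) ** M k" for k
  have JL: "J x ** L k = M k" for k
    by (simp add: L_def matrix_mul_assoc J_inv[OF x])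
  have "L k = Gam G k x" for k
  proof (rule levi_civita_unique[where G=G and x=x, OF G.invertible_G[OF x] _ _ G.transpose_G[OF x]])
    have "M k $ m $ j = M j $ m $ k" for k m j
      unfolding M_def using dmat_J_sym[OF x, of k m j] pullback_Gam_J_sym[OF x, of k m j] by simp
    then show "L k $ i $ j = L j $ i $ k" for k i j
      by (simp add: L_def matrix_matrix_mult_def)
    fix k
    have "dmat k G x = dmat k (\<lambda>y. transpose (J y) ** H (T y) ** J y) x"
      by (rule dmat_cong[OF G.open_S x G_eq])
    also have "\<dots> = (transpose (dmat k J x) ** H (T x) + transpose (J x) ** dmat k (\<lambda>y. H (T y)) x) ** J x
        + transpose (J x) ** H (T x) ** dmat k J x"
      using mdiff_J[OF x] mdiff_compose(1)[OF x H.mdiff_G[OF T_in[OF x]]]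
      by (simp add: dmat_mult mdiff_mult mdiff_transpose dmat_transpose)
    also have "\<dots> = transpose (M k) ** H (T x) ** J x + transpose (J x) ** H (T x) ** M k"
      unfolding dmat_HT[OF x] M_def matrix_ring_simps by simp
    also have "\<dots> = transpose (L k) ** G x + G x ** L k"
      unfolding JL[symmetric] G_eq[OF x] matrix_ring_simps by simp
    finally show "dmat k G x = transpose (L k) ** G x + G x ** L k" .
  qed
  then show ?thesis using JL M_def by simp
qed

lemma mdiff_pullback_Gam:
  assumes x: "x \<in> S"
  shows "mdiff (pullback_Gam b) x"
    "dmat a (pullback_Gam b) x = (\<Sum>p\<in>UNIV. dmat a J x $ p $ b *\<^sub>R Gam H p (T x)
        + J x $ p $ b *\<^sub>R (\<Sum>q\<in>UNIV. J x $ q $ a *\<^sub>R dmat q (Gam H p) (T x)))"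
proof -
  note c = mdiff_compose[OF x H.mdiff_Gam[OF T_in[OF x]]]
  have d: "(\<lambda>y. Gam H p (T y) $ i $ j) differentiable at x" for p i j
    using c(1) by (simp add: mdiff_def)
  show "mdiff (pullback_Gam b) x"
    unfolding mdiff_def pullback_Gam_def sum_component vector_scaleR_component
    using d diff_J[OF x] by simp
  have "dmat a (pullback_Gam b) x $ i $ j = (\<Sum>p\<in>UNIV. dmat a J x $ p $ b * Gam H p (T x) $ i $ j
        + J x $ p $ b * dmat a (\<lambda>y. Gam H p (T y)) x $ i $ j)" for i j
    unfolding dmat_def pullback_Gam_def sum_component vector_scaleR_component vec_lambda_beta real_scaleR_def
    using d diff_J[OF x] by (simp add: partial_sum partial_mult)
  then show "dmat a (pullback_Gam b) x = (\<Sum>p\<in>UNIV. dmat a J x $ p $ b *\<^sub>R Gam H p (T x)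
        + J x $ p $ b *\<^sub>R (\<Sum>q\<in>UNIV. J x $ q $ a *\<^sub>R dmat q (Gam H p) (T x)))"
    by (simp add: vec_eq_iff flip: c(2))
qed

text \<open>\<open>J\<close> intertwines the two connections like a gauge transformation, so it conjugates their
  curvatures; the derivatives of \<open>J\<close> cancel by symmetry.\<close>

lemma J_curv:
  assumes x: "x \<in> S"
  shows "J x ** curv G a b x = (\<Sum>q\<in>UNIV. \<Sum>p\<in>UNIV. (J x $ q $ a * J x $ p $ b) *\<^sub>R curv H q p (T x)) ** J x"
proof -
  have d: "dmat a J x ** Gam G b x + J x ** dmat a (Gam G b) x
     = dmat a (dmat b J) x + dmat a (pullback_Gam b) x ** J x + pullback_Gam b x ** dmat a J x" for a b
  proof -
    have "dmat a (\<lambda>y. J y ** Gam G b y) x = dmat a (\<lambda>y. dmat b J y + pullback_Gam b y ** J y) x"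
      by (rule dmat_cong[OF G.open_S x J_Gam])
    moreover have "mdiff (dmat b J) x"
      using C2_J x by (simp add: mdiff_def dmat_def numeral_2_eq_2)
    ultimately show ?thesis
      by (simp add: dmat_mult dmat_add mdiff_J[OF x] G.mdiff_Gam[OF x] mdiff_pullback_Gam(1)[OF x] mdiff_mult)
  qed
  \<comment> \<open>This substitution removes the first derivatives of \<open>J\<close>; the second
    ones cancel by \<open>dd\<close>.\<close>
  have dJ: "dmat k J x = J x ** Gam G k x - pullback_Gam k x ** J x" for k
    using J_Gam[OF x, of k] by simp
  have dd: "dmat a (dmat b J) x = dmat b (dmat a J) x"
    by (rule dmat_commute[OF G.open_S x C2_J])
  have "J x ** curv G a b x = (dmat a (pullback_Gam b) x - dmat b (pullback_Gam a) x + pullback_Gam a x ** pullback_Gam b x - pullback_Gam b x ** pullback_Gam a x) ** J x"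
    using d[of a b] d[of b a] dd unfolding curv_def dJ matrix_ring_simps by (simp add: algebra_simps)
  moreover have "dmat a (pullback_Gam b) x - dmat b (pullback_Gam a) x + pullback_Gam a x ** pullback_Gam b x - pullback_Gam b x ** pullback_Gam a x
     = (\<Sum>q\<in>UNIV. \<Sum>p\<in>UNIV. (J x $ q $ a * J x $ p $ b) *\<^sub>R curv H q p (T x))"
  proof -
    have e: "(\<Sum>p\<in>UNIV. dmat a J x $ p $ b *\<^sub>R Gam H p (T x)) = (\<Sum>p\<in>UNIV. dmat b J x $ p $ a *\<^sub>R Gam H p (T x))"
      using dmat_J_sym[OF x, of a _ b] by simp
    have A: "pullback_Gam a x ** pullback_Gam b x = (\<Sum>q\<in>UNIV. \<Sum>p\<in>UNIV. (J x $ q $ a * J x $ p $ b) *\<^sub>R (Gam H q (T x) ** Gam H p (T x)))" for a b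
      unfolding pullback_Gam_def matrix_mult_sum(2) by (simp add: matrix_mult_sum(1) matrix_algebra_simps mult.commute)
    have A': "pullback_Gam b x ** pullback_Gam a x = (\<Sum>q\<in>UNIV. \<Sum>p\<in>UNIV. (J x $ q $ a * J x $ p $ b) *\<^sub>R (Gam H p (T x) ** Gam H q (T x)))"
      unfolding A by (subst sum.swap) (simp add: mult.commute)
    have D: "(\<Sum>p\<in>UNIV. J x $ p $ b *\<^sub>R (\<Sum>q\<in>UNIV. J x $ q $ a *\<^sub>R dmat q (Gam H p) (T x)))
       = (\<Sum>q\<in>UNIV. \<Sum>p\<in>UNIV. (J x $ q $ a * J x $ p $ b) *\<^sub>R dmat q (Gam H p) (T x))" for a b
      by (subst sum.swap) (simp add: scaleR_sum_right mult.commute)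
    have D': "(\<Sum>p\<in>UNIV. J x $ p $ a *\<^sub>R (\<Sum>q\<in>UNIV. J x $ q $ b *\<^sub>R dmat q (Gam H p) (T x)))
       = (\<Sum>q\<in>UNIV. \<Sum>p\<in>UNIV. (J x $ q $ a * J x $ p $ b) *\<^sub>R dmat p (Gam H q) (T x))"
      unfolding D by (subst sum.swap) (simp add: mult.commute)
    show ?thesis
      unfolding mdiff_pullback_Gam(2)[OF x] sum.distrib e A[of a b] A' D[of b a] D' curv_def
      by (simp add: scaleR_right_distrib scaleR_right_diff_distrib sum.distrib sum_subtractf)
  qed
  ultimately show ?thesis by simp
qed

text \<open>In the trace over the upper index and the first form index, the inverse of
  \<open>J\<close> from the conjugation meets the factor \<open>J\<close> of that form index and
  both disappear. The two remaining factors are those of a covariant 2-tensor.\<close>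

lemma ricci_pullback:
  assumes x: "x \<in> S"
  shows "ricci G x = transpose (J x) ** ricci H (T x) ** J x"
proof -
  let ?K = "matrix_inv (J x)"
  define Y where "Y q j m i = (\<Sum>p\<in>UNIV. J x $ p $ j * (curv H q p (T x) ** J x) $ m $ i)" for q j m i
  have "ricci G x $ i $ j = (transpose (J x) ** ricci H (T x) ** J x) $ i $ j" for i j
  proof -
    have c: "curv G k j x = ?K ** ((\<Sum>q\<in>UNIV. \<Sum>p\<in>UNIV. (J x $ q $ k * J x $ p $ j) *\<^sub>R curv H q p (T x)) ** J x)" for k
      unfolding J_curv[OF x, symmetric] by (simp add: matrix_mul_assoc J_inv[OF x])
    have "((\<Sum>q\<in>UNIV. \<Sum>p\<in>UNIV. (J x $ q $ k * J x $ p $ j) *\<^sub>R curv H q p (T x)) ** J x) $ m $ i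
        = (\<Sum>q\<in>UNIV. J x $ q $ k * Y q j m i)" for k m
      by (simp add: matrix_mult_sum matrix_algebra_simps Y_def sum_distrib_left mult.assoc)
    then have "ricci G x $ i $ j = (\<Sum>k\<in>UNIV. \<Sum>m\<in>UNIV. \<Sum>q\<in>UNIV. J x $ q $ k * ?K $ k $ m * Y q j m i)"
      by (simp add: G.ricci_curv[OF x] c matrix_matrix_mult_def[of ?K] sum_distrib_left mult_ac)
    also have "\<dots> = (\<Sum>m\<in>UNIV. \<Sum>k\<in>UNIV. \<Sum>q\<in>UNIV. J x $ q $ k * ?K $ k $ m * Y q j m i)"
      by (rule sum.swap)
    also have "\<dots> = (\<Sum>m\<in>UNIV. \<Sum>q\<in>UNIV. \<Sum>k\<in>UNIV. J x $ q $ k * ?K $ k $ m * Y q j m i)"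
      by (intro sum.cong refl sum.swap)
    also have "\<dots> = (\<Sum>m\<in>UNIV. \<Sum>q\<in>UNIV. (J x ** ?K) $ q $ m * Y q j m i)"
      by (simp add: matrix_matrix_mult_def sum_distrib_right)
    also have "\<dots> = (\<Sum>m\<in>UNIV. Y m j m i)"
      by (simp add: J_inv[OF x] mat_def if_distrib[of "\<lambda>a. a * _"] cong: if_cong)
    also have "\<dots> = (\<Sum>m\<in>UNIV. \<Sum>p\<in>UNIV. \<Sum>n\<in>UNIV. J x $ p $ j * (curv H m p (T x) $ m $ n * J x $ n $ i))"
      by (simp add: Y_def matrix_matrix_mult_def sum_distrib_left)
    also have "\<dots> = (\<Sum>p\<in>UNIV. \<Sum>m\<in>UNIV. \<Sum>n\<in>UNIV. J x $ p $ j * (curv H m p (T x) $ m $ n * J x $ n $ i))"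
      by (rule sum.swap)
    also have "\<dots> = (\<Sum>p\<in>UNIV. \<Sum>n\<in>UNIV. \<Sum>m\<in>UNIV. J x $ p $ j * (curv H m p (T x) $ m $ n * J x $ n $ i))"
      by (intro sum.cong refl sum.swap)
    also have "\<dots> = (\<Sum>p\<in>UNIV. \<Sum>n\<in>UNIV. J x $ n $ i * ricci H (T x) $ n $ p * J x $ p $ j)"
      by (simp add: H.ricci_curv[OF T_in[OF x]] sum_distrib_left sum_distrib_right mult_ac)
    also have "\<dots> = (transpose (J x) ** ricci H (T x) ** J x) $ i $ j"
      by (simp add: matrix_matrix_mult_def sum_distrib_right)
    finally show ?thesis .
  qed
  then show ?thesis by (simp add: vec_eq_iff)
qed

text \<open>Written as the trace of the inverse metric times the Ricci matrix: the two
  transformation laws combine to conjugation by \<open>J\<close>, and the trace is cyclic.\<close>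

lemma scal_invariant:
  assumes x: "x \<in> S" shows "scal G x = scal H (T x)"
proof -
  have tr: "scal M y = trace (matrix_inv (M y) ** ricci M y)" if "transpose (matrix_inv (M y)) = matrix_inv (M y)"
    for M :: "real^'n \<Rightarrow> real^'n^'n" and y
  proof -
    have "scal M y = (\<Sum>i\<in>UNIV. \<Sum>j\<in>UNIV. matrix_inv (M y) $ j $ i * ricci M y $ i $ j)"
      unfolding scal_def
    proof (intro sum.cong refl)
      fix i j show "matrix_inv (M y) $ i $ j * ricci M y $ i $ j = matrix_inv (M y) $ j $ i * ricci M y $ i $ j"
        using arg_cong[OF that, of "\<lambda>m. m $ i $ j"] by simp
    qed
    then show ?thesis
      by (subst (asm) sum.swap) (simp add: trace_def matrix_matrix_mult_def)
  qed
  let ?J = "J x" let ?K = "matrix_inv (J x)" let ?H = "matrix_inv (H (T x))"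
  have inv: "matrix_inv (G x) = ?K ** ?H ** transpose ?K"
  proof -
    have "G x ** (?K ** ?H ** transpose ?K) = transpose ?J ** H (T x) ** (?J ** ?K) ** ?H ** transpose ?K"
      by (simp add: G_eq[OF x] matrix_mul_assoc)
    also have "\<dots> = transpose ?J ** (H (T x) ** ?H) ** transpose ?K"
      by (simp add: J_inv[OF x] matrix_mul_assoc)
    also have "\<dots> = transpose (?K ** ?J)"
      by (simp add: matrix_inv_mult[OF H.invertible_G[OF T_in[OF x]]] matrix_transpose_mul)
    also have "\<dots> = mat 1" by (simp add: J_inv[OF x])
    finally have "G x ** (?K ** ?H ** transpose ?K) = mat 1" .
    then have "matrix_inv (G x) ** G x ** (?K ** ?H ** transpose ?K) = matrix_inv (G x)"
      by (simp add: matrix_mul_assoc[symmetric])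
    then show ?thesis by (simp add: matrix_inv_mult[OF G.invertible_G[OF x]])
  qed
  have "matrix_inv (G x) ** ricci G x = ?K ** ?H ** transpose (?J ** ?K) ** ricci H (T x) ** ?J"
    by (simp add: inv ricci_pullback[OF x] matrix_transpose_mul matrix_mul_assoc)
  then have "scal G x = trace (?K ** (?H ** ricci H (T x) ** ?J))"
    by (simp add: tr[of G x, OF G.transpose_Ginv[OF x]] J_inv[OF x] matrix_mul_assoc)
  also have "\<dots> = trace (?H ** ricci H (T x) ** (?J ** ?K))"
    by (subst trace_mul_sym) (simp add: matrix_mul_assoc)
  also have "\<dots> = scal H (T x)"
    by (simp add: tr[of H "T x", OF H.transpose_Ginv[OF T_in[OF x]]] J_inv[OF x])
  finally show ?thesis .
qed

end

section \<open>Integration over spheres\<close>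

lemma lborel_translate_nn:
  fixes g :: "'a::euclidean_space \<Rightarrow> ennreal"
  assumes [measurable]: "g \<in> borel_measurable borel"
  shows "(\<integral>\<^sup>+y. g (a + y) \<partial>lborel) = (\<integral>\<^sup>+y. g y \<partial>lborel)"
  by (subst (2) lborel_distr_plus[of a, symmetric]) (simp add: nn_integral_distr)

lemma lborel_scale_nn:
  fixes g :: "'a::euclidean_space \<Rightarrow> ennreal"
  assumes [measurable]: "g \<in> borel_measurable borel" and c: "c \<noteq> 0"
  shows "(\<integral>\<^sup>+y. g y \<partial>lborel) = ennreal (\<bar>c\<bar> ^ DIM('a)) * (\<integral>\<^sup>+y. g (a + c *\<^sub>R y) \<partial>lborel)"
  by (subst lborel_affine[OF c, of a]) (simp add: nn_integral_density nn_integral_distr nn_integral_cmult ennreal_power)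

lemma lborel_scale:
  fixes g :: "'a::euclidean_space \<Rightarrow> real"
  assumes [measurable]: "g \<in> borel_measurable borel" and c: "c > 0"
  shows "(\<integral>y. g y \<partial>lborel) = c ^ DIM('a) * (\<integral>y. g (c *\<^sub>R y) \<partial>lborel)"
proof -
  have "(\<integral>y. g y \<partial>lborel) = (\<integral>y. g y \<partial>density (distr lborel borel (\<lambda>x::'a. 0 + c *\<^sub>R x)) (\<lambda>_. ennreal (\<bar>c\<bar> ^ DIM('a))))"
    using lborel_affine[of c "0::'a"] c by (simp add: ennreal_power)
  also have "\<dots> = c ^ DIM('a) * (\<integral>y. g (c *\<^sub>R y) \<partial>lborel)"
    using c by (subst integral_density) (auto simp: integral_distr)
  finally show ?thesis .
qed

text \<open>Uniqueness of translation invariant measures: pairing with the unit ball, which \<open>T\<close>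
  preserves, identifies the image of Lebesgue measure under \<open>T\<close>.\<close>

lemma lborel_isometry_nn:
  fixes T T' :: "'a::euclidean_space \<Rightarrow> 'a"
  assumes T: "linear T" and T': "\<And>y. T (T' y) = y" and norm_T: "\<And>x. norm (T x) = norm x"
    and [measurable]: "g \<in> borel_measurable borel"
  shows "(\<integral>\<^sup>+x. g (T x) \<partial>lborel) = (\<integral>\<^sup>+x. g x \<partial>lborel)"
proof -
  have [measurable]: "T \<in> borel_measurable borel"
    using T by (intro borel_measurable_continuous_onI linear_continuous_on)
      (simp add: linear_conv_bounded_linear)
  define f :: "'a \<Rightarrow> ennreal" where "f = indicator (ball 0 1)"
  have [measurable]: "f \<in> borel_measurable borel"
    unfolding f_def by (rule borel_measurable_indicator) simp
  \<comment> \<open>A translation in the source realises any prescribed translation of the target;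
    this is the use of the right inverse \<open>T'\<close>.\<close>
  have Tsub: "T (x + T' (- y)) = T x - y" for x y
    using T T' by (simp add: linear_add)
  have "(\<integral>\<^sup>+x. f x \<partial>lborel) * (\<integral>\<^sup>+y. g y \<partial>lborel) = (\<integral>\<^sup>+x. f (T x) \<partial>lborel) * (\<integral>\<^sup>+y. g y \<partial>lborel)"
    by (simp add: f_def norm_T indicator_def)
  also have "\<dots> = (\<integral>\<^sup>+x. f (T x) * (\<integral>\<^sup>+y. g (T x + y) \<partial>lborel) \<partial>lborel)"
    by (simp add: lborel_translate_nn nn_integral_multc)
  also have "\<dots> = (\<integral>\<^sup>+x. (\<integral>\<^sup>+y. f (T x) * g (T x + y) \<partial>lborel) \<partial>lborel)"
    by (intro nn_integral_cong) (simp add: nn_integral_cmult)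
  also have "\<dots> = (\<integral>\<^sup>+y. (\<integral>\<^sup>+x. f (T x) * g (T x + y) \<partial>lborel) \<partial>lborel)"
    by (rule lborel_pair.Fubini') measurable
  also have "\<dots> = (\<integral>\<^sup>+y. (\<integral>\<^sup>+x. f (T x - y) * g (T x) \<partial>lborel) \<partial>lborel)"
  proof (rule nn_integral_cong)
    fix y
    have "(\<integral>\<^sup>+x. f (T (T' (- y) + x)) * g (T (T' (- y) + x) + y) \<partial>lborel) = (\<integral>\<^sup>+x. f (T x) * g (T x + y) \<partial>lborel)"
      by (rule lborel_translate_nn) measurable
    then show "(\<integral>\<^sup>+x. f (T x) * g (T x + y) \<partial>lborel) = (\<integral>\<^sup>+x. f (T x - y) * g (T x) \<partial>lborel)"
      by (simp add: add.commute[of "T' _"] Tsub)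
  qed
  also have "\<dots> = (\<integral>\<^sup>+x. (\<integral>\<^sup>+y. f (T x - y) * g (T x) \<partial>lborel) \<partial>lborel)"
    by (rule lborel_pair.Fubini'[symmetric]) measurable
  \<comment> \<open>Reflecting and translating \<open>y\<close> frees the inner integral of
    \<open>x\<close>, so the double integral factors. The volume of the ball is then cancelled,
    being finite and nonzero.\<close>
  also have "\<dots> = (\<integral>\<^sup>+x. (\<integral>\<^sup>+y. f y \<partial>lborel) * g (T x) \<partial>lborel)"
  proof (rule nn_integral_cong)
    fix x
    show "(\<integral>\<^sup>+y. f (T x - y) * g (T x) \<partial>lborel) = (\<integral>\<^sup>+y. f y \<partial>lborel) * g (T x)"
      using lborel_scale_nn[of f "-1" "T x"] by (simp add: nn_integral_multc)
  qed
  also have "\<dots> = (\<integral>\<^sup>+y. f y \<partial>lborel) * (\<integral>\<^sup>+x. g (T x) \<partial>lborel)"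
    by (simp add: nn_integral_cmult)
  finally have eq: "(\<integral>\<^sup>+x. f x \<partial>lborel) * (\<integral>\<^sup>+y. g y \<partial>lborel) = (\<integral>\<^sup>+x. f x \<partial>lborel) * (\<integral>\<^sup>+x. g (T x) \<partial>lborel)" .
  have "(\<integral>\<^sup>+x. f x \<partial>lborel) = emeasure lborel (ball (0::'a) 1)" by (simp add: f_def)
  moreover have "emeasure lborel (ball (0::'a) 1) \<noteq> \<infinity>"
    using emeasure_lborel_ball_finite[of "0::'a" 1] by simp
  moreover have "emeasure lborel (ball (0::'a) 1) \<noteq> 0"
    by (simp add: emeasure_ball unit_ball_vol_pos less_imp_neq[THEN not_sym])
  ultimately show ?thesis
    using eq by (metis ennreal_mult_cancel_left infinity_ennreal_def)
qed

lemma lborel_isometry: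
  fixes T T' :: "'a::euclidean_space \<Rightarrow> 'a"
  assumes "linear T" "\<And>y. T (T' y) = y" "\<And>x. norm (T x) = norm x"
  shows "distr lborel borel T = lborel"
proof (rule measure_eqI)
  have [measurable]: "T \<in> borel_measurable borel"
    using assms(1) by (intro borel_measurable_continuous_onI linear_continuous_on)
      (simp add: linear_conv_bounded_linear)
  fix A assume "A \<in> sets (distr lborel borel T)"
  then have [measurable]: "A \<in> sets borel" by simp
  show "emeasure (distr lborel borel T) A = emeasure lborel A"
    using lborel_isometry_nn[OF assms, of "indicator A"]
    by (simp add: nn_integral_distr flip: nn_integral_indicator)
qed simp

section \<open>The measure on directions and its relation to sphere integrals\<close>

text \<open>Not normalised: the total mass is the volume of the unit ball.\<close>

definition sphere_dirs :: "(real^'n::finite) measure" where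
  "sphere_dirs = distr (restrict_space lborel (cball 0 1 - {0})) (restrict_space borel (sphere 0 1)) (\<lambda>y. y /\<^sub>R norm y)"

lemma space_sphere_dirs [simp]: "space sphere_dirs = sphere 0 1"
  by (simp add: sphere_dirs_def)

lemma sets_sphere_dirs [measurable_cong]: "sets sphere_dirs = sets (restrict_space borel (sphere 0 1))"
  by (simp add: sphere_dirs_def)

lemma measurable_dir: "(\<lambda>y::real^'n::finite. y /\<^sub>R norm y) \<in> restrict_space lborel (cball 0 1 - {0}) \<rightarrow>\<^sub>M restrict_space borel (sphere 0 1)"
  by (intro measurable_restrict_space3 measurable_restrict_space2) (auto intro!: measurable_restrict_space1)

lemma finite_sphere_dirs: "finite_measure (sphere_dirs :: (real^'n::finite) measure)"
proof
  have sp: "sphere 0 1 \<in> sets (restrict_space borel (sphere (0::real^'n) 1))"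
    using sets.top[of "restrict_space borel (sphere (0::real^'n) 1)"] by (simp add: space_restrict_space)
  have "emeasure (sphere_dirs :: (real^'n) measure) (space sphere_dirs) = emeasure (restrict_space lborel (cball 0 1 - {0::real^'n})) (space (restrict_space lborel (cball 0 1 - {0})))"
    unfolding sphere_dirs_def by (subst emeasure_distr[OF measurable_dir])
      (auto simp: space_restrict_space sp intro!: arg_cong[of _ _ "emeasure _"])
  also have "\<dots> \<le> emeasure lborel (cball (0::real^'n) 1)"
    by (simp add: emeasure_restrict_space space_restrict_space emeasure_mono)
  also have "\<dots> < \<infinity>" using emeasure_lborel_cball_finite by auto
  finally show "emeasure (sphere_dirs :: (real^'n) measure) (space sphere_dirs) \<noteq> \<infinity>" by auto
qed

interpretation sphere_dirs: finite_measure "sphere_dirs :: (real^'n::finite) measure"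
  by (rule finite_sphere_dirs)

lemma borel_measurable_sphere_dirs:
  "continuous_on (sphere 0 1) (f :: real^'n::finite \<Rightarrow> real) \<Longrightarrow> f \<in> borel_measurable sphere_dirs"
  using borel_measurable_continuous_on_restrict[of "sphere 0 1" f] by (simp add: measurable_cong_sets[OF sets_sphere_dirs])

lemma integrable_sphere_dirs:
  fixes f :: "real^'n::finite \<Rightarrow> real"
  assumes f: "continuous_on (sphere 0 1) f"
  shows "integrable sphere_dirs f"
proof -
  have "bounded (f ` sphere 0 1)"
    by (intro compact_imp_bounded compact_continuous_image f compact_sphere)
  then obtain B where "\<forall>x\<in>sphere 0 1. norm (f x) \<le> B"
    by (metis bounded_iff imageI)
  then show ?thesis
    by (intro sphere_dirs.integrable_const_bound[of _ B] AE_I2 borel_measurable_sphere_dirs f) auto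
qed

lemma integral_sphere_dirs:
  fixes f :: "real^'n::finite \<Rightarrow> real"
  assumes f: "continuous_on (sphere 0 1) f"
  shows "(\<integral>\<theta>. f \<theta> \<partial>sphere_dirs) = (\<integral>y. indicator (cball 0 1 - {0}) y * f (y /\<^sub>R norm y) \<partial>lborel)"
  unfolding sphere_dirs_def
  by (subst integral_distr[OF measurable_dir])
     (simp_all add: borel_measurable_continuous_on_restrict f integral_restrict_space)

text \<open>A linear isometry commutes with the radial projection and preserves the punctured unit
  ball, so the invariance of Lebesgue measure descends to directions.\<close>

lemma sphere_dirs_isometry:
  fixes f :: "real^'n::finite \<Rightarrow> real" and T T' :: "real^'n \<Rightarrow> real^'n"
  assumes f: "continuous_on (sphere 0 1) f"
    and T: "linear T" "\<And>y. T (T' y) = y" "\<And>x. norm (T x) = norm x"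
  shows "(\<integral>\<theta>. f (T \<theta>) \<partial>sphere_dirs) = (\<integral>\<theta>. f \<theta> \<partial>sphere_dirs)"
proof -
  have cT: "continuous_on A T" for A
    using T(1) by (intro linear_continuous_on) (simp add: linear_conv_bounded_linear)
  have mT: "T \<in> borel_measurable borel" by (intro borel_measurable_continuous_onI cT)
  define h :: "real^'n \<Rightarrow> real" where "h y = indicator (cball 0 1 - {0}) y * f (y /\<^sub>R norm y)" for y
  have hm: "h \<in> borel_measurable borel"
  proof -
    have "continuous_on (cball 0 1 - {0}) (\<lambda>y. f (y /\<^sub>R norm y))"
    proof (intro continuous_on_compose2[OF f])
      show "(\<lambda>y. y /\<^sub>R norm y) ` (cball 0 1 - {0}) \<subseteq> sphere (0::real^'n) 1"
      proof (rule image_subsetI)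
        fix y :: "real^'n" assume "y \<in> cball 0 1 - {0}"
        then show "y /\<^sub>R norm y \<in> sphere 0 1" by simp
      qed
    qed (auto intro!: continuous_intros)
    then show ?thesis
      using borel_measurable_continuous_on_indicator[of "cball 0 1 - {0}" "\<lambda>y. f (y /\<^sub>R norm y)"]
      by (simp add: h_def[abs_def])
  qed
  have "(\<integral>\<theta>. f (T \<theta>) \<partial>sphere_dirs) = (\<integral>y. h (T y) \<partial>lborel)"
  proof (subst integral_sphere_dirs)
    show "continuous_on (sphere 0 1) (\<lambda>\<theta>. f (T \<theta>))"
      by (intro continuous_on_compose2[OF f cT]) (auto simp: T)
    have "T y = 0 \<longleftrightarrow> y = 0" for y using T(3) by (metis norm_eq_zero)
    then show "(\<integral>y. indicator (cball 0 1 - {0}) y * f (T (y /\<^sub>R norm y)) \<partial>lborel) = (\<integral>y. h (T y) \<partial>lborel)"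
      by (intro Bochner_Integration.integral_cong) (auto simp: h_def T linear_cmul[OF T(1)] indicator_def)
  qed
  also have "\<dots> = (\<integral>y. h y \<partial>distr lborel borel T)"
    using mT hm by (subst integral_distr) auto
  also have "\<dots> = (\<integral>y. h y \<partial>lborel)" using lborel_isometry[OF T] by simp
  also have "\<dots> = (\<integral>\<theta>. f \<theta> \<partial>sphere_dirs)"
    by (simp add: integral_sphere_dirs[OF f] h_def)
  finally show ?thesis .
qed

lemma scale_measure_density: "scale_measure (ennreal c) M = density M (\<lambda>_. ennreal c)"
  by (rule measure_eqI) (simp_all add: emeasure_density nn_integral_cmult)

lemma sphere_scale_continuous:
  fixes f :: "real^'n::finite \<Rightarrow> real"
  assumes "r > 0" "continuous_on (sphere 0 r) f"
  shows "continuous_on (sphere 0 1) (\<lambda>\<theta>. f (r *\<^sub>R \<theta>))"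
  by (intro continuous_on_compose2[OF assms(2)]) (use assms in \<open>auto intro!: continuous_intros\<close>)

text \<open>The factor n / r of \<open>sphere_measure\<close> and the Jacobian r^n of the dilation
  combine to n r^(n - 1). From here on the radius is a parameter of the integrand over one fixed
  finite measure.\<close>

lemma sphere_integral_eq:
  fixes f :: "real^'n::finite \<Rightarrow> real"
  assumes r: "r > 0" and f: "continuous_on (sphere 0 r) f"
  shows "sphere_integral r f = real CARD('n) * r ^ (CARD('n) - 1) * (\<integral>\<theta>. f (r *\<^sub>R \<theta>) \<partial>sphere_dirs)"
proof -
  define p where "p y = (r / norm y) *\<^sub>R y" for y :: "real^'n"
  define g where "g y = indicator (sphere 0 r) y * f y" for y :: "real^'n"
  have [measurable]: "p \<in> borel_measurable borel" unfolding p_def[abs_def] by measurable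
  have [measurable]: "g \<in> borel_measurable borel"
    using borel_measurable_continuous_on_indicator[OF _ f] by (simp add: g_def[abs_def])
  have "sphere_integral r f = (\<integral>y. g y \<partial>sphere_measure r)"
    by (simp add: sphere_integral_def set_lebesgue_integral_def g_def)
  also have "\<dots> = (real CARD('n) / r) * (\<integral>y. g y \<partial>distr (restrict_space lborel (cball 0 r)) borel p)"
    unfolding sphere_measure_def scale_measure_density p_def[abs_def, symmetric]
    using r by (subst integral_density) auto
  also have "(\<integral>y. g y \<partial>distr (restrict_space lborel (cball 0 r)) borel p) = (\<integral>y. indicator (cball 0 r) y * g (p y) \<partial>lborel)"
    by (subst integral_distr) (auto simp: integral_restrict_space intro!: measurable_restrict_space1)
  also have "\<dots> = r ^ CARD('n) * (\<integral>y. indicator (cball 0 r) (r *\<^sub>R y) * g (p (r *\<^sub>R y)) \<partial>lborel)"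
  proof (rule lborel_scale[OF _ r, where 'a="real^'n", simplified])
    show "(\<lambda>y. indicator (cball 0 r) y * g (p y)) \<in> borel_measurable borel"
      by (intro borel_measurable_times borel_measurable_indicator measurable_compose[of p borel borel g]) simp_all
  qed
  also have "(\<integral>y. indicator (cball 0 r) (r *\<^sub>R y) * g (p (r *\<^sub>R y)) \<partial>lborel)
      = (\<integral>y. indicator (cball 0 1 - {0}) y * f (r *\<^sub>R (y /\<^sub>R norm y)) \<partial>lborel)"
    using r by (intro Bochner_Integration.integral_cong)
      (auto simp: g_def p_def indicator_def field_simps)
  also have "\<dots> = (\<integral>\<theta>. f (r *\<^sub>R \<theta>) \<partial>sphere_dirs)"
    by (rule integral_sphere_dirs[OF sphere_scale_continuous[OF r f], symmetric])
  also have "real CARD('n) / r * (r ^ CARD('n) * (\<integral>\<theta>. f (r *\<^sub>R \<theta>) \<partial>sphere_dirs))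
     = real CARD('n) * r ^ (CARD('n) - 1) * (\<integral>\<theta>. f (r *\<^sub>R \<theta>) \<partial>sphere_dirs)"
    using r by (simp add: power_eq_if[of r "CARD('n)"])
  finally show ?thesis .
qed

lemma sphere_integral_cong:
  assumes "\<And>x. norm x = r \<Longrightarrow> f x = g x"
  shows "sphere_integral r f = sphere_integral r g"
  unfolding sphere_integral_def set_lebesgue_integral_def
  by (intro Bochner_Integration.integral_cong) (auto simp: indicator_def assms)

lemma sphere_integral_add:
  fixes f g :: "real^'n::finite \<Rightarrow> real"
  assumes r: "r > 0" and f: "continuous_on (sphere 0 r) f" and g: "continuous_on (sphere 0 r) g"
  shows "sphere_integral r (\<lambda>x. f x + g x) = sphere_integral r f + sphere_integral r g"
  by (simp add: sphere_integral_eq assms continuous_on_add integrable_sphere_dirs sphere_scale_continuous distrib_left)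

lemma sphere_integral_cmult:
  fixes f :: "real^'n::finite \<Rightarrow> real"
  assumes r: "r > 0" and f: "continuous_on (sphere 0 r) f"
  shows "sphere_integral r (\<lambda>x. c * f x) = c * sphere_integral r f"
  by (simp add: sphere_integral_eq assms continuous_on_mult_left)

lemma sphere_integral_diff:
  fixes f g :: "real^'n::finite \<Rightarrow> real"
  assumes r: "r > 0" and f: "continuous_on (sphere 0 r) f" and g: "continuous_on (sphere 0 r) g"
  shows "sphere_integral r (\<lambda>x. f x - g x) = sphere_integral r f - sphere_integral r g"
  by (simp add: sphere_integral_eq assms continuous_on_diff integrable_sphere_dirs sphere_scale_continuous right_diff_distrib)

lemma sphere_integral_0 [simp]: "sphere_integral r (\<lambda>x. 0) = 0"
  by (simp add: sphere_integral_def)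

lemma sphere_integral_sum:
  fixes f :: "'i \<Rightarrow> real^'n::finite \<Rightarrow> real"
  assumes r: "r > 0" and f: "\<And>i. i \<in> I \<Longrightarrow> continuous_on (sphere 0 r) (f i)"
  shows "sphere_integral r (\<lambda>x. \<Sum>i\<in>I. f i x) = (\<Sum>i\<in>I. sphere_integral r (f i))"
  using f by (induction I rule: infinite_finite_induct)
    (simp_all add: sphere_integral_add[OF r] continuous_on_sum)

lemma sphere_integral_bound:
  fixes f :: "real^'n::finite \<Rightarrow> real"
  assumes r: "r > 0" and f: "continuous_on (sphere 0 r) f" and B: "\<And>x. norm x = r \<Longrightarrow> \<bar>f x\<bar> \<le> B"
  shows "\<bar>sphere_integral r f\<bar> \<le>
    real CARD('n) * measure (sphere_dirs :: (real^'n) measure) (sphere 0 1) * r ^ (CARD('n) - 1) * B"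
proof -
  have "\<bar>\<integral>\<theta>. f (r *\<^sub>R \<theta>) \<partial>sphere_dirs\<bar> \<le> (\<integral>\<theta>. B \<partial>(sphere_dirs :: (real^'n) measure))"
    using r by (intro integral_abs_bound_integral integrable_sphere_dirs sphere_scale_continuous f B) auto
  also have "\<dots> = B * measure (sphere_dirs :: (real^'n) measure) (sphere 0 1)" by simp
  finally show ?thesis
    using r by (simp add: sphere_integral_eq[OF r f] abs_mult mult_ac mult_left_mono)
qed

lemma sphere_integral_reflect:
  fixes f :: "real^'n::finite \<Rightarrow> real"
  assumes r: "r > 0" and f: "continuous_on (sphere 0 r) f"
  shows "sphere_integral r (\<lambda>x. f (- x)) = sphere_integral r f"
proof -
  have c: "continuous_on (sphere 0 r) (\<lambda>x. f (- x))"
    by (intro continuous_on_compose2[OF f]) (auto intro!: continuous_intros)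
  have "(\<integral>\<theta>. f (r *\<^sub>R (- \<theta>)) \<partial>sphere_dirs) = (\<integral>\<theta>. f (r *\<^sub>R \<theta>) \<partial>sphere_dirs)"
    by (rule sphere_dirs_isometry[OF sphere_scale_continuous[OF r f], of uminus uminus])
       (auto intro!: linearI)
  then show ?thesis by (simp add: sphere_integral_eq[OF r f] sphere_integral_eq[OF r c])
qed

text \<open>Differentiation under the integral sign: the mean value theorem turns the bound on
  \<open>\<phi>'\<close> into a common bound for the difference quotients, and dominated convergence
  applies.\<close>

lemma sphere_dirs_derivative:
  fixes \<phi> \<phi>' :: "real \<Rightarrow> real^'n::finite \<Rightarrow> real"
  assumes e: "e > 0" and c: "\<And>t. \<bar>t - t0\<bar> < e \<Longrightarrow> continuous_on (sphere 0 1) (\<phi> t)"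
    and c': "continuous_on (sphere 0 1) (\<phi>' t0)"
    and d: "\<And>t \<theta>. \<bar>t - t0\<bar> < e \<Longrightarrow> norm \<theta> = 1 \<Longrightarrow> ((\<lambda>t. \<phi> t \<theta>) has_real_derivative \<phi>' t \<theta>) (at t)"
    and B: "\<And>t \<theta>. \<bar>t - t0\<bar> < e \<Longrightarrow> norm \<theta> = 1 \<Longrightarrow> \<bar>\<phi>' t \<theta>\<bar> \<le> B"
  shows "((\<lambda>t. \<integral>\<theta>. \<phi> t \<theta> \<partial>sphere_dirs) has_real_derivative (\<integral>\<theta>. \<phi>' t0 \<theta> \<partial>sphere_dirs)) (at t0)"
  unfolding has_field_derivative_iff tendsto_at_iff_sequentially comp_def
proof (intro allI impI)
  fix X :: "nat \<Rightarrow> real" assume X: "\<forall>i. X i \<in> UNIV - {t0}" and lim: "X \<longlonglongrightarrow> t0"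
  \<comment> \<open>The default 0 makes measurability and the bound \<open>B\<close> hold for every
    index, although \<open>X i\<close> is close to \<open>t0\<close> only eventually.\<close>
  define s where "s i \<theta> = (if \<bar>X i - t0\<bar> < e then (\<phi> (X i) \<theta> - \<phi> t0 \<theta>) / (X i - t0) else 0)" for i \<theta>
  have ev: "eventually (\<lambda>i. \<bar>X i - t0\<bar> < e) sequentially"
    using tendstoD[OF lim e] by (simp add: dist_real_def)
  have "(\<lambda>i. \<integral>\<theta>. s i \<theta> \<partial>sphere_dirs) \<longlonglongrightarrow> (\<integral>\<theta>. \<phi>' t0 \<theta> \<partial>sphere_dirs)"
  proof (rule integral_dominated_convergence[where w = "\<lambda>_. B"])
    show "\<phi>' t0 \<in> borel_measurable sphere_dirs" by (rule borel_measurable_sphere_dirs[OF c'])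
    show "s i \<in> borel_measurable sphere_dirs" for i
    proof (cases "\<bar>X i - t0\<bar> < e")
      case True
      then show ?thesis
        unfolding s_def[abs_def] using c[of "X i"] c[of t0] e X
        by (auto intro!: borel_measurable_sphere_dirs continuous_intros)
    qed (simp add: s_def[abs_def])
    show "integrable sphere_dirs (\<lambda>_::real^'n. B)" by simp
    show "AE \<theta> in sphere_dirs. (\<lambda>i. s i \<theta>) \<longlonglongrightarrow> \<phi>' t0 \<theta>"
    proof (rule AE_I2)
      fix \<theta> :: "real^'n" assume "\<theta> \<in> space sphere_dirs"
      then have "((\<lambda>t. \<phi> t \<theta>) has_real_derivative \<phi>' t0 \<theta>) (at t0)" using d[of t0 \<theta>] e by simp
      then have "(\<lambda>i. (\<phi> (X i) \<theta> - \<phi> t0 \<theta>) / (X i - t0)) \<longlonglongrightarrow> \<phi>' t0 \<theta>"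
        using X lim unfolding has_field_derivative_iff tendsto_at_iff_sequentially comp_def by blast
      then show "(\<lambda>i. s i \<theta>) \<longlonglongrightarrow> \<phi>' t0 \<theta>"
        by (rule Lim_transform_eventually) (use ev in \<open>auto simp: s_def elim!: eventually_mono\<close>)
    qed
    show "AE \<theta> in sphere_dirs. norm (s i \<theta>) \<le> B" for i
    proof (rule AE_I2)
      fix \<theta> :: "real^'n" assume "\<theta> \<in> space sphere_dirs"
      then have \<theta>: "norm \<theta> = 1" by simp
      have B0: "B \<ge> 0" using B[of t0 \<theta>] e \<theta> by simp
      show "norm (s i \<theta>) \<le> B"
      proof (cases "\<bar>X i - t0\<bar> < e")
        case True
        have "norm (\<phi> (X i) \<theta> - \<phi> t0 \<theta>) \<le> B * norm (X i - t0)"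
        proof (rule field_differentiable_bound[of "ball t0 e"])
          fix t assume "t \<in> ball t0 e"
          then have t: "\<bar>t - t0\<bar> < e" by (simp add: dist_real_def abs_minus_commute)
          show "((\<lambda>t. \<phi> t \<theta>) has_field_derivative \<phi>' t \<theta>) (at t within ball t0 e)"
            using d[OF t \<theta>] by (rule has_field_derivative_at_within)
          show "norm (\<phi>' t \<theta>) \<le> B" using B[OF t \<theta>] by simp
        qed (use True e in \<open>auto simp: dist_real_def abs_minus_commute\<close>)
        then show ?thesis using True X B0 by (auto simp: s_def divide_le_eq abs_divide)
      qed (simp add: s_def B0)
    qed
  qed
  moreover have "eventually (\<lambda>i. (\<integral>\<theta>. s i \<theta> \<partial>sphere_dirs) = ((\<integral>\<theta>. \<phi> (X i) \<theta> \<partial>sphere_dirs) - (\<integral>\<theta>. \<phi> t0 \<theta> \<partial>sphere_dirs)) / (X i - t0)) sequentially"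
    using ev
  proof eventually_elim
    case (elim i)
    then show ?case
      using integrable_sphere_dirs[OF c[of "X i"]] integrable_sphere_dirs[OF c[of t0]] e by (simp add: s_def)
  qed
  ultimately show "(\<lambda>i. ((\<integral>\<theta>. \<phi> (X i) \<theta> \<partial>sphere_dirs) - (\<integral>\<theta>. \<phi> t0 \<theta> \<partial>sphere_dirs)) / (X i - t0)) \<longlonglongrightarrow> (\<integral>\<theta>. \<phi>' t0 \<theta> \<partial>sphere_dirs)"
    by (rule Lim_transform_eventually)
qed

section \<open>Rotation fields and integration by parts on spheres\<close>

lemma curve_derivative:
  fixes f :: "real^'n::finite \<Rightarrow> real"
  assumes "(\<gamma> has_vector_derivative v) (at t)" "f differentiable at (\<gamma> t)"
  shows "((\<lambda>t. f (\<gamma> t)) has_real_derivative (\<Sum>k\<in>UNIV. v $ k * partial k f (\<gamma> t))) (at t)"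
proof -
  have "((\<lambda>t. f (\<gamma> t)) has_derivative (\<lambda>s. \<Sum>k\<in>UNIV. (s *\<^sub>R v) $ k * partial k f (\<gamma> t))) (at t)"
    using has_derivative_compose[OF assms(1)[unfolded has_vector_derivative_def] has_derivative_partial[OF assms(2)]] .
  moreover have "(\<lambda>s. \<Sum>k\<in>UNIV. (s *\<^sub>R v) $ k * partial k f (\<gamma> t)) = (*) (\<Sum>k\<in>UNIV. v $ k * partial k f (\<gamma> t))"
    by (simp add: fun_eq_iff sum_distrib_left sum_distrib_right mult_ac)
  ultimately show ?thesis unfolding has_field_derivative_def by simp
qed

text \<open>Rotation by the angle \<open>t\<close> in the plane of coordinates \<open>i\<close> and
  \<open>j\<close>, written as a correction of the identity. It is the flow of the field x_i d_j -
  x_j d_i.\<close>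

definition plane_rotation :: "'n \<Rightarrow> 'n \<Rightarrow> real \<Rightarrow> real^'n::finite \<Rightarrow> real^'n" where
  "plane_rotation i j t x = x + ((cos t - 1) * x $ i - sin t * x $ j) *\<^sub>R axis i 1
     + (sin t * x $ i + (cos t - 1) * x $ j) *\<^sub>R axis j 1"

lemma plane_rotation_props:
  fixes x :: "real^'n::finite"
  assumes "i \<noteq> j"
  shows "linear (plane_rotation i j t)" "norm (plane_rotation i j t x) = norm x"
    "plane_rotation i j t (plane_rotation i j (- t) x) = x"
    "((\<lambda>t. plane_rotation i j t x) has_vector_derivative
       (- plane_rotation i j t x $ j) *\<^sub>R axis i 1 + (plane_rotation i j t x $ i) *\<^sub>R axis j 1) (at t)"
    "plane_rotation i j 0 x = x"
proof -
  have comp: "plane_rotation i j t x $ k = (if k = i then cos t * x $ i - sin t * x $ j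
      else if k = j then sin t * x $ i + cos t * x $ j else x $ k)" for k t and x :: "real^'n"
    using assms by (auto simp: plane_rotation_def axis_def algebra_simps)
  show "linear (plane_rotation i j t)"
    by (rule linearI) (auto simp: vec_eq_iff comp algebra_simps)
  show "plane_rotation i j 0 x = x" by (simp add: vec_eq_iff comp)
  have sc: "sin t * sin t = 1 - cos t * cos t"
    using sin_cos_squared_add[of t] by (simp add: power2_eq_square)
  have cc: "cos t * (cos t * z) + sin t * (sin t * z) = z" for z
    using arg_cong[OF sc, of "\<lambda>u. u * z"] by (simp add: algebra_simps)
  show "plane_rotation i j t (plane_rotation i j (- t) x) = x"
    using assms by (auto simp: vec_eq_iff comp algebra_simps cc)
  define a b where "a = (cos t - 1) * x $ i - sin t * x $ j" and "b = sin t * x $ i + (cos t - 1) * x $ j"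
  have "(x + a *\<^sub>R axis i 1 + b *\<^sub>R axis j 1) \<bullet> (x + a *\<^sub>R axis i 1 + b *\<^sub>R axis j 1)
      = x \<bullet> x + 2 * a * x $ i + 2 * b * x $ j + a * a + b * b" for a b
  proof -
    have "axis i (1::real) $ i = 1" "axis j (1::real) $ j = 1" "axis i (1::real) $ j = 0" "axis j (1::real) $ i = 0"
      using assms by (auto simp: axis_def)
    then show ?thesis
      by (simp add: inner_add_left inner_add_right inner_axis inner_axis' algebra_simps)
  qed
  then have "plane_rotation i j t x \<bullet> plane_rotation i j t x = x \<bullet> x + 2 * a * x $ i + 2 * b * x $ j + a * a + b * b"
    unfolding plane_rotation_def a_def[symmetric] b_def[symmetric] .
  moreover define z where "z = x $ i * x $ i + x $ j * x $ j"
  have "2 * a * x $ i + 2 * b * x $ j + a * a + b * b = cos t * (cos t * z) + sin t * (sin t * z) - z"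
    by (simp add: a_def b_def z_def algebra_simps)
  ultimately have "plane_rotation i j t x \<bullet> plane_rotation i j t x = x \<bullet> x" using cc[of z] by linarith
  then show "norm (plane_rotation i j t x) = norm x" by (simp add: norm_eq_sqrt_inner)
  have "((\<lambda>t. plane_rotation i j t x) has_vector_derivative
       (- sin t * x $ i - cos t * x $ j) *\<^sub>R axis i 1 + (cos t * x $ i - sin t * x $ j) *\<^sub>R axis j 1) (at t)"
    unfolding plane_rotation_def by (auto intro!: derivative_eq_intros simp: algebra_simps)
  then show "((\<lambda>t. plane_rotation i j t x) has_vector_derivative
       (- plane_rotation i j t x $ j) *\<^sub>R axis i 1 + (plane_rotation i j t x $ i) *\<^sub>R axis j 1) (at t)"
    using assms by (simp add: comp)
qed

lemma continuous_on_sphere_C1: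
  assumes "C1_on f U" "sphere 0 r \<subseteq> U"
  shows "continuous_on (sphere 0 r) f" "continuous_on (sphere 0 r) (partial i f)"
  using C1D(2,3)[OF assms(1)] assms(2) continuous_on_subset by blast+

text \<open>The integral of \<open>f\<close> composed with the rotation flow does not depend on
  time, and its derivative at time 0 is the integral in question.\<close>

lemma sphere_integral_rotation:
  fixes f :: "real^'n::finite \<Rightarrow> real"
  assumes r: "r > 0" and f: "C1_on f U" and U: "sphere 0 r \<subseteq> U"
  shows "sphere_integral r (\<lambda>x. x $ i * partial j f x - x $ j * partial i f x) = 0"
proof (cases "i = j")
  case False
  let ?R = "plane_rotation i j"
  note R = plane_rotation_props[OF False]
  define Lf where "Lf x = x $ i * partial j f x - x $ j * partial i f x" for x
  note cf = continuous_on_sphere_C1[OF f U]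
  have cL: "continuous_on (sphere 0 r) Lf"
    unfolding Lf_def by (intro continuous_intros cf)
  then have "bounded (Lf ` sphere 0 r)"
    by (intro compact_imp_bounded compact_continuous_image compact_sphere)
  then obtain B where B: "\<forall>x\<in>sphere 0 r. norm (Lf x) \<le> B" by (metis bounded_iff imageI)
  have cR: "continuous_on A (\<lambda>\<theta>. ?R t (r *\<^sub>R \<theta>))" for A t
    using R(1) by (intro continuous_on_compose2[OF linear_continuous_on[of "?R t" UNIV]])
      (auto simp: linear_conv_bounded_linear intro!: continuous_intros)
  have img: "(\<lambda>\<theta>. ?R t (r *\<^sub>R \<theta>)) ` sphere 0 1 \<subseteq> sphere 0 r" for t
    using r by (auto simp: R(2))
  have "((\<lambda>t. \<integral>\<theta>. f (?R t (r *\<^sub>R \<theta>)) \<partial>sphere_dirs) has_real_derivative (\<integral>\<theta>. Lf (?R 0 (r *\<^sub>R \<theta>)) \<partial>sphere_dirs)) (at 0)"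
  proof (rule sphere_dirs_derivative[of 1, where B = B])
    fix t and \<theta> :: "real^'n" assume \<theta>: "norm \<theta> = 1"
    then have in_S: "?R t (r *\<^sub>R \<theta>) \<in> sphere 0 r" using r by (simp add: R(2))
    have "((\<lambda>t. f (?R t (r *\<^sub>R \<theta>))) has_real_derivative (\<Sum>k\<in>UNIV.
        ((- ?R t (r *\<^sub>R \<theta>) $ j) *\<^sub>R axis i 1 + (?R t (r *\<^sub>R \<theta>) $ i) *\<^sub>R axis j 1 :: real^'n) $ k * partial k f (?R t (r *\<^sub>R \<theta>)))) (at t)"
      using in_S U C1D(1)[OF f] by (intro curve_derivative R(4)) auto
    also have "(\<Sum>k\<in>UNIV. ((- ?R t (r *\<^sub>R \<theta>) $ j) *\<^sub>R axis i 1 + (?R t (r *\<^sub>R \<theta>) $ i) *\<^sub>R axis j 1 :: real^'n) $ k * partial k f (?R t (r *\<^sub>R \<theta>)))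
       = Lf (?R t (r *\<^sub>R \<theta>))"
      by (simp add: distrib_right sum.distrib axis_def if_distrib[of "\<lambda>a. a * _"] if_distrib[of "\<lambda>a. _ * a"] Lf_def left_diff_distrib sum_subtractf cong: if_cong)
    finally show "((\<lambda>t. f (?R t (r *\<^sub>R \<theta>))) has_real_derivative Lf (?R t (r *\<^sub>R \<theta>))) (at t)" .
    show "\<bar>Lf (?R t (r *\<^sub>R \<theta>))\<bar> \<le> B" using B in_S by auto
  next
    fix t
    show "continuous_on (sphere 0 1) (\<lambda>\<theta>. f (?R t (r *\<^sub>R \<theta>)))"
      by (rule continuous_on_compose2[OF cf(1) cR img])
  next
    show "continuous_on (sphere 0 1) (\<lambda>\<theta>. Lf (?R 0 (r *\<^sub>R \<theta>)))"
      by (rule continuous_on_compose2[OF cL cR img])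
  qed simp
  moreover have "(\<integral>\<theta>. f (?R t (r *\<^sub>R \<theta>)) \<partial>sphere_dirs) = (\<integral>\<theta>. f (r *\<^sub>R \<theta>) \<partial>sphere_dirs)" for t
    using sphere_dirs_isometry[OF sphere_scale_continuous[OF r cf(1)] R(1)[of t] R(3)[of t] R(2)[of t]]
    by (simp add: linear_cmul[OF R(1)])
  ultimately have "((\<lambda>t::real. \<integral>\<theta>. f (r *\<^sub>R \<theta>) \<partial>sphere_dirs) has_real_derivative (\<integral>\<theta>. Lf (r *\<^sub>R \<theta>) \<partial>sphere_dirs)) (at 0)"
    by (simp add: R(5))
  then have "(\<integral>\<theta>. Lf (r *\<^sub>R \<theta>) \<partial>sphere_dirs) = 0"
    using DERIV_const DERIV_unique by blast
  then show ?thesis by (simp add: sphere_integral_eq[OF r cL] Lf_def[abs_def, symmetric])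
qed (simp add: mult.commute)

text \<open>The product rule for a derivation whose integral over the sphere vanishes.\<close>

lemma sphere_integral_rotation_parts:
  fixes f g :: "real^'n::finite \<Rightarrow> real"
  assumes r: "r > 0" and f: "C1_on f U" and g: "C1_on g U" and U: "sphere 0 r \<subseteq> U"
  shows "sphere_integral r (\<lambda>x. g x * (x $ i * partial j f x - x $ j * partial i f x))
    = - sphere_integral r (\<lambda>x. (x $ i * partial j g x - x $ j * partial i g x) * f x)"
proof -
  note cf = continuous_on_sphere_C1[OF f U] and cg = continuous_on_sphere_C1[OF g U]
  have "0 = sphere_integral r (\<lambda>x. x $ i * partial j (\<lambda>x. g x * f x) x - x $ j * partial i (\<lambda>x. g x * f x) x)"
    by (rule sphere_integral_rotation[OF r C1_mult[OF g f] U, symmetric])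
  also have "\<dots> = sphere_integral r (\<lambda>x. g x * (x $ i * partial j f x - x $ j * partial i f x)
      + (x $ i * partial j g x - x $ j * partial i g x) * f x)"
  proof (rule sphere_integral_cong)
    fix x :: "real^'n" assume "norm x = r"
    then have "x \<in> U" using U by auto
    then show "x $ i * partial j (\<lambda>x. g x * f x) x - x $ j * partial i (\<lambda>x. g x * f x) x
      = g x * (x $ i * partial j f x - x $ j * partial i f x) + (x $ i * partial j g x - x $ j * partial i g x) * f x"
      by (simp add: partial_mult C1D(1)[OF f] C1D(1)[OF g] algebra_simps)
  qed
  also have "\<dots> = sphere_integral r (\<lambda>x. g x * (x $ i * partial j f x - x $ j * partial i f x))
     + sphere_integral r (\<lambda>x. (x $ i * partial j g x - x $ j * partial i g x) * f x)"
    by (intro sphere_integral_add r continuous_intros cf cg)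
  finally show ?thesis by simp
qed

text \<open>Skewness lets the sum be averaged with the one that has \<open>k\<close> and
  \<open>a\<close> exchanged, and each averaged term is a rotational derivative. Thus the radial
  component of the divergence of a skew field involves only tangential derivatives.\<close>

lemma sphere_integral_antisym_divergence:
  fixes V :: "'n \<Rightarrow> 'n \<Rightarrow> real^'n::finite \<Rightarrow> real"
  assumes r: "r > 0" and V: "\<And>k a. C1_on (V k a) U" and U: "sphere 0 r \<subseteq> U" "open U"
    and anti: "\<And>k a x. V k a x = - V a k x"
  shows "sphere_integral r (\<lambda>x. \<Sum>k\<in>UNIV. \<Sum>a\<in>UNIV. x $ k * partial a (V k a) x) = 0"
proof -
  note c = continuous_on_sphere_C1[OF V U(1)]
  have "sphere_integral r (\<lambda>x. \<Sum>k\<in>UNIV. \<Sum>a\<in>UNIV. x $ k * partial a (V k a) x)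
     = sphere_integral r (\<lambda>x. 1/2 * (\<Sum>k\<in>UNIV. \<Sum>a\<in>UNIV. x $ k * partial a (V k a) x - x $ a * partial k (V k a) x))"
  proof (rule sphere_integral_cong)
    fix x :: "real^'n" assume "norm x = r"
    then have x: "x \<in> U" using U by auto
    have "partial a (V k a) x = - partial a (V a k) x" for a k
    proof -
      have "partial a (V k a) x = partial a (\<lambda>y. - V a k y) x"
        by (rule arg_cong[of _ _ "\<lambda>f. partial a f x"]) (rule ext, rule anti)
      then show ?thesis by (simp add: partial_minus C1D(1)[OF V x])
    qed
    then have "(\<Sum>k\<in>UNIV. \<Sum>a\<in>UNIV. x $ k * partial a (V k a) x) = (\<Sum>k\<in>UNIV. \<Sum>a\<in>UNIV. - (x $ k * partial a (V a k) x))"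
      by (intro sum.cong refl) simp
    also have "\<dots> = (\<Sum>k\<in>UNIV. \<Sum>a\<in>UNIV. - (x $ a * partial k (V k a) x))"
      by (rule sum.swap)
    finally have "(\<Sum>k\<in>UNIV. \<Sum>a\<in>UNIV. x $ k * partial a (V k a) x) = - (\<Sum>k\<in>UNIV. \<Sum>a\<in>UNIV. x $ a * partial k (V k a) x)"
      by (simp add: sum_negf)
    then show "(\<Sum>k\<in>UNIV. \<Sum>a\<in>UNIV. x $ k * partial a (V k a) x)
       = 1/2 * (\<Sum>k\<in>UNIV. \<Sum>a\<in>UNIV. x $ k * partial a (V k a) x - x $ a * partial k (V k a) x)"
      by (simp add: sum_subtractf)
  qed
  also have "\<dots> = 1/2 * (\<Sum>k\<in>UNIV. \<Sum>a\<in>UNIV. sphere_integral r (\<lambda>x. x $ k * partial a (V k a) x - x $ a * partial k (V k a) x))"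
    by (simp only: sphere_integral_cmult[OF r] sphere_integral_sum[OF r] continuous_on_sum continuous_intros c)
  also have "\<dots> = 0" by (simp add: sphere_integral_rotation[OF r V U(1)])
  finally show ?thesis .
qed

section \<open>Radial derivative of the flux through spheres\<close>

lemma sphere_dirs_flux_derivative:
  fixes W :: "'n \<Rightarrow> real^'n::finite \<Rightarrow> real"
  assumes R: "0 \<le> R" "R < r" and W: "\<And>k. C1_on (W k) {x. R < norm x}"
  shows "((\<lambda>\<rho>. \<integral>\<theta>. (\<Sum>k\<in>UNIV. W k (\<rho> *\<^sub>R \<theta>) * \<theta> $ k) \<partial>sphere_dirs) has_real_derivative
    (\<integral>\<theta>. (\<Sum>k\<in>UNIV. (\<Sum>i\<in>UNIV. \<theta> $ i * partial i (W k) (r *\<^sub>R \<theta>)) * \<theta> $ k) \<partial>sphere_dirs)) (at r)"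
proof -
  let ?U = "{x::real^'n. R < norm x}"
  have U: "sphere 0 \<rho> \<subseteq> ?U" if "R < \<rho>" for \<rho> :: real using that by auto
  note c = continuous_on_sphere_C1[OF W U]
  have W1: "continuous_on (sphere 0 1) (\<lambda>\<theta>. W k (\<rho> *\<^sub>R \<theta>))" "continuous_on (sphere 0 1) (\<lambda>\<theta>. partial i (W k) (\<rho> *\<^sub>R \<theta>))"
    if "R < \<rho>" for \<rho> k i
    using c[OF that] that R by (auto intro!: sphere_scale_continuous)
  define e where "e = (r - R) / 2"
  have e: "e > 0" "R < r - e" using R by (auto simp: e_def field_simps)
  \<comment> \<open>A compact shell around radius \<open>r\<close>, on which continuity of the
    derivatives supplies one bound for all nearby radii.\<close>
  let ?K = "cball 0 (r + e) - ball 0 (r - e) :: (real^'n) set"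
  have K: "?K \<subseteq> ?U" using e by auto
  have cK: "continuous_on ?K (\<lambda>x. \<Sum>k\<in>UNIV. \<Sum>i\<in>UNIV. \<bar>partial i (W k) x\<bar>)"
    by (intro continuous_intros continuous_on_subset[OF C1D(2)[OF W] K])
  have "compact ?K" by (intro compact_diff) auto
  then have "bounded ((\<lambda>x. \<Sum>k\<in>UNIV. \<Sum>i\<in>UNIV. \<bar>partial i (W k) x\<bar>) ` ?K)"
    by (intro compact_imp_bounded compact_continuous_image cK)
  then obtain B where B: "\<forall>x\<in>?K. norm (\<Sum>k\<in>UNIV. \<Sum>i\<in>UNIV. \<bar>partial i (W k) x\<bar>) \<le> B"
    unfolding bounded_iff by blast
  show ?thesis
  proof (rule sphere_dirs_derivative[OF e(1), where B = B and \<phi> = "\<lambda>t \<theta>. \<Sum>k\<in>UNIV. W k (t *\<^sub>R \<theta>) * \<theta> $ k"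
        and \<phi>' = "\<lambda>t \<theta>. \<Sum>k\<in>UNIV. (\<Sum>i\<in>UNIV. \<theta> $ i * partial i (W k) (t *\<^sub>R \<theta>)) * \<theta> $ k"])
    fix t assume t: "\<bar>t - r\<bar> < e"
    then have tR: "R < t" using e by linarith
    show "continuous_on (sphere 0 1) (\<lambda>\<theta>. \<Sum>k\<in>UNIV. W k (t *\<^sub>R \<theta>) * \<theta> $ k)"
      by (intro continuous_intros W1 tR)
    fix \<theta> :: "real^'n" assume \<theta>: "norm \<theta> = 1"
    have tU: "t *\<^sub>R \<theta> \<in> ?U" using tR R \<theta> by simp
    have lin: "((\<lambda>t. t *\<^sub>R \<theta>) has_vector_derivative \<theta>) (at t)"
      by (auto intro!: derivative_eq_intros)
    show "((\<lambda>t. \<Sum>k\<in>UNIV. W k (t *\<^sub>R \<theta>) * \<theta> $ k) has_real_derivative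
       (\<Sum>k\<in>UNIV. (\<Sum>i\<in>UNIV. \<theta> $ i * partial i (W k) (t *\<^sub>R \<theta>)) * \<theta> $ k)) (at t)"
    proof (rule DERIV_sum)
      fix k
      show "((\<lambda>t. W k (t *\<^sub>R \<theta>) * \<theta> $ k) has_real_derivative
        (\<Sum>i\<in>UNIV. \<theta> $ i * partial i (W k) (t *\<^sub>R \<theta>)) * \<theta> $ k) (at t)"
        by (rule DERIV_cmult_right[OF curve_derivative[OF lin C1D(1)[OF W tU]]])
    qed
    have "norm (t *\<^sub>R \<theta>) = t" using tR R \<theta> by simp
    moreover have "r - e \<le> t" "t \<le> r + e" using t by linarith+
    ultimately have tK: "t *\<^sub>R \<theta> \<in> ?K" by simp
    have comp: "\<bar>\<theta> $ i\<bar> \<le> 1" for i using component_le_norm_cart[of \<theta> i] \<theta> by simp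
    have "\<bar>\<Sum>k\<in>UNIV. (\<Sum>i\<in>UNIV. \<theta> $ i * partial i (W k) (t *\<^sub>R \<theta>)) * \<theta> $ k\<bar>
        \<le> (\<Sum>k\<in>UNIV. \<bar>(\<Sum>i\<in>UNIV. \<theta> $ i * partial i (W k) (t *\<^sub>R \<theta>)) * \<theta> $ k\<bar>)"
      by (rule sum_abs)
    also have "\<dots> \<le> (\<Sum>k\<in>UNIV. \<Sum>i\<in>UNIV. \<bar>partial i (W k) (t *\<^sub>R \<theta>)\<bar>)"
    proof (rule sum_mono)
      fix k
      have "\<bar>(\<Sum>i\<in>UNIV. \<theta> $ i * partial i (W k) (t *\<^sub>R \<theta>)) * \<theta> $ k\<bar> \<le> \<bar>\<Sum>i\<in>UNIV. \<theta> $ i * partial i (W k) (t *\<^sub>R \<theta>)\<bar>"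
        using comp[of k] by (simp add: abs_mult mult_left_le)
      also have "\<dots> \<le> (\<Sum>i\<in>UNIV. \<bar>\<theta> $ i * partial i (W k) (t *\<^sub>R \<theta>)\<bar>)" by (rule sum_abs)
      also have "\<dots> \<le> (\<Sum>i\<in>UNIV. \<bar>partial i (W k) (t *\<^sub>R \<theta>)\<bar>)"
        using comp by (intro sum_mono) (simp add: abs_mult mult_left_le_one_le)
      finally show "\<bar>(\<Sum>i\<in>UNIV. \<theta> $ i * partial i (W k) (t *\<^sub>R \<theta>)) * \<theta> $ k\<bar> \<le> (\<Sum>i\<in>UNIV. \<bar>partial i (W k) (t *\<^sub>R \<theta>)\<bar>)" .
    qed
    also have "\<dots> \<le> B" using bspec[OF B tK] by simp
    finally show "\<bar>\<Sum>k\<in>UNIV. (\<Sum>i\<in>UNIV. \<theta> $ i * partial i (W k) (t *\<^sub>R \<theta>)) * \<theta> $ k\<bar> \<le> B" .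
  next
    show "continuous_on (sphere 0 1) (\<lambda>\<theta>. \<Sum>k\<in>UNIV. (\<Sum>i\<in>UNIV. \<theta> $ i * partial i (W k) (r *\<^sub>R \<theta>)) * \<theta> $ k)"
      by (intro continuous_intros W1 R)
  qed
qed

text \<open>Obtained by summing the vanishing integrals of the rotational derivatives of x_k W_i
  over all k and i. Derivatives of W give r^2 times the divergence minus the radial term;
  derivatives of the coordinate factor give (1 - n) times the radial component.\<close>

lemma sphere_integral_divergence:
  fixes W :: "'n \<Rightarrow> real^'n::finite \<Rightarrow> real"
  assumes r: "0 < r" and W: "\<And>k. C1_on (W k) U" and U: "sphere 0 r \<subseteq> U"
  shows "r * r * sphere_integral r (\<lambda>x. \<Sum>k\<in>UNIV. partial k (W k) x)
    = sphere_integral r (\<lambda>x. \<Sum>k\<in>UNIV. \<Sum>i\<in>UNIV. x $ i * x $ k * partial i (W k) x)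
      + (real CARD('n) - 1) * sphere_integral r (\<lambda>x. \<Sum>k\<in>UNIV. W k x * x $ k)"
proof -
  let ?n = "CARD('n)"
  note c = continuous_on_sphere_C1[OF W U]
  define I :: "(real^'n \<Rightarrow> real) \<Rightarrow> real" where "I = sphere_integral r"
  have cd: "continuous_on (sphere 0 r) (\<lambda>x. \<Sum>k\<in>UNIV. partial k (W k) x)"
    by (intro continuous_intros c)
  have "0 = (\<Sum>k\<in>UNIV. \<Sum>i\<in>UNIV. I (\<lambda>x. x $ k * partial i (\<lambda>x. x $ k * W i x) x - x $ i * partial k (\<lambda>x. x $ k * W i x) x))"
    unfolding I_def by (simp add: sphere_integral_rotation[OF r C1_mult[OF C1_coord W] U])
  also have "\<dots> = (\<Sum>k\<in>UNIV. \<Sum>i\<in>UNIV. I (\<lambda>x. (x $ k * x $ k * partial i (W i) x - x $ k * x $ i * partial k (W i) x)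
      + ((if i = k then x $ k * W i x else 0) - x $ i * W i x)))"
    unfolding I_def
  proof (intro sum.cong refl sphere_integral_cong)
    fix k i and x :: "real^'n" assume "norm x = r"
    then have "x \<in> U" using U by auto
    then show "x $ k * partial i (\<lambda>x. x $ k * W i x) x - x $ i * partial k (\<lambda>x. x $ k * W i x) x
      = (x $ k * x $ k * partial i (W i) x - x $ k * x $ i * partial k (W i) x)
      + ((if i = k then x $ k * W i x else 0) - x $ i * W i x)"
      by (simp add: partial_mult C1D(1)[OF W] partial_coord algebra_simps)
  qed
  also have "\<dots> = I (\<lambda>x. \<Sum>k\<in>UNIV. \<Sum>i\<in>UNIV. (x $ k * x $ k * partial i (W i) x - x $ k * x $ i * partial k (W i) x)
      + ((if i = k then x $ k * W i x else 0) - x $ i * W i x))"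
  proof -
    have ci: "continuous_on (sphere 0 r) (\<lambda>x. (x $ k * x $ k * partial i (W i) x - x $ k * x $ i * partial k (W i) x)
      + ((if i = k then x $ k * W i x else 0) - x $ i * W i x))" for k i
      by (cases "i = k") (auto intro!: continuous_intros c)
    then show ?thesis
      unfolding I_def by (simp only: sphere_integral_sum[OF r] continuous_on_sum)
  qed
  also have "\<dots> = I (\<lambda>x. (r * r * (\<Sum>k\<in>UNIV. partial k (W k) x) - (\<Sum>k\<in>UNIV. \<Sum>i\<in>UNIV. x $ i * x $ k * partial i (W k) x))
      - (real ?n - 1) * (\<Sum>k\<in>UNIV. W k x * x $ k))"
    unfolding I_def
  proof (rule sphere_integral_cong)
    fix x :: "real^'n" assume "norm x = r"
    then have rr: "(\<Sum>k\<in>UNIV. x $ k * x $ k) = r * r"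
      using dot_square_norm[of x] by (simp add: inner_vec_def power2_eq_square)
    have a: "(\<Sum>k\<in>UNIV. \<Sum>i\<in>UNIV. x $ k * x $ k * partial i (W i) x) = r * r * (\<Sum>k\<in>UNIV. partial k (W k) x)"
      unfolding rr[symmetric] by (subst sum.swap) (simp add: sum_distrib_left sum_distrib_right)
    have b: "(\<Sum>k\<in>UNIV. \<Sum>i\<in>UNIV. x $ k * x $ i * partial k (W i) x) = (\<Sum>k\<in>UNIV. \<Sum>i\<in>UNIV. x $ i * x $ k * partial i (W k) x)"
      by (rule sum.swap)
    have c: "(\<Sum>k\<in>UNIV. \<Sum>i\<in>UNIV. (if i = k then x $ k * W i x else 0) - x $ i * W i x) = - ((real ?n - 1) * (\<Sum>k\<in>UNIV. W k x * x $ k))"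
      by (simp add: sum_subtractf mult.commute left_diff_distrib)
    show "(\<Sum>k\<in>UNIV. \<Sum>i\<in>UNIV. (x $ k * x $ k * partial i (W i) x - x $ k * x $ i * partial k (W i) x)
      + ((if i = k then x $ k * W i x else 0) - x $ i * W i x)) =
      (r * r * (\<Sum>k\<in>UNIV. partial k (W k) x) - (\<Sum>k\<in>UNIV. \<Sum>i\<in>UNIV. x $ i * x $ k * partial i (W k) x))
      - (real ?n - 1) * (\<Sum>k\<in>UNIV. W k x * x $ k)"
      using a b c by (simp add: sum.distrib sum_subtractf)
  qed
  also have "\<dots> = (r * r * I (\<lambda>x. \<Sum>k\<in>UNIV. partial k (W k) x) - I (\<lambda>x. \<Sum>k\<in>UNIV. \<Sum>i\<in>UNIV. x $ i * x $ k * partial i (W k) x))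
      - (real ?n - 1) * I (\<lambda>x. \<Sum>k\<in>UNIV. W k x * x $ k)"
  proof -
    have c1: "continuous_on (sphere 0 r) (\<lambda>x. \<Sum>k\<in>UNIV. \<Sum>i\<in>UNIV. x $ i * x $ k * partial i (W k) x)"
      and c2: "continuous_on (sphere 0 r) (\<lambda>x. \<Sum>k\<in>UNIV. W k x * x $ k)"
      by (intro continuous_intros c)+
    show ?thesis
      unfolding I_def sphere_integral_cmult[OF r cd, symmetric] sphere_integral_cmult[OF r c2, symmetric]
      by (simp add: sphere_integral_diff[OF r] continuous_on_diff continuous_on_mult_left cd c1 c2)
  qed
  finally show ?thesis by (simp add: I_def)
qed

text \<open>The divergence theorem in infinitesimal form. In n \<rho>^(n - 1) g(\<rho>),
  differentiating the power and differentiating \<open>g\<close> yield the two terms on the right of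
  \<open>sphere_integral_divergence\<close>.\<close>

lemma sphere_flux_derivative:
  fixes W :: "'n \<Rightarrow> real^'n::finite \<Rightarrow> real"
  assumes R: "0 \<le> R" "R < r" and W: "\<And>k. C1_on (W k) {x. R < norm x}"
  shows "((\<lambda>\<rho>. sphere_integral \<rho> (\<lambda>x. \<Sum>k\<in>UNIV. W k x * euclidean_normal x $ k)) has_real_derivative
     sphere_integral r (\<lambda>x. \<Sum>k\<in>UNIV. partial k (W k) x)) (at r)"
proof -
  let ?U = "{x::real^'n. R < norm x}" and ?n = "CARD('n)"
  have r: "r > 0" using R by simp
  have U: "sphere 0 \<rho> \<subseteq> ?U" if "R < \<rho>" for \<rho> :: real using that by auto
  note c = continuous_on_sphere_C1[OF W U]
  have W1: "continuous_on (sphere 0 1) (\<lambda>\<theta>. W k (\<rho> *\<^sub>R \<theta>))" "continuous_on (sphere 0 1) (\<lambda>\<theta>. partial i (W k) (\<rho> *\<^sub>R \<theta>))"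
    if "R < \<rho>" for \<rho> k i
    using c[OF that] that R by (auto intro!: sphere_scale_continuous)
  define g where "g (\<rho>::real) = (\<integral>\<theta>. (\<Sum>k\<in>UNIV. W k (\<rho> *\<^sub>R \<theta>) * \<theta> $ k) \<partial>sphere_dirs)" for \<rho>
  define g' where "g' (\<rho>::real) = (\<integral>\<theta>. (\<Sum>k\<in>UNIV. (\<Sum>i\<in>UNIV. \<theta> $ i * partial i (W k) (\<rho> *\<^sub>R \<theta>)) * \<theta> $ k) \<partial>sphere_dirs)" for \<rho>
  have F: "sphere_integral \<rho> (\<lambda>x. \<Sum>k\<in>UNIV. W k x * euclidean_normal x $ k) = real ?n * \<rho> ^ (?n - 1) * g \<rho>" if "R < \<rho>" for \<rho> :: real
  proof -
    have "0 < \<rho>" using that R by simp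
    moreover have "continuous_on (sphere 0 \<rho>) (\<lambda>x. \<Sum>k\<in>UNIV. W k x * euclidean_normal x $ k)"
      unfolding euclidean_normal_def using that R by (intro continuous_intros c that) auto
    ultimately have "sphere_integral \<rho> (\<lambda>x. \<Sum>k\<in>UNIV. W k x * euclidean_normal x $ k)
       = real ?n * \<rho> ^ (?n - 1) * (\<integral>\<theta>. (\<Sum>k\<in>UNIV. W k (\<rho> *\<^sub>R \<theta>) * euclidean_normal (\<rho> *\<^sub>R \<theta>) $ k) \<partial>sphere_dirs)"
      by (rule sphere_integral_eq)
    also have "(\<integral>\<theta>. (\<Sum>k\<in>UNIV. W k (\<rho> *\<^sub>R \<theta>) * euclidean_normal (\<rho> *\<^sub>R \<theta>) $ k) \<partial>sphere_dirs) = g \<rho>"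
      unfolding g_def using that R
      by (intro Bochner_Integration.integral_cong) (auto simp: euclidean_normal_def)
    finally show ?thesis .
  qed
  have dg: "(g has_real_derivative g' r) (at r)"
    unfolding g_def[abs_def] g'_def by (rule sphere_dirs_flux_derivative[OF R W])
  have "((\<lambda>\<rho>. real ?n * \<rho> ^ (?n - 1) * g \<rho>) has_real_derivative real ?n * ((real (?n - 1) * r ^ (?n - 1 - 1)) * g r + r ^ (?n - 1) * g' r)) (at r)"
    by (auto intro!: derivative_eq_intros dg simp: algebra_simps)
  then have deriv: "((\<lambda>\<rho>. sphere_integral \<rho> (\<lambda>x. \<Sum>k\<in>UNIV. W k x * euclidean_normal x $ k)) has_real_derivative
      real ?n * ((real (?n - 1) * r ^ (?n - 1 - 1)) * g r + r ^ (?n - 1) * g' r)) (at r)"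
    by (rule has_field_derivative_transform_within_open[of _ _ _ "{R<..}"]) (use R F in auto)
  define I :: "(real^'n \<Rightarrow> real) \<Rightarrow> real" where "I = sphere_integral r"
  have i1: "I (\<lambda>x. \<Sum>k\<in>UNIV. W k x * x $ k) = real ?n * r ^ (?n - 1) * (r * g r)"
  proof -
    have "I (\<lambda>x. \<Sum>k\<in>UNIV. W k x * x $ k) = real ?n * r ^ (?n - 1) * (\<integral>\<theta>. (\<Sum>k\<in>UNIV. W k (r *\<^sub>R \<theta>) * (r *\<^sub>R \<theta>) $ k) \<partial>sphere_dirs)"
      unfolding I_def by (rule sphere_integral_eq[OF r]) (intro continuous_intros c R)
    moreover have "(\<lambda>\<theta>. \<Sum>k\<in>UNIV. W k (r *\<^sub>R \<theta>) * (r *\<^sub>R \<theta>) $ k) = (\<lambda>\<theta>. r * (\<Sum>k\<in>UNIV. W k (r *\<^sub>R \<theta>) * \<theta> $ k))"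
      by (simp add: fun_eq_iff sum_distrib_left mult_ac)
    ultimately show ?thesis by (simp add: g_def)
  qed
  have i2: "I (\<lambda>x. \<Sum>k\<in>UNIV. \<Sum>i\<in>UNIV. x $ i * x $ k * partial i (W k) x) = real ?n * r ^ (?n - 1) * (r * (r * g' r))"
  proof -
    have "I (\<lambda>x. \<Sum>k\<in>UNIV. \<Sum>i\<in>UNIV. x $ i * x $ k * partial i (W k) x)
       = real ?n * r ^ (?n - 1) * (\<integral>\<theta>. (\<Sum>k\<in>UNIV. \<Sum>i\<in>UNIV. (r *\<^sub>R \<theta>) $ i * (r *\<^sub>R \<theta>) $ k * partial i (W k) (r *\<^sub>R \<theta>)) \<partial>sphere_dirs)"
      unfolding I_def by (rule sphere_integral_eq[OF r]) (intro continuous_intros c R)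
    moreover have "(\<lambda>\<theta>. \<Sum>k\<in>UNIV. \<Sum>i\<in>UNIV. (r *\<^sub>R \<theta>) $ i * (r *\<^sub>R \<theta>) $ k * partial i (W k) (r *\<^sub>R \<theta>))
       = (\<lambda>\<theta>. r * (r * (\<Sum>k\<in>UNIV. (\<Sum>i\<in>UNIV. \<theta> $ i * partial i (W k) (r *\<^sub>R \<theta>)) * \<theta> $ k)))"
      by (simp add: fun_eq_iff sum_distrib_left sum_distrib_right mult_ac)
    ultimately show ?thesis by (simp add: g'_def)
  qed
  have "r * r * I (\<lambda>x. \<Sum>k\<in>UNIV. partial k (W k) x) = real ?n * r ^ (?n - 1) * (r * (r * g' r)) + (real ?n - 1) * (real ?n * r ^ (?n - 1) * (r * g r))"
    using sphere_integral_divergence[OF r W U[OF R(2)]] i1 i2 unfolding I_def by simp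
  also have "\<dots> = r * r * (real ?n * ((real (?n - 1) * r ^ (?n - 1 - 1)) * g r + r ^ (?n - 1) * g' r))"
  \<comment> \<open>In dimension one the exponent \<open>?n - 1 - 1\<close> is truncated to 0, but
    its coefficient vanishes.\<close>
  proof (cases "?n - 1")
    case 0
    then have "?n = 1" by (metis One_nat_def Suc_pred zero_less_card_finite)
    then show ?thesis by (simp add: algebra_simps)
  next
    case (Suc m)
    then have "real ?n = real m + 2" by simp
    then show ?thesis unfolding Suc by (simp add: algebra_simps)
  qed
  finally have "I (\<lambda>x. \<Sum>k\<in>UNIV. partial k (W k) x) = real ?n * ((real (?n - 1) * r ^ (?n - 1 - 1)) * g r + r ^ (?n - 1) * g' r)"
    using r by simp
  then show ?thesis using deriv by (simp add: I_def)
qed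

section \<open>Polar coordinates\<close>

text \<open>The mass that cancels the factor |x|^n left over in the passage to polar
  coordinates.\<close>

lemma nn_integral_power_tail:
  assumes "a > 0" "n > 0"
  shows "(\<integral>\<^sup>+s. ennreal (real n * s powr (- real n - 1)) * indicator {a..} s \<partial>lborel) = ennreal (a powr (- real n))"
proof -
  have "(\<integral>\<^sup>+s. ennreal (real n * s powr (- real n - 1)) * indicator {a..} s \<partial>lborel) = ennreal (0 - (- (a powr (- real n))))"
  proof (rule nn_integral_FTC_atLeast)
    fix s assume "a \<le> s"
    then show "((\<lambda>s. - (s powr (- real n))) has_real_derivative real n * s powr (- real n - 1)) (at s)"
      using assms by (auto intro!: derivative_eq_intros)
    show "0 \<le> real n * s powr (- real n - 1)" by simp
  next
    have "((\<lambda>s. s powr (- real n)) \<longlongrightarrow> 0) at_top"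
      using assms by (intro tendsto_neg_powr filterlim_ident) auto
    then show "((\<lambda>s. - (s powr (- real n))) \<longlongrightarrow> 0) at_top"
      using tendsto_minus by fastforce
  qed simp
  then show ?thesis by simp
qed

text \<open>The dilation \<open>\<rho> = s |y|\<close> turns the integral over directions into integrals over dilated
  copies of \<open>g\<close>, to which linear substitution applies.\<close>

lemma polar_nn_integral:
  fixes g :: "real^'n::finite \<Rightarrow> ennreal"
  assumes g[measurable]: "g \<in> borel_measurable borel"
  shows "(\<integral>\<^sup>+\<rho>. indicator {0<..} \<rho> * ennreal (real CARD('n) * \<rho> ^ (CARD('n) - 1)) *
      (\<integral>\<^sup>+y. indicator (cball 0 1 - {0}) y * g (\<rho> *\<^sub>R (y /\<^sub>R norm y)) \<partial>lborel) \<partial>lborel) = (\<integral>\<^sup>+x. g x \<partial>lborel)"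
proof -
  let ?n = "CARD('n)"
  define C :: "real^'n \<Rightarrow> ennreal" where "C = indicator (cball 0 1 - {0})"
  have [measurable]: "C \<in> borel_measurable borel" unfolding C_def by (rule borel_measurable_indicator) simp
  define P :: "real \<Rightarrow> ennreal" where "P \<rho> = indicator {0<..} \<rho> * ennreal (real ?n * \<rho> ^ (?n - 1))" for \<rho>
  have [measurable]: "P \<in> borel_measurable borel" unfolding P_def[abs_def] by measurable
  have npos: "?n > 0" by simp
  have "(\<integral>\<^sup>+\<rho>. P \<rho> * (\<integral>\<^sup>+y. C y * g (\<rho> *\<^sub>R (y /\<^sub>R norm y)) \<partial>lborel) \<partial>lborel)
    = (\<integral>\<^sup>+\<rho>. (\<integral>\<^sup>+y. P \<rho> * (C y * g (\<rho> *\<^sub>R (y /\<^sub>R norm y))) \<partial>lborel) \<partial>lborel)"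
    by (intro nn_integral_cong nn_integral_cmult[symmetric]) measurable
  also have "\<dots> = (\<integral>\<^sup>+y. (\<integral>\<^sup>+\<rho>. P \<rho> * (C y * g (\<rho> *\<^sub>R (y /\<^sub>R norm y))) \<partial>lborel) \<partial>lborel)"
    by (rule lborel_pair.Fubini') measurable
  also have "\<dots> = (\<integral>\<^sup>+y. (\<integral>\<^sup>+s. P s * (C y * (ennreal (norm y ^ ?n) * g (s *\<^sub>R y))) \<partial>lborel) \<partial>lborel)"
  proof (rule nn_integral_cong)
    fix y :: "real^'n"
    show "(\<integral>\<^sup>+\<rho>. P \<rho> * (C y * g (\<rho> *\<^sub>R (y /\<^sub>R norm y))) \<partial>lborel) = (\<integral>\<^sup>+s. P s * (C y * (ennreal (norm y ^ ?n) * g (s *\<^sub>R y))) \<partial>lborel)"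
    proof (cases "y = 0")
      case True
      then show ?thesis by (simp add: C_def)
    next
      case False
      then have ny: "norm y > 0" by simp
      have "(\<integral>\<^sup>+\<rho>. P \<rho> * (C y * g (\<rho> *\<^sub>R (y /\<^sub>R norm y))) \<partial>lborel)
         = ennreal \<bar>norm y\<bar> * (\<integral>\<^sup>+s. P (0 + norm y * s) * (C y * g ((0 + norm y * s) *\<^sub>R (y /\<^sub>R norm y))) \<partial>lborel)"
        using ny by (intro nn_integral_real_affine) auto
      also have "\<dots> = (\<integral>\<^sup>+s. ennreal (norm y) * (P (norm y * s) * (C y * g ((norm y * s) *\<^sub>R (y /\<^sub>R norm y)))) \<partial>lborel)"
        by (subst nn_integral_cmult) auto
      also have "\<dots> = (\<integral>\<^sup>+s. P s * (C y * (ennreal (norm y ^ ?n) * g (s *\<^sub>R y))) \<partial>lborel)"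
      proof (rule nn_integral_cong)
        fix s :: real
        have "ennreal (norm y) * P (norm y * s) = P s * ennreal (norm y ^ ?n)"
        proof (cases "s > 0")
          case True
          then have "norm y * (real ?n * (norm y * s) ^ (?n - 1)) = (real ?n * s ^ (?n - 1)) * norm y ^ ?n"
            using npos by (simp add: power_mult_distrib power_eq_if[of "norm y" ?n])
          then show ?thesis
            using True ny by (simp add: P_def flip: ennreal_mult')
        next
          case False
          then show ?thesis using ny by (simp add: P_def zero_less_mult_iff)
        qed
        then have "ennreal (norm y) * (P (norm y * s) * (C y * g (s *\<^sub>R y))) = P s * ennreal (norm y ^ ?n) * (C y * g (s *\<^sub>R y))"
          by (simp only: mult.assoc[symmetric])
        moreover have "(norm y * s) *\<^sub>R (y /\<^sub>R norm y) = s *\<^sub>R y" using ny by simp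
        ultimately show "ennreal (norm y) * (P (norm y * s) * (C y * g ((norm y * s) *\<^sub>R (y /\<^sub>R norm y)))) = P s * (C y * (ennreal (norm y ^ ?n) * g (s *\<^sub>R y)))"
          by (simp only: mult.assoc mult.left_commute)
      qed
      finally show ?thesis .
    qed
  qed
  also have "\<dots> = (\<integral>\<^sup>+s. (\<integral>\<^sup>+y. P s * (C y * (ennreal (norm y ^ ?n) * g (s *\<^sub>R y))) \<partial>lborel) \<partial>lborel)"
    by (rule lborel_pair.Fubini'[symmetric]) measurable
  \<comment> \<open>The substitution x = s y. For fixed nonzero x the condition |y| \<le> 1 becomes
    s \<ge> |x|, and the weight |x|^n n s^(-n - 1) has integral 1 over these s.\<close>
  also have "\<dots> = (\<integral>\<^sup>+s. (\<integral>\<^sup>+x. g x * (ennreal (norm x ^ ?n) * (ennreal (real ?n * s powr (- real ?n - 1)) * indicator {norm x..} s) * (indicator {0<..} s * indicator (- {0}) x)) \<partial>lborel) \<partial>lborel)"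
  proof (rule nn_integral_cong)
    fix s :: real
    show "(\<integral>\<^sup>+y. P s * (C y * (ennreal (norm y ^ ?n) * g (s *\<^sub>R y))) \<partial>lborel)
      = (\<integral>\<^sup>+x. g x * (ennreal (norm x ^ ?n) * (ennreal (real ?n * s powr (- real ?n - 1)) * indicator {norm x..} s) * (indicator {0<..} s * indicator (- {0}) x)) \<partial>lborel)"
    proof (cases "s > 0")
      case False
      then show ?thesis by (simp add: P_def)
    next
      case s: True
      define h where "h x = g x * (ennreal (norm x ^ ?n) * (ennreal (real ?n * s powr (- real ?n - 1)) * indicator {norm x..} s) * (indicator {0<..} s * indicator (- {0}) x))" for x :: "real^'n"
      have [measurable]: "h \<in> borel_measurable borel"
      proof -
        define I1 I2 :: "real^'n \<Rightarrow> ennreal" where "I1 = indicator (cball 0 s)" and "I2 = indicator (- {0})"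
        have [measurable]: "I1 \<in> borel_measurable borel" "I2 \<in> borel_measurable borel"
          unfolding I1_def I2_def by (rule borel_measurable_indicator, simp)+
        have "h = (\<lambda>x. g x * (ennreal (norm x ^ ?n) * (ennreal (real ?n * s powr (- real ?n - 1)) * I1 x) * (indicator {0<..} s * I2 x)))"
          by (simp add: fun_eq_iff h_def I1_def I2_def indicator_def)
        then show ?thesis by simp
      qed
      have "(\<integral>\<^sup>+x. h x \<partial>lborel) = ennreal (s ^ ?n) * (\<integral>\<^sup>+y. h (s *\<^sub>R y) \<partial>lborel)"
        using lborel_scale_nn[of h s 0] s by simp
      also have "\<dots> = (\<integral>\<^sup>+y. ennreal (s ^ ?n) * h (s *\<^sub>R y) \<partial>lborel)"
        by (rule nn_integral_cmult[symmetric]) measurable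
      also have "\<dots> = (\<integral>\<^sup>+y. P s * (C y * (ennreal (norm y ^ ?n) * g (s *\<^sub>R y))) \<partial>lborel)"
      proof (rule nn_integral_cong)
        fix y :: "real^'n"
        show "ennreal (s ^ ?n) * h (s *\<^sub>R y) = P s * (C y * (ennreal (norm y ^ ?n) * g (s *\<^sub>R y)))"
        proof (cases "y \<noteq> 0 \<and> norm y \<le> 1")
          case True
          then have ind: "indicator {norm (s *\<^sub>R y)..} s = (1::ennreal)" "indicator (- {0}) (s *\<^sub>R y) = (1::ennreal)" "C y = 1"
            using s by (auto simp: C_def indicator_def)
          have "s ^ ?n * (norm (s *\<^sub>R y) ^ ?n * (real ?n * s powr (- real ?n - 1))) = (real ?n * s ^ (?n - 1)) * norm y ^ ?n"
          proof -
            have "s powr (- real ?n - 1) = inverse (s ^ ?n) * inverse s"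
              using s by (simp add: powr_diff powr_minus powr_realpow divide_inverse)
            moreover have "s ^ ?n = s * s ^ (?n - 1)" by (simp add: power_eq_if)
            ultimately show ?thesis using s by (simp add: power_mult_distrib field_simps)
          qed
          then have e: "ennreal (s ^ ?n) * (ennreal (norm (s *\<^sub>R y) ^ ?n) * ennreal (real ?n * s powr (- real ?n - 1))) = ennreal (real ?n * s ^ (?n - 1)) * ennreal (norm y ^ ?n)"
            using s by (simp flip: ennreal_mult')
          have "ennreal (s ^ ?n) * h (s *\<^sub>R y) = ennreal (s ^ ?n) * (ennreal (norm (s *\<^sub>R y) ^ ?n) * ennreal (real ?n * s powr (- real ?n - 1))) * g (s *\<^sub>R y)"
            unfolding h_def ind using s by (simp add: mult_ac del: norm_scaleR)
          also have "\<dots> = P s * (C y * (ennreal (norm y ^ ?n) * g (s *\<^sub>R y)))"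
            unfolding e ind P_def using s by (simp add: mult_ac)
          finally show ?thesis .
        next
          case False
          then show ?thesis using s by (auto simp: h_def C_def indicator_def)
        qed
      qed
      finally show ?thesis by (simp add: h_def)
    qed
  qed
  also have "\<dots> = (\<integral>\<^sup>+x. (\<integral>\<^sup>+s. g x * (ennreal (norm x ^ ?n) * (ennreal (real ?n * s powr (- real ?n - 1)) * indicator {norm x..} s) * (indicator {0<..} s * indicator (- {0}) x)) \<partial>lborel) \<partial>lborel)"
  proof (rule lborel_pair.Fubini')
    \<comment> \<open>The indicator of a set depending on \<open>x\<close> becomes a conditional,
      whose joint measurability in \<open>x\<close> and \<open>s\<close> is derivable.\<close>
    have "(\<lambda>(x, s). g x * (ennreal (norm x ^ ?n) * (ennreal (real ?n * s powr (- real ?n - 1)) * indicator {norm x..} s) * (indicator {0<..} s * indicator (- {0}) x)))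
      = (\<lambda>(x, s). g x * (ennreal (norm x ^ ?n) * (ennreal (real ?n * s powr (- real ?n - 1)) * (if norm x \<le> s then 1 else 0)) * ((if 0 < s then 1 else 0) * (if norm x = 0 then 0 else 1))))"
      by (simp add: fun_eq_iff indicator_def)
    also have "\<dots> \<in> borel_measurable (lborel \<Otimes>\<^sub>M lborel)" by measurable
    finally show "(\<lambda>(x, s). g x * (ennreal (norm x ^ ?n) * (ennreal (real ?n * s powr (- real ?n - 1)) * indicator {norm x..} s) * (indicator {0<..} s * indicator (- {0}) x))) \<in> borel_measurable (lborel \<Otimes>\<^sub>M lborel)" .
  qed
  also have "\<dots> = (\<integral>\<^sup>+x. g x * indicator (- {0}) x \<partial>lborel)"
  proof (rule nn_integral_cong)
    fix x :: "real^'n"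
    show "(\<integral>\<^sup>+s. g x * (ennreal (norm x ^ ?n) * (ennreal (real ?n * s powr (- real ?n - 1)) * indicator {norm x..} s) * (indicator {0<..} s * indicator (- {0}) x)) \<partial>lborel) = g x * indicator (- {0}) x"
    proof (cases "x = 0")
      case False
      then have nx: "norm x > 0" by simp
      have "(\<integral>\<^sup>+s. g x * (ennreal (norm x ^ ?n) * (ennreal (real ?n * s powr (- real ?n - 1)) * indicator {norm x..} s) * (indicator {0<..} s * indicator (- {0}) x)) \<partial>lborel)
        = (\<integral>\<^sup>+s. (g x * ennreal (norm x ^ ?n)) * (ennreal (real ?n * s powr (- real ?n - 1)) * indicator {norm x..} s) \<partial>lborel)"
      proof (rule nn_integral_cong)
        fix s
        show "g x * (ennreal (norm x ^ ?n) * (ennreal (real ?n * s powr (- real ?n - 1)) * indicator {norm x..} s) * (indicator {0<..} s * indicator (- {0}) x))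
          = (g x * ennreal (norm x ^ ?n)) * (ennreal (real ?n * s powr (- real ?n - 1)) * indicator {norm x..} s)"
        proof (cases "norm x \<le> s")
          case True
          then have "0 < s" using nx by linarith
          then show ?thesis using False by (simp add: mult_ac)
        qed simp
      qed
      also have "\<dots> = (g x * ennreal (norm x ^ ?n)) * ennreal (norm x powr (- real ?n))"
        by (subst nn_integral_cmult) (simp_all add: nn_integral_power_tail[OF nx])
      also have "\<dots> = g x"
        using nx by (simp add: mult.assoc powr_minus powr_realpow flip: ennreal_mult')
      finally show ?thesis using False by simp
    qed simp
  qed
  also have "\<dots> = (\<integral>\<^sup>+x. g x \<partial>lborel)"
  proof (rule nn_integral_cong_AE)
    have "AE x in lborel. x \<noteq> (0::real^'n)" by (rule AE_lborel_singleton)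
    then show "AE x in lborel. g x * indicator (- {0}) x = g x" by eventually_elim simp
  qed
  finally show ?thesis by (simp add: P_def C_def)
qed

section \<open>Convergence of functions whose derivative is integrable at infinity\<close>

lemma mono_bounded_tendsto_at_top:
  fixes P :: "real \<Rightarrow> real"
  assumes mono: "\<And>x y. a \<le> x \<Longrightarrow> x \<le> y \<Longrightarrow> P x \<le> P y" and B: "\<And>x. a \<le> x \<Longrightarrow> P x \<le> B"
  shows "\<exists>l. (P \<longlongrightarrow> l) at_top"
proof
  have bdd: "bdd_above (P ` {a..})" using B by (auto simp: bdd_above_def)
  show "(P \<longlongrightarrow> (SUP x\<in>{a..}. P x)) at_top"
  proof (rule order_tendstoI)
    fix u assume "u < (SUP x\<in>{a..}. P x)"
    then obtain x where x: "a \<le> x" "u < P x"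
      using less_cSUP_iff[OF _ bdd, of u] by auto
    then show "eventually (\<lambda>y. u < P y) at_top"
      using mono[of x] by (intro eventually_at_top_linorderI[of x]) force
  next
    fix u assume "(SUP x\<in>{a..}. P x) < u"
    then show "eventually (\<lambda>y. P y < u) at_top"
      using cSUP_upper[OF _ bdd] by (intro eventually_at_top_linorderI[of a]) (force intro: le_less_trans)
  qed
qed

text \<open>With \<open>H\<close> the integral of \<open>h\<close>, both \<open>H\<close> and F + H
  are increasing and bounded, so \<open>F\<close> is a difference of two convergent
  functions.\<close>

lemma tendsto_of_dominated_derivative:
  fixes F F' h :: "real \<Rightarrow> real"
  assumes d: "\<And>r. a \<le> r \<Longrightarrow> (F has_real_derivative F' r) (at r)"
    and h: "\<And>r. a \<le> r \<Longrightarrow> \<bar>F' r\<bar> \<le> h r"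
    and int: "\<And>b. h integrable_on {a..b}" and bd: "\<And>b. integral {a..b} h \<le> B"
  shows "\<exists>l. (F \<longlongrightarrow> l) at_top"
proof -
  define H where "H b = integral {a..b} h" for b
  have inc: "\<bar>F c - F b\<bar> \<le> H c - H b" if "a \<le> b" "b \<le> c" for b c
  proof -
    have F: "(F' has_integral (F c - F b)) {b..c}"
    proof (rule fundamental_theorem_of_calculus[OF that(2)])
      fix x assume "x \<in> {b..c}"
      then have "(F has_real_derivative F' x) (at x)" using d that by simp
      then show "(F has_vector_derivative F' x) (at x within {b..c})"
        by (simp add: has_real_derivative_iff_has_vector_derivative has_vector_derivative_at_within)
    qed
    have hi: "h integrable_on {b..c}"
      by (rule integrable_subinterval_real[OF int[of c]]) (use that in auto)
    have "norm (integral {b..c} F') \<le> integral {b..c} h"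
      by (rule integral_norm_bound_integral) (use F hi h that in \<open>auto simp: has_integral_integrable\<close>)
    moreover have "H c = H b + integral {b..c} h"
      unfolding H_def using Henstock_Kurzweil_Integration.integral_combine[OF that(1,2) int[of c]] by simp
    ultimately show ?thesis using integral_unique[OF F] by simp
  qed
  have Hle: "H b \<le> B" for b unfolding H_def by (rule bd)
  have Ha: "H a = 0" by (simp add: H_def)
  have "\<exists>l. (H \<longlongrightarrow> l) at_top"
    by (rule mono_bounded_tendsto_at_top[of a H B]) (use inc Hle in force)+
  moreover have "\<exists>l. ((\<lambda>b. F b + H b) \<longlongrightarrow> l) at_top"
  proof (rule mono_bounded_tendsto_at_top[of a _ "F a + 2 * B"])
    show "F b + H b \<le> F c + H c" if "a \<le> b" "b \<le> c" for b c using inc[OF that] by linarith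
    show "F b + H b \<le> F a + 2 * B" if "a \<le> b" for b using inc[OF order_refl that] Hle[of b] Ha by linarith
  qed
  ultimately obtain l m where "(H \<longlongrightarrow> l) at_top" "((\<lambda>b. F b + H b) \<longlongrightarrow> m) at_top" by blast
  then have "((\<lambda>b. (F b + H b) - H b) \<longlongrightarrow> m - l) at_top" by (intro tendsto_diff)
  then show ?thesis by auto
qed

text \<open>The derivative is dominated by the sphere integral of the absolute value of
  \<open>\<psi>\<close>, integrable in the radius by polar coordinates, plus a multiple of r^(n - 1
  - p), integrable because p > n.\<close>

lemma flux_converges:
  fixes \<psi> E :: "real^'n::finite \<Rightarrow> real"
  assumes R: "R > 0" and \<psi>: "continuous_on {x. R < norm x} \<psi>" and E: "continuous_on {x. R < norm x} E"
    and int: "(\<integral>\<^sup>+x. indicator {x. R < norm x} x * ennreal \<bar>\<psi> x\<bar> \<partial>lborel) < \<infinity>"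
    and Eb: "\<And>x. R < norm x \<Longrightarrow> \<bar>E x\<bar> \<le> C * norm x powr (- p)" and p: "p > real CARD('n)"
    and F: "\<And>r. R < r \<Longrightarrow> (F has_real_derivative sphere_integral r (\<lambda>x. \<psi> x + E x)) (at r)"
  shows "\<exists>l. (F \<longlongrightarrow> l) at_top"
proof -
  let ?U = "{x::real^'n. R < norm x}" and ?n = "CARD('n)"
  have openU: "open ?U" by (intro open_Collect_less continuous_intros)
  have sub: "sphere 0 r \<subseteq> ?U" if "R < r" for r using that by auto
  define g :: "real^'n \<Rightarrow> ennreal" where "g x = ennreal (indicator ?U x * \<bar>\<psi> x\<bar>)" for x
  have [measurable]: "g \<in> borel_measurable borel"
  proof -
    have "(\<lambda>x. indicator ?U x *\<^sub>R \<bar>\<psi> x\<bar>) \<in> borel_measurable borel"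
      by (rule borel_measurable_continuous_on_indicator) (use openU in \<open>auto intro!: continuous_intros \<psi>\<close>)
    then show ?thesis unfolding g_def[abs_def] by simp
  qed
  \<comment> \<open>Beyond \<open>R\<close> this equals the sphere integral of the absolute value of
    \<open>\<psi>\<close>, by \<open>NS\<close>. As a nonnegative extended integral it is measurable
    in \<open>\<rho>\<close>, and its total is finite by \<open>polar_nn_integral\<close>.\<close>
  define N where "N \<rho> = indicator {0<..} \<rho> * ennreal (real ?n * \<rho> ^ (?n - 1)) *
      (\<integral>\<^sup>+y. indicator (cball 0 1 - {0}) y * g (\<rho> *\<^sub>R (y /\<^sub>R norm y)) \<partial>lborel)" for \<rho> :: real
  have Nint: "(\<integral>\<^sup>+\<rho>. N \<rho> \<partial>lborel) < \<infinity>"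
  proof -
    have "(\<integral>\<^sup>+x. g x \<partial>lborel) = (\<integral>\<^sup>+x. indicator ?U x * ennreal \<bar>\<psi> x\<bar> \<partial>lborel)"
      by (intro nn_integral_cong) (auto simp: g_def indicator_def)
    then show ?thesis using int polar_nn_integral[of g] by (simp add: N_def)
  qed
  have [measurable]: "N \<in> borel_measurable borel"
  proof -
    have [measurable]: "(indicator (cball 0 1 - {0}) :: real^'n \<Rightarrow> ennreal) \<in> borel_measurable borel"
      by (rule borel_measurable_indicator) simp
    have "(\<lambda>(\<rho>, y). indicator (cball 0 1 - {0}) y * g (\<rho> *\<^sub>R (y /\<^sub>R norm y))) \<in> borel_measurable (borel \<Otimes>\<^sub>M lborel)"
      by measurable
    from lborel.borel_measurable_nn_integral[OF this]
    show ?thesis unfolding N_def[abs_def] by measurable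
  qed
  have NS: "N r = ennreal (sphere_integral r (\<lambda>x. \<bar>\<psi> x\<bar>))" if "R < r" for r
  proof -
    have r: "r > 0" using that R by simp
    have c: "continuous_on (sphere 0 r) (\<lambda>x. \<bar>\<psi> x\<bar>)"
      by (intro continuous_intros continuous_on_subset[OF \<psi> sub[OF that]])
    note c1 = sphere_scale_continuous[OF r c]
    have "(\<integral>\<^sup>+y. indicator (cball 0 1 - {0}) y * g (r *\<^sub>R (y /\<^sub>R norm y)) \<partial>lborel)
        = (\<integral>\<^sup>+y. ennreal \<bar>\<psi> (r *\<^sub>R (y /\<^sub>R norm y))\<bar> * indicator (cball 0 1 - {0}) y \<partial>lborel)"
      using that r by (intro nn_integral_cong) (auto simp: g_def indicator_def mult.assoc)
    also have "\<dots> = (\<integral>\<^sup>+\<theta>. ennreal \<bar>\<psi> (r *\<^sub>R \<theta>)\<bar> \<partial>sphere_dirs)"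
      unfolding sphere_dirs_def
      by (subst nn_integral_distr[OF measurable_dir])
        (simp_all add: borel_measurable_continuous_on_restrict[OF c1] nn_integral_restrict_space)
    also have "\<dots> = ennreal (\<integral>\<theta>. \<bar>\<psi> (r *\<^sub>R \<theta>)\<bar> \<partial>sphere_dirs)"
      by (rule nn_integral_eq_integral[OF integrable_sphere_dirs[OF c1]]) simp
    finally show ?thesis
      using r by (simp add: N_def sphere_integral_eq[OF r c] flip: ennreal_mult')
  qed
  have Dint: "integrable lborel (\<lambda>\<rho>. enn2real (N \<rho>))"
  proof (rule integrableI_bounded)
    have "(\<integral>\<^sup>+\<rho>. ennreal (norm (enn2real (N \<rho>))) \<partial>lborel) \<le> (\<integral>\<^sup>+\<rho>. N \<rho> \<partial>lborel)"
      by (intro nn_integral_mono) (simp add: ennreal_enn2real_if)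
    then show "(\<integral>\<^sup>+\<rho>. ennreal (norm (enn2real (N \<rho>))) \<partial>lborel) < \<infinity>" using Nint by (rule le_less_trans)
  qed measurable
  \<comment> \<open>Radii from \<open>R + 1\<close> on lie inside the open region
    \<open>R < norm x\<close>.\<close>
  define a where "a = R + 1"
  define K where "K = real ?n * measure (sphere_dirs :: (real^'n) measure) (sphere 0 1) * \<bar>C\<bar>"
  define e where "e = real ?n - 1 - p"
  have K: "K \<ge> 0" by (simp add: K_def)
  have e: "e < -1" using p by (simp add: e_def)
  show ?thesis
  proof (rule tendsto_of_dominated_derivative[of a F "\<lambda>r. sphere_integral r (\<lambda>x. \<psi> x + E x)" "\<lambda>r. enn2real (N r) + K * r powr e"])
    fix r assume ar: "a \<le> r"
    then have r: "R < r" "r > 0" using R by (auto simp: a_def)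
    then show "(F has_real_derivative sphere_integral r (\<lambda>x. \<psi> x + E x)) (at r)" using F by blast
    have cp: "continuous_on (sphere 0 r) \<psi>" "continuous_on (sphere 0 r) E"
      using continuous_on_subset[OF \<psi> sub[OF r(1)]] continuous_on_subset[OF E sub[OF r(1)]] by auto
    have "\<bar>sphere_integral r \<psi>\<bar> \<le> sphere_integral r (\<lambda>x. \<bar>\<psi> x\<bar>)"
    proof -
      have "\<bar>\<integral>\<theta>. \<psi> (r *\<^sub>R \<theta>) \<partial>sphere_dirs\<bar> \<le> (\<integral>\<theta>. \<bar>\<psi> (r *\<^sub>R \<theta>)\<bar> \<partial>sphere_dirs)"
        by (rule integral_abs_bound)
      then show ?thesis
        using r by (simp add: sphere_integral_eq cp continuous_on_rabs abs_mult mult_left_mono)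
    qed
    also have "\<dots> = enn2real (N r)"
    proof -
      have "sphere_integral r (\<lambda>x. \<bar>\<psi> x\<bar>) \<ge> 0"
        using r by (simp add: sphere_integral_eq cp continuous_on_rabs)
      then show ?thesis by (simp add: NS[OF r(1)])
    qed
    finally have 1: "\<bar>sphere_integral r \<psi>\<bar> \<le> enn2real (N r)" .
    have 2: "\<bar>sphere_integral r E\<bar> \<le> K * r powr e"
    proof -
      have "\<bar>sphere_integral r E\<bar> \<le> real ?n * measure (sphere_dirs :: (real^'n) measure) (sphere 0 1) * r ^ (?n - 1) * (\<bar>C\<bar> * r powr (- p))"
      proof (rule sphere_integral_bound[OF r(2) cp(2)])
        fix x :: "real^'n" assume x: "norm x = r"
        have "\<bar>E x\<bar> \<le> C * r powr (- p)" using Eb[of x] x r by simp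
        also have "\<dots> \<le> \<bar>C\<bar> * r powr (- p)" by (intro mult_right_mono) auto
        finally show "\<bar>E x\<bar> \<le> \<bar>C\<bar> * r powr (- p)" .
      qed
      also have "r ^ (?n - 1) = r powr (real ?n - 1)"
        using r by (simp add: of_nat_diff flip: powr_realpow)
      also have "real ?n * measure (sphere_dirs :: (real^'n) measure) (sphere 0 1) * r powr (real ?n - 1) * (\<bar>C\<bar> * r powr (- p)) = K * (r powr (real ?n - 1) * r powr (- p))"
        by (simp add: K_def)
      also have "\<dots> = K * r powr e" by (simp add: e_def flip: powr_add)
      finally show ?thesis .
    qed
    show "\<bar>sphere_integral r (\<lambda>x. \<psi> x + E x)\<bar> \<le> enn2real (N r) + K * r powr e"
      unfolding sphere_integral_add[OF r(2) cp] using 1 2 by linarith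
  next
    fix b
    have i1: "(\<lambda>r. enn2real (N r)) integrable_on {a..b}"
      and l1: "integral {a..b} (\<lambda>r. enn2real (N r)) \<le> (\<integral>r. enn2real (N r) \<partial>lborel)"
    proof -
      have s: "set_integrable lborel {a..b} (\<lambda>r. enn2real (N r))"
        unfolding set_integrable_def by (rule integrable_mult_indicator[OF _ Dint]) simp
      show "(\<lambda>r. enn2real (N r)) integrable_on {a..b}" using set_borel_integral_eq_integral(1)[OF s] .
      have "(LINT r:{a..b}|lborel. enn2real (N r)) \<le> (\<integral>r. enn2real (N r) \<partial>lborel)"
        unfolding set_lebesgue_integral_def
        by (rule integral_mono[OF s[unfolded set_integrable_def] Dint]) (auto simp: indicator_def)
      then show "integral {a..b} (\<lambda>r. enn2real (N r)) \<le> (\<integral>r. enn2real (N r) \<partial>lborel)"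
        using set_borel_integral_eq_integral(2)[OF s] by simp
    qed
    have i2: "(\<lambda>r. K * r powr e) integrable_on {a..b}"
      and l2: "integral {a..b} (\<lambda>r. K * r powr e) \<le> K / (- e - 1) * a powr (e + 1)"
    proof -
      have "(\<lambda>r. K * r powr e) integrable_on {a..b} \<and> integral {a..b} (\<lambda>r. K * r powr e) \<le> K / (- e - 1) * a powr (e + 1)"
      proof (cases "a \<le> b")
        case True
        \<comment> \<open>The antiderivative that vanishes at infinity: \<open>e + 1\<close> is
          negative, so \<open>- A a\<close> bounds the integral for every endpoint
          \<open>b\<close>.\<close>
        define A where "A r = - (K / (- e - 1) * r powr (e + 1))" for r
        have hI: "((\<lambda>r. K * r powr e) has_integral (A b - A a)) {a..b}"
        proof (rule fundamental_theorem_of_calculus[OF True])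
          fix r assume "r \<in> {a..b}"
          then have "r > 0" using R by (simp add: a_def)
          then have "(A has_real_derivative - (K / (- e - 1) * ((e + 1) * r powr e))) (at r)"
            unfolding A_def using e by (auto intro!: derivative_eq_intros)
          moreover have "- (K / (- e - 1) * ((e + 1) * t)) = K * t" for t
          proof -
            have "K / (- e - 1) * (e + 1) = - K" using e by (simp add: divide_eq_eq algebra_simps)
            then show ?thesis by (simp only: mult.assoc[symmetric])
          qed
          ultimately have "(A has_real_derivative K * r powr e) (at r)" by simp
          then show "(A has_vector_derivative K * r powr e) (at r within {a..b})"
            by (simp add: has_real_derivative_iff_has_vector_derivative has_vector_derivative_at_within)
        qed
        have "A b \<le> 0" "- A a = K / (- e - 1) * a powr (e + 1)" using K e by (simp_all add: A_def)
        then have "integral {a..b} (\<lambda>r. K * r powr e) \<le> K / (- e - 1) * a powr (e + 1)"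
          unfolding integral_unique[OF hI] by linarith
        then show ?thesis using has_integral_integrable[OF hI] by blast
      next
        case False
        then show ?thesis using K e by (simp add: integrable_on_empty)
      qed
      then show "(\<lambda>r. K * r powr e) integrable_on {a..b}"
        "integral {a..b} (\<lambda>r. K * r powr e) \<le> K / (- e - 1) * a powr (e + 1)" by auto
    qed
    show "(\<lambda>r. enn2real (N r) + K * r powr e) integrable_on {a..b}"
      by (intro Henstock_Kurzweil_Integration.integrable_add i1 i2)
    show "integral {a..b} (\<lambda>r. enn2real (N r) + K * r powr e) \<le> (\<integral>r. enn2real (N r) \<partial>lborel) + K / (- e - 1) * a powr (e + 1)"
      using l1 l2 by (simp add: Henstock_Kurzweil_Integration.integral_add[OF i1 i2])
  qed
qed

section \<open>Decay with approximate parity\<close>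

text \<open>\<open>decay \<delta> a s f\<close>: \<open>f\<close> is of order \<open>-a\<close> and of parity \<open>s\<close> (1 or -1) up to order \<open>-a - \<delta>\<close>. For
  \<open>\<delta> = 0\<close> the second condition follows from the first; \<open>\<delta> = 1\<close> encodes the RT conditions.\<close>

definition decay :: "real \<Rightarrow> real \<Rightarrow> real \<Rightarrow> (real^'n::finite \<Rightarrow> real) \<Rightarrow> bool" where
  "decay \<delta> a s f \<longleftrightarrow> f \<in> O[at_infinity](\<lambda>x. norm x powr (- a)) \<and>
     (\<lambda>x. f x - s * f (- x)) \<in> O[at_infinity](\<lambda>x. norm x powr (- a - \<delta>))"

lemma eventually_norm_gt: "eventually (\<lambda>x::real^'n::finite. R < norm x) at_infinity"
  unfolding eventually_at_infinity by (rule exI[of _ "R + 1"]) auto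

lemma eventually_reflect:
  assumes "eventually P (at_infinity :: (real^'n::finite) filter)"
  shows "eventually (\<lambda>x. P (- x)) at_infinity"
  using assms unfolding eventually_at_infinity by (metis norm_minus_cancel)

lemma bigo_reflect:
  assumes "f \<in> O[at_infinity](\<lambda>x::real^'n::finite. norm x powr a)"
  shows "(\<lambda>x. f (- x) :: real) \<in> O[at_infinity](\<lambda>x. norm x powr a)"
proof -
  have "filterlim (uminus :: real^'n \<Rightarrow> real^'n) at_infinity at_infinity"
    unfolding filterlim_iff using eventually_reflect by blast
  from landau_o.big.compose[OF assms this] show ?thesis by simp
qed

lemma bigo_powr_mult:
  assumes "f \<in> O[at_infinity](\<lambda>x::real^'n::finite. norm x powr a)" "g \<in> O[at_infinity](\<lambda>x. norm x powr b)"
  shows "(\<lambda>x. f x * g x :: real) \<in> O[at_infinity](\<lambda>x. norm x powr (a + b))"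
  using landau_o.big.mult[OF assms] by (simp add: powr_add)

lemma bigo_powr_mono:
  assumes "f \<in> O[at_infinity](\<lambda>x::real^'n::finite. norm x powr a)" "a \<le> b"
  shows "(f :: _ \<Rightarrow> real) \<in> O[at_infinity](\<lambda>x. norm x powr b)"
proof (rule landau_o.big_trans[OF assms(1)])
  have "eventually (\<lambda>x::real^'n. norm (norm x powr a) \<le> norm (norm x powr b)) at_infinity"
    using eventually_norm_gt[of 1] by eventually_elim (simp add: assms(2) powr_mono)
  then show "(\<lambda>x::real^'n. norm x powr a) \<in> O[at_infinity](\<lambda>x. norm x powr b)"
    by (rule landau_o.big_mono)
qed

lemma decay_cong:
  assumes "eventually (\<lambda>x. f x = g x) at_infinity"
  shows "decay \<delta> a s f \<longleftrightarrow> decay \<delta> a s g"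
proof -
  have "eventually (\<lambda>x. f (- x) = g (- x)) at_infinity"
    by (rule eventually_reflect[OF assms])
  then have e: "eventually (\<lambda>x. f x - s * f (- x) = g x - s * g (- x)) at_infinity"
    using assms by eventually_elim simp
  show ?thesis
    unfolding decay_def by (simp only: landau_o.big.in_cong[OF assms] landau_o.big.in_cong[OF e])
qed

lemma decay_cong_exterior:
  assumes "\<And>x. R < norm x \<Longrightarrow> f x = g x"
  shows "decay \<delta> a s f \<longleftrightarrow> decay \<delta> a s g"
  by (rule decay_cong) (rule eventually_mono[OF eventually_norm_gt[of R] assms])

lemma decay_add: "decay \<delta> a s f \<Longrightarrow> decay \<delta> a s g \<Longrightarrow> decay \<delta> a s (\<lambda>x. f x + g x)"
  unfolding decay_def using sum_in_bigo(1)[of f at_infinity _ g]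
    sum_in_bigo(1)[of "\<lambda>x. f x - s * f (- x)" at_infinity _ "\<lambda>x. g x - s * g (- x)"]
  by (auto simp: algebra_simps)

text \<open>The parity error of a product splits as (f(x) - s f(-x)) g(x) + s f(-x) (g(x) - t
  g(-x)): each summand has the gain \<open>\<delta>\<close> of one factor and the plain decay of the
  other.\<close>

lemma decay_mult:
  assumes f: "decay \<delta> a s f" and g: "decay \<delta> b t g"
  shows "decay \<delta> (a + b) (s * t) (\<lambda>x. f x * g x)"
proof -
  have 1: "(\<lambda>x. f x * g x) \<in> O[at_infinity](\<lambda>x. norm x powr (- (a + b)))"
    using bigo_powr_mult[of f "- a" g "- b"] f g by (simp add: decay_def)
  have 2: "(\<lambda>x. (f x - s * f (- x)) * g x) \<in> O[at_infinity](\<lambda>x. norm x powr (- (a + b) - \<delta>))"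
    using bigo_powr_mult[of "\<lambda>x. f x - s * f (- x)" "- a - \<delta>" g "- b"] f g
    by (simp add: decay_def algebra_simps)
  have 3: "(\<lambda>x. f (- x) * (g x - t * g (- x))) \<in> O[at_infinity](\<lambda>x. norm x powr (- (a + b) - \<delta>))"
    using bigo_powr_mult[OF bigo_reflect, of f "- a" "\<lambda>x. g x - t * g (- x)" "- b - \<delta>"] f g
    by (simp add: decay_def algebra_simps)
  have "(\<lambda>x. (f x - s * f (- x)) * g x + s * (f (- x) * (g x - t * g (- x)))) \<in> O[at_infinity](\<lambda>x. norm x powr (- (a + b) - \<delta>))"
    by (intro sum_in_bigo 2) (use 3 landau_o.big.cmult_in_iff[of s] in \<open>cases "s = 0"; simp\<close>)
  moreover have "(\<lambda>x. (f x - s * f (- x)) * g x + s * (f (- x) * (g x - t * g (- x)))) = (\<lambda>x. f x * g x - s * t * (f (- x) * g (- x)))"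
    by (simp add: fun_eq_iff algebra_simps)
  ultimately show ?thesis using 1 by (simp add: decay_def)
qed

lemma decay_mono:
  assumes "decay \<delta> a s f" "b \<le> a" shows "decay \<delta> b s f"
  unfolding decay_def
proof
  show "f \<in> O[at_infinity](\<lambda>x. norm x powr (- b))"
    by (rule bigo_powr_mono[of _ "- a"]) (use assms in \<open>auto simp: decay_def\<close>)
  show "(\<lambda>x. f x - s * f (- x)) \<in> O[at_infinity](\<lambda>x. norm x powr (- b - \<delta>))"
    by (rule bigo_powr_mono[of _ "- a - \<delta>"]) (use assms in \<open>auto simp: decay_def\<close>)
qed

lemma decay_zero [simp]: "decay \<delta> a s (\<lambda>x. 0)"
  by (simp add: decay_def)

lemma decay_const: "decay \<delta> 0 1 (\<lambda>x. c)"
  unfolding decay_def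
proof
  have "eventually (\<lambda>x::real^'a. norm c \<le> norm c * norm (norm x powr (- 0))) at_infinity"
    using eventually_norm_gt[of 0] by eventually_elim simp
  then show "(\<lambda>x. c) \<in> O[at_infinity](\<lambda>x::real^'a. norm x powr (- 0))" by (rule bigoI)
qed simp

lemma decay_cmult: "decay \<delta> a s f \<Longrightarrow> decay \<delta> a s (\<lambda>x. c * f x)"
  using decay_mult[OF decay_const[of \<delta> c], of a s f] by simp

lemma decay_minus: "decay \<delta> a s f \<Longrightarrow> decay \<delta> a s (\<lambda>x. - f x)"
  using decay_cmult[of \<delta> a s f "-1"] by simp

lemma decay_diff: "decay \<delta> a s f \<Longrightarrow> decay \<delta> a s g \<Longrightarrow> decay \<delta> a s (\<lambda>x. f x - g x)"
  using decay_add[OF _ decay_minus, of \<delta> a s f g] by simp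

lemma decay_sum: "(\<And>i. i \<in> I \<Longrightarrow> decay \<delta> a s (f i)) \<Longrightarrow> decay \<delta> a s (\<lambda>x. \<Sum>i\<in>I. f i x)"
  by (induction I rule: infinite_finite_induct) (auto intro: decay_add)

lemma decay_coord: "decay \<delta> (-1) (-1) (\<lambda>x. x $ i)"
  unfolding decay_def
proof
  have "eventually (\<lambda>x::real^'a. norm (x $ i) \<le> 1 * norm (norm x powr (- (-1)))) at_infinity"
    using eventually_norm_gt[of 0] by eventually_elim (simp add: component_le_norm_cart)
  then show "(\<lambda>x. x $ i) \<in> O[at_infinity](\<lambda>x::real^'a. norm x powr (- (-1)))" by (rule bigoI)
qed simp

lemma decay_inverse_norm: "decay \<delta> 1 1 (\<lambda>x. inverse (norm x))"
  unfolding decay_def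
proof
  have "eventually (\<lambda>x::real^'a. norm (inverse (norm x)) \<le> 1 * norm (norm x powr (- 1))) at_infinity"
    using eventually_norm_gt[of 0] by eventually_elim (simp add: powr_minus)
  then show "(\<lambda>x. inverse (norm x)) \<in> O[at_infinity](\<lambda>x::real^'a. norm x powr (- 1))" by (rule bigoI)
qed simp

lemma decay_euclidean_normal: "decay \<delta> 0 (-1) (\<lambda>x. euclidean_normal x $ k)"
  using decay_mult[OF decay_inverse_norm decay_coord, of \<delta> k] by (simp add: euclidean_normal_def)

lemma decay_0I:
  assumes "f \<in> O[at_infinity](\<lambda>x::real^'n::finite. norm x powr (- a))" "\<bar>s\<bar> = 1"
  shows "decay 0 a s f"
proof -
  have "(\<lambda>x. f x - s * f (- x)) \<in> O[at_infinity](\<lambda>x. norm x powr (- a))"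
    by (intro sum_in_bigo assms landau_o.big.cmult_in_iff[THEN iffD2] bigo_reflect) (use assms in auto)
  then show ?thesis using assms by (simp add: decay_def)
qed

lemma decay_tendsto_0:
  assumes "decay \<delta> a s f" "a > 0"
  shows "(f \<longlongrightarrow> 0) at_infinity"
proof -
  obtain C where C: "eventually (\<lambda>x. norm (f x) \<le> C * norm (norm x powr (- a))) at_infinity"
    using assms(1) unfolding decay_def bigo_def by auto
  have "((\<lambda>x::real^'a. norm x powr (- a)) \<longlongrightarrow> 0) at_infinity"
    by (rule tendsto_neg_powr) (use assms filterlim_norm_at_top in auto)
  then have "((\<lambda>x::real^'a. C * norm (norm x powr (- a))) \<longlongrightarrow> 0) at_infinity"
    by (intro tendsto_mult_right_zero tendsto_norm_zero)
  with C show ?thesis by (rule Lim_null_comparison)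
qed

text \<open>Far out |f| is at least |c| / 2, so 1 / f is bounded. Its parity error is that of f
  divided by f(x) f(-x), up to sign, and 1 / f - 1 / c is -(f - c) / (c f).\<close>

lemma decay_inverse:
  assumes f: "decay \<delta> a 1 (\<lambda>x. f x - c)" and a: "a > 0" and c: "c \<noteq> 0"
  shows "decay \<delta> 0 1 (\<lambda>x. inverse (f x))" "decay \<delta> a 1 (\<lambda>x. inverse (f x) - inverse c)"
proof -
  have "eventually (\<lambda>x. norm (f x - c) < \<bar>c\<bar> / 2) at_infinity"
    using tendstoD[OF decay_tendsto_0[OF f a], of "\<bar>c\<bar> / 2"] c by simp
  then have half: "eventually (\<lambda>x. \<bar>c\<bar> / 2 \<le> \<bar>f x\<bar>) at_infinity"
  proof eventually_elim
    case (elim x)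
    then show ?case using abs_triangle_ineq2_sym[of c "f x"] unfolding real_norm_def by linarith
  qed
  have inv: "(\<lambda>x. inverse (f x)) \<in> O[at_infinity](\<lambda>x. norm x powr (- 0))"
  proof (rule bigoI[of _ "2 / \<bar>c\<bar>"])
    show "eventually (\<lambda>x. norm (inverse (f x)) \<le> 2 / \<bar>c\<bar> * norm (norm x powr (- 0))) at_infinity"
      using half eventually_norm_gt[of 0]
    proof eventually_elim
      case (elim x)
      then have "inverse \<bar>f x\<bar> \<le> inverse (\<bar>c\<bar> / 2)" using c by (intro le_imp_inverse_le) auto
      then show ?case using elim by simp
    qed
  qed
  have half': "eventually (\<lambda>x. \<bar>c\<bar> / 2 \<le> \<bar>f (- x)\<bar>) at_infinity"
    by (rule eventually_reflect[OF half])
  have "(\<lambda>x. ((f x - c) - 1 * (f (- x) - c)) * (inverse (f x) * inverse (f (- x)))) \<in> O[at_infinity](\<lambda>x. norm x powr ((- a - \<delta>) + ((- 0) + (- 0))))"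
    by (intro bigo_powr_mult inv bigo_reflect[OF inv]) (use f in \<open>simp add: decay_def\<close>)
  then have "(\<lambda>x. - (((f x - c) - 1 * (f (- x) - c)) * (inverse (f x) * inverse (f (- x))))) \<in> O[at_infinity](\<lambda>x. norm x powr (- 0 - \<delta>))"
    using a by (subst landau_o.big.uminus_in_iff) (rule bigo_powr_mono, auto)
  also have "?this \<longleftrightarrow> (\<lambda>x. inverse (f x) - 1 * inverse (f (- x))) \<in> O[at_infinity](\<lambda>x. norm x powr (- 0 - \<delta>))"
  proof (rule landau_o.big.in_cong)
    show "eventually (\<lambda>x. - (((f x - c) - 1 * (f (- x) - c)) * (inverse (f x) * inverse (f (- x)))) = inverse (f x) - 1 * inverse (f (- x))) at_infinity"
      using half half'
    proof eventually_elim
      case (elim x)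
      then have "f x \<noteq> 0" "f (- x) \<noteq> 0" using c by auto
      then show ?case by (simp add: field_simps)
    qed
  qed
  finally show i: "decay \<delta> 0 1 (\<lambda>x. inverse (f x))" using inv by (simp add: decay_def)
  have "decay \<delta> a 1 (\<lambda>x. (- inverse c) * ((f x - c) * inverse (f x)))"
    using decay_cmult[OF decay_mult[OF f i], of "- inverse c"] by simp
  also have "?this \<longleftrightarrow> decay \<delta> a 1 (\<lambda>x. inverse (f x) - inverse c)"
  proof (rule decay_cong)
    show "eventually (\<lambda>x. (- inverse c) * ((f x - c) * inverse (f x)) = inverse (f x) - inverse c) at_infinity"
      using half
    proof eventually_elim
      case (elim x)
      then have "f x \<noteq> 0" using c by auto
      then show ?case using c by (simp add: field_simps)
    qed
  qed
  finally show "decay \<delta> a 1 (\<lambda>x. inverse (f x) - inverse c)" .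
qed

text \<open>The lower bound is placed on the sum of the roots, so that only one of the two arguments
  has to stay away from 0.\<close>

lemma abs_sqrt_diff_le:
  assumes "m > 0" "x \<ge> 0" "y \<ge> 0" "m \<le> sqrt x + sqrt y"
  shows "\<bar>sqrt x - sqrt y\<bar> \<le> inverse m * \<bar>x - y\<bar>"
proof -
  have "(sqrt x - sqrt y) * (sqrt x + sqrt y) = x - y"
    using assms by (simp add: algebra_simps)
  moreover have "\<bar>sqrt x + sqrt y\<bar> = sqrt x + sqrt y" using assms by simp
  ultimately have "\<bar>x - y\<bar> = \<bar>sqrt x - sqrt y\<bar> * (sqrt x + sqrt y)"
    by (metis abs_mult)
  also have "\<dots> \<ge> \<bar>sqrt x - sqrt y\<bar> * m" using assms by (intro mult_left_mono) auto
  finally show ?thesis using assms by (simp add: field_simps)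
qed

lemma decay_sqrt:
  assumes f: "decay \<delta> a 1 (\<lambda>x. f x - c)" and a: "a > 0" and c: "c > 0"
  shows "decay \<delta> a 1 (\<lambda>x. sqrt (f x) - sqrt c)"
proof -
  have "eventually (\<lambda>x. norm (f x - c) < c) at_infinity"
    using tendstoD[OF decay_tendsto_0[OF f a], of c] c by simp
  then have pos: "eventually (\<lambda>x. 0 \<le> f x) at_infinity"
  proof eventually_elim
    case (elim x)
    then show ?case using abs_ge_minus_self[of "f x - c"] unfolding real_norm_def by linarith
  qed
  have pos': "eventually (\<lambda>x. 0 \<le> f (- x)) at_infinity"
    by (rule eventually_reflect[OF pos])
  have "eventually (\<lambda>x. norm (f x - c) < c / 2) at_infinity"
    using tendstoD[OF decay_tendsto_0[OF f a], of "c / 2"] c by simp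
  then have half: "eventually (\<lambda>x. sqrt (c / 2) \<le> sqrt (f x)) at_infinity"
  proof eventually_elim
    case (elim x)
    then have "c / 2 \<le> f x" using abs_ge_minus_self[of "f x - c"] unfolding real_norm_def by linarith
    then show ?case by (rule real_sqrt_le_mono)
  qed
  have "(\<lambda>x. sqrt (f x) - sqrt c) \<in> O[at_infinity](\<lambda>x. f x - c)"
  proof (rule bigoI[of _ "inverse (sqrt c)"])
    show "eventually (\<lambda>x. norm (sqrt (f x) - sqrt c) \<le> inverse (sqrt c) * norm (f x - c)) at_infinity"
      using pos
    proof eventually_elim
      case (elim x)
      then have "\<bar>sqrt (f x) - sqrt c\<bar> \<le> inverse (sqrt c) * \<bar>f x - c\<bar>"
        using c by (intro abs_sqrt_diff_le) auto
      then show ?case by simp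
    qed
  qed
  then have 1: "(\<lambda>x. sqrt (f x) - sqrt c) \<in> O[at_infinity](\<lambda>x. norm x powr (- a))"
    by (rule landau_o.big_trans) (use f in \<open>simp add: decay_def\<close>)
  have "(\<lambda>x. (sqrt (f x) - sqrt c) - 1 * (sqrt (f (- x)) - sqrt c)) \<in> O[at_infinity](\<lambda>x. (f x - c) - 1 * (f (- x) - c))"
  proof (rule bigoI[of _ "inverse (sqrt (c / 2))"])
    show "eventually (\<lambda>x. norm ((sqrt (f x) - sqrt c) - 1 * (sqrt (f (- x)) - sqrt c)) \<le> inverse (sqrt (c / 2)) * norm ((f x - c) - 1 * (f (- x) - c))) at_infinity"
      using pos pos' half
    proof eventually_elim
      case (elim x)
      then have "\<bar>sqrt (f x) - sqrt (f (- x))\<bar> \<le> inverse (sqrt (c / 2)) * \<bar>f x - f (- x)\<bar>"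
        using c by (intro abs_sqrt_diff_le) (auto intro: add_increasing2)
      then show ?case by simp
    qed
  qed
  then have "(\<lambda>x. (sqrt (f x) - sqrt c) - 1 * (sqrt (f (- x)) - sqrt c)) \<in> O[at_infinity](\<lambda>x. norm x powr (- a - \<delta>))"
    by (rule landau_o.big_trans) (use f in \<open>simp add: decay_def\<close>)
  then show ?thesis using 1 by (simp add: decay_def)
qed

text \<open>Reflection preserves the integral, so twice the integral is that of f(x) + f(-x), which
  parity -1 places at order a + \<delta>. The area of the sphere grows like r^(n - 1). This is where
  parity supplies the missing order.\<close>

lemma sphere_integral_tendsto_0:
  fixes f :: "real^'n::finite \<Rightarrow> real"
  assumes R: "R > 0" and c: "continuous_on {x. R < norm x} f" and d: "decay \<delta> a (-1) f" and a: "a + \<delta> > real CARD('n) - 1"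
  shows "((\<lambda>r. sphere_integral r f) \<longlongrightarrow> 0) at_top"
proof -
  let ?n = "CARD('n)"
  obtain C where "eventually (\<lambda>x. norm (f x - (-1) * f (- x)) \<le> C * norm (norm x powr (- a - \<delta>))) at_infinity"
    using d unfolding decay_def bigo_def by auto
  then obtain R1 where R1: "\<And>x. R1 \<le> norm x \<Longrightarrow> \<bar>f x + f (- x)\<bar> \<le> C * norm x powr (- a - \<delta>)"
    by (auto simp: eventually_at_infinity)
  define K where "K = real ?n * measure (sphere_dirs :: (real^'n) measure) (sphere 0 1)"
  have "eventually (\<lambda>r. norm (sphere_integral r f) \<le> (K * C / 2) * r powr (- (a + \<delta> - (real ?n - 1)))) at_top"
    using eventually_gt_at_top[of R] eventually_ge_at_top[of R1]
  proof eventually_elim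
    case (elim r)
    then have r: "r > 0" using R by simp
    have cf: "continuous_on (sphere 0 r) f" using elim by (intro continuous_on_subset[OF c]) auto
    have cf': "continuous_on (sphere 0 r) (\<lambda>x. f (- x))"
      by (intro continuous_on_compose2[OF cf]) (auto intro!: continuous_intros)
    have "2 * sphere_integral r f = sphere_integral r (\<lambda>x. f x + f (- x))"
      by (simp add: sphere_integral_add[OF r cf cf'] sphere_integral_reflect[OF r cf])
    moreover have "\<bar>sphere_integral r (\<lambda>x. f x + f (- x))\<bar> \<le> K * r ^ (?n - 1) * (C * r powr (- a - \<delta>))"
      unfolding K_def using R1 elim by (intro sphere_integral_bound r continuous_on_add cf cf') auto
    ultimately have "2 * \<bar>sphere_integral r f\<bar> \<le> K * r ^ (?n - 1) * (C * r powr (- a - \<delta>))" by linarith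
    also have "r ^ (?n - 1) = r powr (real ?n - 1)"
      using r by (simp add: of_nat_diff flip: powr_realpow)
    also have "K * r powr (real ?n - 1) * (C * r powr (- a - \<delta>)) = K * C * (r powr (real ?n - 1) * r powr (- a - \<delta>))" by simp
    also have "r powr (real ?n - 1) * r powr (- a - \<delta>) = r powr (- (a + \<delta> - (real ?n - 1)))"
      by (simp add: algebra_simps flip: powr_add)
    finally show ?case by simp
  qed
  moreover have "((\<lambda>r. (K * C / 2) * r powr (- (a + \<delta> - (real ?n - 1)))) \<longlongrightarrow> 0) at_top"
    by (intro tendsto_mult_right_zero tendsto_neg_powr filterlim_ident) (use a in simp)
  ultimately show ?thesis by (rule Lim_null_comparison)
qed

section \<open>Normal vector and area element of coordinate spheres\<close>

definition outer_prod :: "real^'n \<Rightarrow> real^'n \<Rightarrow> real^'n^'n" where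
  "outer_prod u v = (\<chi> i j. u $ i * v $ j)"

lemma outer_prod_simps:
  fixes A :: "real^'n^'n"
  shows "A ** outer_prod u v = outer_prod (A *v u) v" "outer_prod u v ** A = outer_prod u (transpose A *v v)"
    "transpose (outer_prod u v) = outer_prod v u" "outer_prod u v *v a = (v \<bullet> a) *\<^sub>R u"
    "outer_prod u 0 = 0" "outer_prod 0 u = 0"
  by (simp_all add: outer_prod_def vec_eq_iff matrix_matrix_mult_def matrix_vector_mult_def transpose_def
      inner_vec_def sum_distrib_left sum_distrib_right mult_ac vector_matrix_mult_def)

lemma sym_inner:
  fixes A :: "real^'n^'n"
  assumes "transpose A = A"
  shows "(A *v x) \<bullet> y = x \<bullet> (A *v y)"
  using dot_lmul_matrix[of x A y] assms by (metis transpose_matrix_vector)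

text \<open>The area distortion of the tangent hyperplane is the volume distortion times the length
  of the conormal in the inverse metric.\<close>

lemma area_density_eq:
  fixes G :: "real^'n::finite \<Rightarrow> real^'n^'n"
  assumes spd: "sym_posdef (G x)" and x: "x \<noteq> 0"
  defines "n \<equiv> euclidean_normal x"
  shows "area_density G x = sqrt (n \<bullet> (matrix_inv (G x) *v n)) * sqrt (det (G x))"
proof -
  let ?G = "G x" and ?N = "outer_prod n n"
  define P where "P = mat 1 - ?N"
  define u where "u = matrix_inv ?G *v n"
  define s where "s = n \<bullet> u"
  have tG: "transpose ?G = ?G" using spd by (simp add: sym_posdef_def)
  note inv = matrix_inv_mult[OF sym_posdef_invertible[OF spd]]
  have n1: "n \<bullet> n = 1" using x by (simp add: n_def euclidean_normal_def dot_square_norm power2_eq_square)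
  then have "n \<noteq> 0" by auto
  then have s: "s > 0" using sym_posdef_inv[OF spd] by (simp add: s_def u_def sym_posdef_def)
  have Gu: "?G *v u = n" by (simp add: u_def matrix_vector_mul_assoc inv)
  have Pn: "P *v n = 0" by (simp add: P_def matrix_vector_mult_diff_rdistrib outer_prod_simps(4) n1)
  have tP: "transpose P = P" by (simp add: P_def matrix_algebra_simps(10) outer_prod_simps(3))
  have PN: "P ** ?N = 0" by (simp add: outer_prod_simps(1,6) Pn)
  have NP: "?N ** P = 0" by (simp only: outer_prod_simps(2) tP Pn outer_prod_simps(5))
  have NN: "?N ** ?N = ?N"
    by (simp add: outer_prod_simps(1,4) n1)
  have PP: "P ** P = P"
  proof -
    have "P ** P = P ** (mat 1 - ?N)" by (simp add: P_def)
    then show ?thesis by (simp add: matrix_algebra_simps(3) PN)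
  qed
  \<comment> \<open>\<open>B\<close> fixes the Euclidean tangent space and sends \<open>n\<close> to
    \<open>u\<close>, which is orthogonal to that space with respect to the metric. Hence transpose
    B ** G ** B is block diagonal, with the tangential block and \<open>s\<close> on the normal
    line; comparing determinants gives the claim because det B is \<open>s\<close>.\<close>
  define B where "B = P + outer_prod u n"
  have "B = mat 1 + (\<chi> i j. (u - n) $ i * n $ j)"
    by (simp add: B_def P_def outer_prod_def vec_eq_iff algebra_simps)
  then have "det B = 1 + (u - n) \<bullet> n" by (simp only: det_rank_one)
  then have detB: "det B = s"
    by (simp add: s_def inner_diff_left inner_diff_right n1 inner_commute)
  have GB: "?G ** B = ?G ** P + ?N"
    by (simp add: B_def matrix_algebra_simps(1) outer_prod_simps(1) Gu)
  have un: "outer_prod n u ** (?G ** P) = 0"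
  proof -
    have "transpose (?G ** P) *v u = P *v (?G *v u)"
      by (simp only: matrix_transpose_mul tP tG matrix_vector_mul_assoc)
    then show ?thesis by (simp only: outer_prod_simps(2) Gu Pn outer_prod_simps(5))
  qed
  have uN: "outer_prod n u ** ?N = s *\<^sub>R ?N"
    by (simp add: outer_prod_simps(1,4) s_def inner_commute) (simp add: outer_prod_def vec_eq_iff)
  have tB: "transpose B = P + outer_prod n u"
    by (simp add: B_def matrix_algebra_simps(9) tP outer_prod_simps(3))
  have "transpose B ** (?G ** B) = P ** ?G ** P + s *\<^sub>R ?N"
    unfolding GB tB matrix_algebra_simps(1,2) un uN PN by (simp add: matrix_mul_assoc)
  also have "\<dots> = (P ** ?G ** P + ?N) ** (P + s *\<^sub>R ?N)"
  proof -
    have "P ** ?G ** P ** P = P ** ?G ** P" "P ** ?G ** P ** ?N = 0"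
      by (simp_all add: PP PN flip: matrix_mul_assoc)
    then show ?thesis by (simp add: matrix_algebra_simps(1,2,7) NP NN)
  qed
  finally have "det (transpose B ** (?G ** B)) = det ((P ** ?G ** P + ?N) ** (P + s *\<^sub>R ?N))" by simp
  then have "det B * (det ?G * det B) = det (P ** ?G ** P + ?N) * det (P + s *\<^sub>R ?N)"
    by (simp only: det_mul det_transpose)
  moreover have "P + s *\<^sub>R ?N = mat 1 + (\<chi> i j. ((s - 1) *\<^sub>R n) $ i * n $ j)"
    by (simp add: P_def outer_prod_def vec_eq_iff algebra_simps)
  then have "det (P + s *\<^sub>R ?N) = 1 + ((s - 1) *\<^sub>R n) \<bullet> n" by (simp only: det_rank_one)
  then have "det (P + s *\<^sub>R ?N) = s" by (simp add: n1)
  ultimately have "det (P ** ?G ** P + ?N) = s * det ?G" using s detB by (simp add: mult.commute[of s])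
  then show ?thesis
    by (simp add: area_density_def Let_def outer_prod_def[symmetric] n_def[symmetric] P_def[symmetric] real_sqrt_mult s_def u_def)
qed

text \<open>A covector annihilating the orthogonal complement of \<open>x\<close> is a multiple of
  \<open>x\<close>; unit length and outward direction then fix the multiple, which resolves the
  definite description.\<close>

lemma outer_normal_eq:
  fixes G :: "real^'n::finite \<Rightarrow> real^'n^'n"
  assumes spd: "sym_posdef (G x)" and x: "x \<noteq> 0"
  shows "outer_normal G x = inverse (sqrt (x \<bullet> (matrix_inv (G x) *v x))) *\<^sub>R (matrix_inv (G x) *v x)"
proof -
  let ?G = "G x" and ?H = "matrix_inv (G x)"
  note inv = matrix_inv_mult[OF sym_posdef_invertible[OF spd]]
  have tG: "transpose ?G = ?G" using spd by (simp add: sym_posdef_def)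
  define s where "s = x \<bullet> (?H *v x)"
  have s: "s > 0" using sym_posdef_inv[OF spd] x by (simp add: s_def sym_posdef_def)
  have GH: "(?H *v y) \<bullet> (?G *v w) = y \<bullet> w" for y w
    by (simp add: sym_inner[OF tG, symmetric] matrix_vector_mul_assoc inv)
  define c where "c = inverse (sqrt s)"
  have c: "c > 0" "c * c * s = 1"
    using s by (simp_all add: c_def field_simps)
  show ?thesis
    unfolding outer_normal_def s_def[symmetric] c_def[symmetric]
  proof (rule the_equality)
    show "(\<forall>w. w \<bullet> x = 0 \<longrightarrow> (c *\<^sub>R (?H *v x)) \<bullet> (?G *v w) = 0) \<and>
      (c *\<^sub>R (?H *v x)) \<bullet> (?G *v (c *\<^sub>R (?H *v x))) = 1 \<and> (c *\<^sub>R (?H *v x)) \<bullet> x > 0"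
      using s c by (simp add: GH inner_commute[of _ x] matrix_vector_mult_scaleR s_def[symmetric] mult.assoc)
  next
    fix v assume v: "(\<forall>w. w \<bullet> x = 0 \<longrightarrow> v \<bullet> (?G *v w) = 0) \<and> v \<bullet> (?G *v v) = 1 \<and> v \<bullet> x > 0"
    \<comment> \<open>\<open>t\<close> is the coefficient of the Euclidean projection of the lowered
      vector onto \<open>x\<close>, and \<open>w\<close> the tangential rest, which turns out to be
      orthogonal to itself.\<close>
    define t where "t = ((?G *v v) \<bullet> x) / (x \<bullet> x)"
    define w where "w = ?G *v v - t *\<^sub>R x"
    have wx: "w \<bullet> x = 0" using x by (simp add: w_def t_def inner_diff_left)
    then have "(?G *v v) \<bullet> w = 0" using v by (simp add: sym_inner[OF tG])
    moreover have "w \<bullet> w = (?G *v v) \<bullet> w - t * (w \<bullet> x)"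
      by (subst (1) w_def) (simp add: inner_diff_right inner_diff_left inner_commute)
    ultimately have "w \<bullet> w = 0" using wx by simp
    then have Gv: "?G *v v = t *\<^sub>R x" by (simp add: w_def)
    have "v = ?H *v (?G *v v)" by (simp add: matrix_vector_mul_assoc inv)
    then have vt: "v = t *\<^sub>R (?H *v x)" by (simp add: Gv matrix_vector_mult_scaleR)
    have vx: "v \<bullet> x = t * s" by (simp add: vt s_def inner_commute)
    then have t: "t > 0" using s v by (simp add: zero_less_mult_iff)
    have "v \<bullet> (?G *v v) = t * (t * s)" by (simp add: Gv vx)
    then have "t * t * s = c * c * s" using v c by simp
    then have "t\<^sup>2 = c\<^sup>2" using s by (simp add: power2_eq_square)
    then have "t = c" using t c by (simp add: power2_eq_iff_nonneg)
    then show "v = c *\<^sub>R (?H *v x)" using vt by simp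
  qed
qed

text \<open>The length of the conormal enters the area density and the normalisation of the normal
  inversely and cancels. What is left is the factor called \<open>wt\<close> and the raised
  Euclidean normal expected by \<open>einstein_divergence\<close>.\<close>

lemma conormal_density:
  fixes G :: "real^'n::finite \<Rightarrow> real^'n^'n"
  assumes spd: "sym_posdef (G x)" and x: "x \<noteq> 0"
  shows "area_density G x *\<^sub>R outer_normal G x = sqrt (det (G x)) *\<^sub>R (matrix_inv (G x) *v euclidean_normal x)"
proof -
  define n where "n = euclidean_normal x"
  define s where "s = n \<bullet> (matrix_inv (G x) *v n)"
  have xe: "x = norm x *\<^sub>R n" using x by (simp add: euclidean_normal_def n_def)
  have H: "matrix_inv (G x) *v x = norm x *\<^sub>R (matrix_inv (G x) *v n)"
    by (subst (2) xe) (simp add: matrix_vector_mult_scaleR)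
  have "x \<bullet> (matrix_inv (G x) *v x) > 0" using sym_posdef_inv[OF spd] x by (simp add: sym_posdef_def)
  moreover have xs: "x \<bullet> (matrix_inv (G x) *v x) = norm x * norm x * s"
    unfolding H by (subst (1) xe) (simp add: s_def)
  ultimately have s: "s > 0" using x by (simp add: zero_less_mult_iff)
  have q: "sqrt (x \<bullet> (matrix_inv (G x) *v x)) = norm x * sqrt s"
    unfolding xs by (simp add: real_sqrt_mult)
  have "area_density G x *\<^sub>R outer_normal G x
      = (sqrt s * sqrt (det (G x)) * (inverse (norm x * sqrt s) * norm x)) *\<^sub>R (matrix_inv (G x) *v n)"
    unfolding outer_normal_eq[where G=G and x=x, OF assms] area_density_eq[where G=G and x=x, OF assms] q n_def[symmetric] s_def[symmetric] unfolding H by simp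
  also have "sqrt s * sqrt (det (G x)) * (inverse (norm x * sqrt s) * norm x) = sqrt (det (G x))"
    using s x by (simp add: field_simps)
  finally show ?thesis by (simp add: n_def)
qed

section \<open>Decay on an asymptotically flat end\<close>

text \<open>Coordinates near infinity. \<open>\<delta>\<close> is 0 in general and 1 under the RT
  conditions; metric coefficients are even and their first derivatives odd up to that gain. The
  potentials and remainders to be estimated are of first order in the metric.\<close>

locale af_end = metric_field G "{x. R0 < norm x}"
  for G :: "real^'n::finite \<Rightarrow> real^'n^'n" and R0 :: real +
  fixes \<tau> \<delta> :: real
  assumes R0: "R0 > 0" and tau: "\<tau> > 0"
    and decay_G: "decay \<delta> \<tau> 1 (\<lambda>x. G x $ i $ j - mat 1 $ i $ j)"
    and decay_dG: "decay \<delta> (\<tau> + 1) (-1) (partial k (\<lambda>x. G x $ i $ j))"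
begin

abbreviation E :: "(real^'n) set" where "E \<equiv> {x. R0 < norm x}"

text \<open>Functions with limit \<open>c\<close> and the decay and parity of the metric
  coefficients. Closure under sums, products, reciprocals and square roots carries these properties
  to determinants, \<open>wt\<close> and the inverse metric.\<close>

definition tame :: "real \<Rightarrow> (real^'n \<Rightarrow> real) \<Rightarrow> bool" where
  "tame c f \<longleftrightarrow> C1_on f E \<and> decay \<delta> \<tau> 1 (\<lambda>x. f x - c) \<and> (\<forall>k. decay \<delta> (\<tau> + 1) (-1) (partial k f))"

lemma tameD:
  assumes "tame c f"
  shows "C1_on f E" "decay \<delta> \<tau> 1 (\<lambda>x. f x - c)" "decay \<delta> (\<tau> + 1) (-1) (partial k f)" "decay \<delta> 0 1 f"
proof -
  have "decay \<delta> 0 1 (\<lambda>x. (f x - c) + c)"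
  proof (rule decay_add[OF _ decay_const])
    show "decay \<delta> 0 1 (\<lambda>x. f x - c)"
      by (rule decay_mono[of \<delta> \<tau>]) (use assms tau in \<open>auto simp: tame_def\<close>)
  qed
  then show "decay \<delta> 0 1 f" by simp
qed (use assms in \<open>auto simp: tame_def\<close>)

lemma tame_cong:
  assumes "\<And>x. R0 < norm x \<Longrightarrow> f x = g x" and g: "tame c g"
  shows "tame c f"
  unfolding tame_def
proof (intro conjI allI)
  show "C1_on f E" using C1_cong[OF open_S, of f g] tameD(1)[OF g] assms(1) by simp
  show "decay \<delta> \<tau> 1 (\<lambda>x. f x - c)"
    using decay_cong_exterior[of R0 "\<lambda>x. f x - c" "\<lambda>x. g x - c"] tameD(2)[OF g] assms(1) by simp
  fix k
  have "partial k f x = partial k g x" if "R0 < norm x" for x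
    by (rule partial_cong[OF open_S]) (use that assms(1) in auto)
  then show "decay \<delta> (\<tau> + 1) (-1) (partial k f)"
    using decay_cong_exterior[of R0 "partial k f" "partial k g"] tameD(3)[OF g] by simp
qed

lemma tame_const: "tame c (\<lambda>x. c)"
  unfolding tame_def by (simp add: partial_const[abs_def])

lemma tame_add:
  assumes f: "tame c f" and g: "tame d g"
  shows "tame (c + d) (\<lambda>x. f x + g x)"
  unfolding tame_def
proof (intro conjI allI)
  show "C1_on (\<lambda>x. f x + g x) E" by (intro C1_add tameD(1)[OF f] tameD(1)[OF g])
  have "decay \<delta> \<tau> 1 (\<lambda>x. (f x - c) + (g x - d))" by (intro decay_add tameD(2)[OF f] tameD(2)[OF g])
  then show "decay \<delta> \<tau> 1 (\<lambda>x. f x + g x - (c + d))" by (simp add: algebra_simps)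
  fix k
  have "decay \<delta> (\<tau> + 1) (-1) (\<lambda>x. partial k f x + partial k g x)" by (intro decay_add tameD(3)[OF f] tameD(3)[OF g])
  moreover have "partial k (\<lambda>x. f x + g x) x = partial k f x + partial k g x" if "R0 < norm x" for x
    using that by (intro partial_add C1D(1)[OF tameD(1)[OF f]] C1D(1)[OF tameD(1)[OF g]]) auto
  ultimately show "decay \<delta> (\<tau> + 1) (-1) (partial k (\<lambda>x. f x + g x))"
    using decay_cong_exterior[of R0 "partial k (\<lambda>x. f x + g x)" "\<lambda>x. partial k f x + partial k g x"] by simp
qed

lemma tame_mult:
  assumes f: "tame c f" and g: "tame d g"
  shows "tame (c * d) (\<lambda>x. f x * g x)"
  unfolding tame_def
proof (intro conjI allI)
  show "C1_on (\<lambda>x. f x * g x) E" by (intro C1_mult tameD(1)[OF f] tameD(1)[OF g])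
  have "decay \<delta> \<tau> 1 (\<lambda>x. (f x - c) * g x)" using decay_mult[OF tameD(2)[OF f] tameD(4)[OF g]] by simp
  then have "decay \<delta> \<tau> 1 (\<lambda>x. (f x - c) * g x + c * (g x - d))"
    by (intro decay_add decay_cmult tameD(2)[OF g])
  then show "decay \<delta> \<tau> 1 (\<lambda>x. f x * g x - c * d)" by (simp add: algebra_simps)
  fix k
  have "decay \<delta> (\<tau> + 1) (-1) (\<lambda>x. partial k f x * g x)"
    using decay_mult[OF tameD(3)[OF f, of k] tameD(4)[OF g]] by simp
  moreover have "decay \<delta> (\<tau> + 1) (-1) (\<lambda>x. f x * partial k g x)"
    using decay_mult[OF tameD(4)[OF f] tameD(3)[OF g, of k]] by simp
  ultimately have "decay \<delta> (\<tau> + 1) (-1) (\<lambda>x. partial k f x * g x + f x * partial k g x)"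
    by (rule decay_add)
  moreover have "partial k (\<lambda>x. f x * g x) x = partial k f x * g x + f x * partial k g x" if "R0 < norm x" for x
    using that by (intro partial_mult C1D(1)[OF tameD(1)[OF f]] C1D(1)[OF tameD(1)[OF g]]) auto
  ultimately show "decay \<delta> (\<tau> + 1) (-1) (partial k (\<lambda>x. f x * g x))"
    using decay_cong_exterior[of R0 "partial k (\<lambda>x. f x * g x)" "\<lambda>x. partial k f x * g x + f x * partial k g x"] by simp
qed

lemma tame_sum: "(\<And>i. i \<in> I \<Longrightarrow> tame (c i) (f i)) \<Longrightarrow> tame (\<Sum>i\<in>I. c i) (\<lambda>x. \<Sum>i\<in>I. f i x)"
  by (induction I rule: infinite_finite_induct) (simp_all add: tame_add tame_const)

lemma tame_prod: "(\<And>i. i \<in> I \<Longrightarrow> tame (c i) (f i)) \<Longrightarrow> tame (\<Prod>i\<in>I. c i) (\<lambda>x. \<Prod>i\<in>I. f i x)"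
  by (induction I rule: infinite_finite_induct) (simp_all add: tame_mult tame_const)

lemma tame_det:
  assumes "\<And>i j. tame (C $ i $ j) (\<lambda>x. M x $ i $ j)"
  shows "tame (det C) (\<lambda>x. det (M x))"
  unfolding det_def by (intro tame_sum tame_mult tame_const tame_prod assms)

lemma tame_inverse:
  assumes f: "tame c f" and c: "c \<noteq> 0" and nz: "\<And>x. R0 < norm x \<Longrightarrow> f x \<noteq> 0"
  shows "tame (inverse c) (\<lambda>x. inverse (f x))"
  unfolding tame_def
proof (intro conjI allI)
  show "C1_on (\<lambda>x. inverse (f x)) E" by (intro C1_inverse tameD(1)[OF f]) (use nz in auto)
  note inv = decay_inverse[OF tameD(2)[OF f] tau c]
  show "decay \<delta> \<tau> 1 (\<lambda>x. inverse (f x) - inverse c)" by (rule inv)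
  fix k
  have "decay \<delta> (\<tau> + 1) (-1) (\<lambda>x. - (partial k f x * (inverse (f x) * inverse (f x))))"
    using decay_minus[OF decay_mult[OF tameD(3)[OF f, of k] decay_mult[OF inv(1) inv(1)]]] by simp
  moreover have "partial k (\<lambda>x. inverse (f x)) x = - (partial k f x * (inverse (f x) * inverse (f x)))" if "R0 < norm x" for x
    using that nz by (intro partial_inverse C1D(1)[OF tameD(1)[OF f]]) auto
  ultimately show "decay \<delta> (\<tau> + 1) (-1) (partial k (\<lambda>x. inverse (f x)))"
    using decay_cong_exterior[of R0 "partial k (\<lambda>x. inverse (f x))" "\<lambda>x. - (partial k f x * (inverse (f x) * inverse (f x)))"] by simp
qed

lemma tame_sqrt:
  assumes f: "tame c f" and c: "c > 0" and pos: "\<And>x. R0 < norm x \<Longrightarrow> f x > 0"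
  shows "tame (sqrt c) (\<lambda>x. sqrt (f x))"
  unfolding tame_def
proof (intro conjI allI)
  show "C1_on (\<lambda>x. sqrt (f x)) E" by (intro C1_sqrt tameD(1)[OF f]) (use pos in auto)
  show sq: "decay \<delta> \<tau> 1 (\<lambda>x. sqrt (f x) - sqrt c)" by (rule decay_sqrt[OF tameD(2)[OF f] tau c])
  have inv: "decay \<delta> 0 1 (\<lambda>x. inverse (sqrt (f x)))" by (rule decay_inverse[OF sq tau]) (use c in simp)
  fix k
  have "decay \<delta> (\<tau> + 1) (-1) (\<lambda>x. 1/2 * (partial k f x * inverse (sqrt (f x))))"
    using decay_cmult[OF decay_mult[OF tameD(3)[OF f, of k] inv], of "1/2"] by simp
  moreover have "partial k (\<lambda>x. sqrt (f x)) x = 1/2 * (partial k f x * inverse (sqrt (f x)))" if "R0 < norm x" for x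
    using that pos partial_sqrt[OF C1D(1)[OF tameD(1)[OF f]], of x k] by simp
  ultimately show "decay \<delta> (\<tau> + 1) (-1) (partial k (\<lambda>x. sqrt (f x)))"
    using decay_cong_exterior[of R0 "partial k (\<lambda>x. sqrt (f x))" "\<lambda>x. 1/2 * (partial k f x * inverse (sqrt (f x)))"] by simp
qed

lemma tame_G: "tame (mat 1 $ i $ j) (\<lambda>x. G x $ i $ j)"
  unfolding tame_def using C1_G decay_G decay_dG by blast

lemma tame_wt: "tame 1 wt"
proof -
  have "tame (sqrt (det (mat 1 :: real^'n^'n))) (\<lambda>x. sqrt (det (G x)))"
    by (intro tame_sqrt tame_det tame_G) (simp_all add: det_pos)
  then show ?thesis by (simp add: wt_def[abs_def])
qed

lemma tame_Ginv: "tame (mat 1 $ k $ l) (\<lambda>x. matrix_inv (G x) $ k $ l)"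
proof -
  define C where "C A = (\<chi> i j. if j = k then (if i = l then 1 else 0) else A $ i $ j)" for A :: "real^'n^'n"
  have inv: "matrix_inv A $ k $ l = det (C A) * inverse (det A)" if "det A \<noteq> 0" for A
    unfolding C_def by (rule matrix_inv_entry[OF that])
  have "matrix_inv (mat 1) = (mat 1 :: real^'n^'n)"
    using matrix_inv_mult(1)[of "mat 1 :: real^'n^'n"] by (simp add: invertible_det_nz)
  then have c: "mat 1 $ k $ l = det (C (mat 1)) * inverse (det (mat 1 :: real^'n^'n))"
    using inv[of "mat 1"] by simp
  have "tame (det (C (mat 1)) * inverse (det (mat 1 :: real^'n^'n))) (\<lambda>x. det (C (G x)) * inverse (det (G x)))"
  proof (intro tame_mult tame_inverse tame_det tame_G)
    show "tame (C (mat 1) $ i $ j) (\<lambda>x. C (G x) $ i $ j)" for i j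
      using tame_G[of i j] by (cases "j = k"; cases "i = l") (simp_all add: tame_const C_def)
    show "det (G x) \<noteq> 0" if "R0 < norm x" for x using det_pos[of x] that by simp
  qed simp
  then have "tame (mat 1 $ k $ l) (\<lambda>x. det (C (G x)) * inverse (det (G x)))" unfolding c .
  moreover have "matrix_inv (G x) $ k $ l = det (C (G x)) * inverse (det (G x))" if "R0 < norm x" for x
    using inv[of "G x"] det_pos[of x] that by simp
  ultimately show ?thesis
    using tame_cong[of "\<lambda>x. matrix_inv (G x) $ k $ l" "\<lambda>x. det (C (G x)) * inverse (det (G x))"] by simp
qed

lemma tame_wtGinv: "tame (mat 1 $ k $ l) (\<lambda>x. (wt x *\<^sub>R matrix_inv (G x)) $ k $ l)"
  using tame_mult[OF tame_wt tame_Ginv, of k l] by simp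

section \<open>Linearisation of the connection and of the potentials\<close>

lemma decay_Gam: "decay \<delta> (\<tau> + 1) (-1) (\<lambda>x. Gam G b x $ c $ d)"
proof -
  have "decay \<delta> (\<tau> + 1) (-1) (\<lambda>x. matrix_inv (G x) $ c $ l *
     (partial b (\<lambda>y. G y $ d $ l) x + partial d (\<lambda>y. G y $ b $ l) x - partial l (\<lambda>y. G y $ b $ d) x))" for l
    using decay_mult[OF tameD(4)[OF tame_Ginv] decay_diff[OF decay_add[OF decay_dG decay_dG] decay_dG]] by simp
  then show ?thesis
    unfolding Gam_def christoffel_def vec_lambda_beta by (intro decay_cmult decay_sum)
qed

text \<open>The linearised Christoffel symbols at the Euclidean metric.\<close>

definition Glin :: "'n \<Rightarrow> 'n \<Rightarrow> 'n \<Rightarrow> real^'n \<Rightarrow> real" where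
  "Glin b c d x = 1/2 * (partial b (\<lambda>y. G y $ d $ c) x + partial d (\<lambda>y. G y $ b $ c) x - partial c (\<lambda>y. G y $ b $ d) x)"

text \<open>The inverse metric differs from the identity at order \<tau>, and this difference
  multiplies first derivatives of order \<tau> + 1.\<close>

lemma decay_Gam_linear: "decay \<delta> (2 * \<tau> + 1) (-1) (\<lambda>x. Gam G b x $ c $ d - Glin b c d x)"
proof -
  define D where "D l x = partial b (\<lambda>y. G y $ d $ l) x + partial d (\<lambda>y. G y $ b $ l) x - partial l (\<lambda>y. G y $ b $ d) x" for l x
  have "decay \<delta> (\<tau> + 1) (-1) (D l)" for l
    unfolding D_def by (intro decay_diff decay_add decay_dG)
  from decay_mult[OF tameD(2)[OF tame_Ginv] this]
  have "decay \<delta> (2 * \<tau> + 1) (-1) (\<lambda>x. (matrix_inv (G x) $ c $ l - mat 1 $ c $ l) * D l x)" for l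
    by (simp add: algebra_simps)
  then have "decay \<delta> (2 * \<tau> + 1) (-1) (\<lambda>x. 1/2 * (\<Sum>l\<in>UNIV. (matrix_inv (G x) $ c $ l - mat 1 $ c $ l) * D l x))"
    by (intro decay_cmult decay_sum)
  moreover have "1/2 * (\<Sum>l\<in>UNIV. (matrix_inv (G x) $ c $ l - mat 1 $ c $ l) * D l x) = Gam G b x $ c $ d - Glin b c d x" for x
  proof -
    have "(\<Sum>l\<in>UNIV. mat 1 $ c $ l * D l x) = D c x"
      by (simp add: mat_def if_distrib[of "\<lambda>a. a * _"] cong: if_cong)
    then show ?thesis
      by (simp add: Gam_def christoffel_def Glin_def D_def[symmetric] left_diff_distrib sum_subtractf)
  qed
  ultimately show ?thesis by (simp only:)
qed

lemma decay_Bpot_linear: "decay \<delta> (2 * \<tau> + 1) (-1) (\<lambda>x. Bpot b x $ c $ d - Glin b c d x)"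
proof -
  define K where "K x = (wt x *\<^sub>R matrix_inv (G x))" for x
  have "decay \<delta> (2 * \<tau> + 1) (-1) (\<lambda>x. Gam G b x $ c $ e * (K x $ e $ d - mat 1 $ e $ d))" for e
    using decay_mult[OF decay_Gam tameD(2)[OF tame_wtGinv]] by (simp add: K_def algebra_simps)
  then have "decay \<delta> (2 * \<tau> + 1) (-1) (\<lambda>x. (\<Sum>e\<in>UNIV. Gam G b x $ c $ e * (K x $ e $ d - mat 1 $ e $ d)) + (Gam G b x $ c $ d - Glin b c d x))"
    by (intro decay_add decay_sum decay_Gam_linear)
  moreover have "(\<Sum>e\<in>UNIV. Gam G b x $ c $ e * (K x $ e $ d - mat 1 $ e $ d)) = Bpot b x $ c $ d - Gam G b x $ c $ d" for x
  proof -
    have "(\<Sum>e\<in>UNIV. Gam G b x $ c $ e * mat 1 $ e $ d) = Gam G b x $ c $ d"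
      by (simp add: mat_def if_distrib[of "\<lambda>a. _ * a"] cong: if_cong)
    then show ?thesis
      by (simp add: Bpot_def K_def[symmetric] matrix_matrix_mult_def right_diff_distrib sum_subtractf)
  qed
  ultimately show ?thesis by simp
qed

text \<open>The linearisation of \<open>Apot\<close>: in \<open>Glin b c d x - Glin b d c x\<close>
  the derivative in direction \<open>b\<close> drops out by symmetry of the metric.\<close>

definition Alin :: "'n \<Rightarrow> 'n \<Rightarrow> 'n \<Rightarrow> real^'n \<Rightarrow> real" where
  "Alin b c d x = partial d (\<lambda>y. G y $ b $ c) x - partial c (\<lambda>y. G y $ b $ d) x"

lemma partial_G_sym: "R0 < norm x \<Longrightarrow> partial k (\<lambda>y. G y $ i $ j) x = partial k (\<lambda>y. G y $ j $ i) x"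
  using dmat_G_sym[of x k i j] by (simp add: dmat_def)

lemma decay_Apot_linear: "decay \<delta> (2 * \<tau> + 1) (-1) (\<lambda>x. Apot b x $ c $ d - Alin b c d x)"
proof -
  have "decay \<delta> (2 * \<tau> + 1) (-1) (\<lambda>x. (Bpot b x $ c $ d - Glin b c d x) - (Bpot b x $ d $ c - Glin b d c x))"
    by (intro decay_diff decay_Bpot_linear)
  moreover have "Apot b x $ c $ d - Alin b c d x = (Bpot b x $ c $ d - Glin b c d x) - (Bpot b x $ d $ c - Glin b d c x)"
    if x: "R0 < norm x" for x
    using partial_G_sym[OF x, of b c d] by (simp add: Apot_def Alin_def Glin_def field_simps)
  ultimately show ?thesis
    using decay_cong_exterior[of R0 "\<lambda>x. Apot b x $ c $ d - Alin b c d x"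
        "\<lambda>x. (Bpot b x $ c $ d - Glin b c d x) - (Bpot b x $ d $ c - Glin b d c x)"] by simp
qed

lemma decay_matrix_mult:
  assumes "\<And>i j. decay \<delta> a s (\<lambda>x. M x $ i $ j)" "\<And>i j. decay \<delta> b t (\<lambda>x. N x $ i $ j)"
  shows "decay \<delta> (a + b) (s * t) (\<lambda>x. (M x ** N x) $ i $ j)"
  unfolding matrix_matrix_mult_def vec_lambda_beta by (intro decay_sum decay_mult assms)

text \<open>Each summand has two odd factors of order \<tau> + 1, connection matrices or a
  derivative of the weighted inverse metric; the remaining factors are even and bounded.\<close>

lemma decay_Qrem: "decay \<delta> (2 * \<tau> + 2) 1 (\<lambda>x. Qrem a b x $ c $ d)"
proof -
  define K where "K x = (wt x *\<^sub>R matrix_inv (G x))" for x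
  have K: "decay \<delta> 0 1 (\<lambda>x. K x $ i $ j)" for i j
    using tameD(4)[OF tame_wtGinv] by (simp add: K_def)
  have dK: "decay \<delta> (\<tau> + 1) (-1) (\<lambda>x. dmat a K x $ i $ j)" for a i j
    using tameD(3)[OF tame_wtGinv[of i j], of a] by (simp add: dmat_def K_def)
  have gg: "decay \<delta> (2 * \<tau> + 2) 1 (\<lambda>x. (Gam G a x ** Gam G b x) $ i $ j)" for a b i j
    using decay_matrix_mult[OF decay_Gam decay_Gam, of a b i j] by (simp add: algebra_simps)
  have gk: "decay \<delta> (2 * \<tau> + 2) 1 (\<lambda>x. (Gam G b x ** dmat a K x) $ i $ j)" for a b i j
    using decay_matrix_mult[OF decay_Gam dK, of b a i j] by (simp add: algebra_simps)
  have "decay \<delta> (2 * \<tau> + 2) 1 (\<lambda>x. (Gam G a x ** Gam G b x - Gam G b x ** Gam G a x) $ i $ j)" for i j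
    unfolding vector_minus_component by (intro decay_diff gg)
  from decay_matrix_mult[OF this K]
  have ggk: "decay \<delta> (2 * \<tau> + 2) 1 (\<lambda>x. ((Gam G a x ** Gam G b x - Gam G b x ** Gam G a x) ** K x) $ i $ j)" for i j
    by simp
  have "decay \<delta> (2 * \<tau> + 2) 1 (\<lambda>x. ((Gam G a x ** Gam G b x - Gam G b x ** Gam G a x) ** K x) $ c $ d
     - (Gam G b x ** dmat a K x) $ c $ d + (Gam G a x ** dmat b K x) $ c $ d)" for c d
    by (intro decay_add decay_diff ggk gk)
  then have q: "decay \<delta> (2 * \<tau> + 2) 1 (\<lambda>x. qrem a b x $ c $ d)" for c d
    by (simp add: qrem_def K_def[abs_def])
  show ?thesis
    unfolding Qrem_def vector_minus_component transpose_component by (intro decay_diff q)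
qed

lemma continuous_Qrem: "continuous_on E (\<lambda>x. Qrem a b x $ c $ d)"
proof -
  have K: "continuous_on E (\<lambda>x. (wt x *\<^sub>R matrix_inv (G x)) $ i $ j)"
    "continuous_on E (\<lambda>x. dmat a (\<lambda>y. wt y *\<^sub>R matrix_inv (G y)) x $ i $ j)" for a i j
    using C1D(2,3)[OF tameD(1)[OF tame_wtGinv[of i j]]] by (auto simp: dmat_def)
  note g = C1D(3)[OF C1_Gam]
  have q: "continuous_on E (\<lambda>x. qrem a b x $ c $ d)" for c d
    unfolding qrem_def matrix_matrix_mult_def vector_minus_component vector_add_component vec_lambda_beta
    by (intro continuous_intros g K)
  show ?thesis
    unfolding Qrem_def vector_minus_component transpose_component by (intro continuous_intros q)
qed

end

section \<open>Flux integrals\<close>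

context metric_field
begin

lemma continuous_scal: "continuous_on S (scal G)"
proof -
  have c: "C1_on (christoffel G k i j) S" for k i j
    using C1_Gam[of i k j] by (simp add: Gam_def)
  show ?thesis
    unfolding scal_def[abs_def] ricci_def vec_lambda_beta
    by (intro continuous_intros C1D(3)[OF C1_Ginv] C1D(2)[OF c] C1D(3)[OF c])
qed

end

context af_end
begin

lemma sphere_subset_E: "R0 < r \<Longrightarrow> sphere 0 r \<subseteq> E"
  by auto

lemma continuous_on_sphere_E: "continuous_on E f \<Longrightarrow> R0 < r \<Longrightarrow> continuous_on (sphere 0 r) f"
  using continuous_on_subset sphere_subset_E by blast

lemma continuous_euclidean_normal: "continuous_on E (\<lambda>x. euclidean_normal x $ k)"
  unfolding euclidean_normal_def using R0 by (intro continuous_intros) auto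

text \<open>The vector potential of the scalar curvature from \<open>scal_divergence\<close>. Its
  linearisation \<open>Vlin\<close> is the integrand of the classical mass.\<close>

definition Wpot :: "'n \<Rightarrow> real^'n \<Rightarrow> real" where
  "Wpot k x = (\<Sum>d\<in>UNIV. Apot d x $ k $ d)"

definition Vlin :: "'n \<Rightarrow> real^'n \<Rightarrow> real" where
  "Vlin k x = (\<Sum>d\<in>UNIV. Alin d k d x)"

lemma C1_Wpot: "C1_on (Wpot k) E"
  unfolding Wpot_def[abs_def] by (intro C1_sum C1_Apot)

lemma partial_Apot: "partial a (\<lambda>x. Apot d x $ k $ j) x = dmat a (Apot d) x $ k $ j"
  by (simp add: dmat_def)

lemma partial_Wpot: "x \<in> E \<Longrightarrow> partial a (Wpot k) x = (\<Sum>d\<in>UNIV. dmat a (Apot d) x $ k $ d)"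
  unfolding Wpot_def[abs_def] by (subst partial_sum) (simp_all add: C1D(1)[OF C1_Apot] partial_Apot)

lemma continuous_Alin: "continuous_on E (Alin b c d)"
  unfolding Alin_def[abs_def] by (intro continuous_intros C1D(2)[OF C1_G])

lemma continuous_Vlin: "continuous_on E (Vlin k)"
  unfolding Vlin_def[abs_def] by (intro continuous_intros continuous_Alin)

lemma decay_Wpot: "decay \<delta> (2 * \<tau> + 1) (-1) (\<lambda>x. Wpot k x - Vlin k x)"
  unfolding Wpot_def Vlin_def sum_subtractf[symmetric] by (intro decay_sum decay_Apot_linear)

lemma mass_flux_eq:
  assumes r: "R0 < r"
  shows "mass_flux G r = sphere_integral r (\<lambda>x. \<Sum>k\<in>UNIV. Vlin k x * euclidean_normal x $ k)"
  unfolding mass_flux_def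
proof (rule sphere_integral_cong)
  fix x :: "real^'n" assume "norm x = r"
  then have x: "x \<in> E" using r by simp
  have "(- euclidean_delta G x - d_trace G x) $ k = Vlin k x" for k
    using C1D(1)[OF C1_G x] by (simp add: euclidean_delta_def d_trace_def Vlin_def Alin_def trace_def partial_sum sum_subtractf)
  then show "(- euclidean_delta G x - d_trace G x) \<bullet> euclidean_normal x = (\<Sum>k\<in>UNIV. Vlin k x * euclidean_normal x $ k)"
    unfolding inner_vec_def inner_real_def by simp
qed

lemma euclidean_normal_eq: "norm x = r \<Longrightarrow> euclidean_normal x $ k = inverse r * x $ k"
  by (simp add: euclidean_normal_def)

definition quad :: "(real^'n \<Rightarrow> real^'n) \<Rightarrow> real^'n \<Rightarrow> real" where
  "quad X x = - (\<Sum>k\<in>UNIV. X x $ k * euclidean_normal x $ k) * (\<Sum>a\<in>UNIV. \<Sum>d\<in>UNIV. Qrem a d x $ a $ d) / 4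
    + (\<Sum>k\<in>UNIV. \<Sum>a\<in>UNIV. \<Sum>d\<in>UNIV. euclidean_normal x $ k * X x $ a * Qrem a d x $ k $ d) / 2"

text \<open>The part of the divergence of the skew field \<open>U\<close> of
  \<open>einstein_flux_eq\<close> in which \<open>X\<close> is differentiated.\<close>

definition first_order :: "(real^'n \<Rightarrow> real^'n) \<Rightarrow> 'n \<Rightarrow> real^'n \<Rightarrow> real" where
  "first_order X k x = (\<Sum>a\<in>UNIV. partial a (\<lambda>x. X x $ k) x * Wpot a x)
     - (\<Sum>a\<in>UNIV. partial a (\<lambda>x. X x $ a) x) * Wpot k x
     + (\<Sum>a\<in>UNIV. \<Sum>i\<in>UNIV. partial a (\<lambda>x. X x $ i) x * Apot i x $ k $ a)"

lemma continuous_quad: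
  assumes "\<And>k. continuous_on E (\<lambda>x. X x $ k)"
  shows "continuous_on E (quad X)"
  unfolding quad_def[abs_def]
  by (intro continuous_intros assms continuous_euclidean_normal continuous_Qrem) simp_all

lemma continuous_first_order:
  assumes "\<And>k. C1_on (\<lambda>x. X x $ k) E"
  shows "continuous_on E (first_order X k)"
  unfolding first_order_def[abs_def]
  by (intro continuous_intros C1D(2)[OF assms] C1D(3)[OF C1_Wpot] C1D(3)[OF C1_Apot])

lemma decay_quad:
  assumes "\<And>k. decay \<delta> a s (\<lambda>x. X x $ k)"
  shows "decay \<delta> (2 * \<tau> + 2 + a) (- s) (quad X)"
proof -
  have nX: "decay \<delta> a (- s) (\<lambda>x. euclidean_normal x $ k * X x $ j)" for k j
    using decay_mult[OF decay_euclidean_normal assms] by simp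
  have xn: "decay \<delta> a (- s) (\<lambda>x. X x $ j * euclidean_normal x $ k)" for k j
    using decay_mult[OF assms decay_euclidean_normal] by simp
  have 1: "decay \<delta> a (- s) (\<lambda>x. \<Sum>k\<in>UNIV. X x $ k * euclidean_normal x $ k)"
    by (intro decay_sum xn)
  have 2: "decay \<delta> (2 * \<tau> + 2) 1 (\<lambda>x. \<Sum>a\<in>UNIV. \<Sum>d\<in>UNIV. Qrem a d x $ a $ d)"
    by (intro decay_sum decay_Qrem)
  have "decay \<delta> (2 * \<tau> + 2 + a) (- s) (\<lambda>x. (\<Sum>k\<in>UNIV. X x $ k * euclidean_normal x $ k) * (\<Sum>a\<in>UNIV. \<Sum>d\<in>UNIV. Qrem a d x $ a $ d))"
    using decay_mult[OF 1 2] by (simp add: algebra_simps)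
  moreover have "decay \<delta> (2 * \<tau> + 2 + a) (- s) (\<lambda>x. euclidean_normal x $ k * X x $ a' * Qrem a' d x $ k $ d)" for k a' d
    using decay_mult[OF nX[of k a'] decay_Qrem[of a' d k d]] by (simp add: algebra_simps)
  then have "decay \<delta> (2 * \<tau> + 2 + a) (- s) (\<lambda>x. \<Sum>k\<in>UNIV. \<Sum>a\<in>UNIV. \<Sum>d\<in>UNIV. euclidean_normal x $ k * X x $ a * Qrem a d x $ k $ d)"
    by (intro decay_sum)
  ultimately have "decay \<delta> (2 * \<tau> + 2 + a) (- s) (\<lambda>x. - (1/4) * ((\<Sum>k\<in>UNIV. X x $ k * euclidean_normal x $ k) * (\<Sum>a\<in>UNIV. \<Sum>d\<in>UNIV. Qrem a d x $ a $ d))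
     + 1/2 * (\<Sum>k\<in>UNIV. \<Sum>a\<in>UNIV. \<Sum>d\<in>UNIV. euclidean_normal x $ k * X x $ a * Qrem a d x $ k $ d))"
    by (intro decay_add decay_cmult)
  moreover have "quad X = (\<lambda>x. - (1/4) * ((\<Sum>k\<in>UNIV. X x $ k * euclidean_normal x $ k) * (\<Sum>a\<in>UNIV. \<Sum>d\<in>UNIV. Qrem a d x $ a $ d))
     + 1/2 * (\<Sum>k\<in>UNIV. \<Sum>a\<in>UNIV. \<Sum>d\<in>UNIV. euclidean_normal x $ k * X x $ a * Qrem a d x $ k $ d))"
    by (simp add: fun_eq_iff quad_def)
  ultimately show ?thesis by (simp only:)
qed

text \<open>The second derivatives enter the flux of the Einstein tensor through the divergence of the
  skew field \<open>U\<close>, which integrates to zero over the sphere.\<close>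

lemma einstein_flux_eq:
  assumes X: "\<And>k. C1_on (\<lambda>x. X x $ k) E" and r: "R0 < r"
  shows "einstein_flux G X r =
    sphere_integral r (\<lambda>x. 1/2 * (\<Sum>k\<in>UNIV. euclidean_normal x $ k * first_order X k x) + quad X x)"
proof -
  have r0: "r > 0" using r R0 by simp
  \<comment> \<open>The three terms are dictated by the bracket in
    \<open>einstein_divergence\<close>, which they reproduce when the derivative falls on the
    potentials.\<close>
  define U where "U k a x = X x $ k * Wpot a x - X x $ a * Wpot k x + (\<Sum>i\<in>UNIV. X x $ i * Apot i x $ k $ a)" for k a x
  have C1U: "C1_on (U k a) E" for k a
    unfolding U_def[abs_def] by (intro C1_add C1_diff C1_mult C1_sum X C1_Wpot C1_Apot)
  have anti: "U k a x = - U a k x" for k a x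
  proof -
    have "(\<Sum>i\<in>UNIV. X x $ i * Apot i x $ k $ a) = (\<Sum>i\<in>UNIV. - (X x $ i * Apot i x $ a $ k))"
      using Apot_antisym[of _ x k a] by (intro sum.cong) auto
    then show ?thesis by (simp add: U_def sum_negf)
  qed
  have pt: "X x \<bullet> (einstein G x *v outer_normal G x) * area_density G x
     = - inverse (2 * r) * (\<Sum>k\<in>UNIV. \<Sum>a\<in>UNIV. x $ k * partial a (U k a) x)
       + (1/2 * (\<Sum>k\<in>UNIV. euclidean_normal x $ k * first_order X k x) + quad X x)" if nx: "norm x = r" for x
  proof -
    have x: "x \<in> E" using nx r by simp
    have x0: "x \<noteq> 0" using nx r0 by auto
    define P where "P k = X x $ k * (\<Sum>a\<in>UNIV. \<Sum>d\<in>UNIV. dmat a (Apot d) x $ a $ d)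
         - (\<Sum>a\<in>UNIV. \<Sum>d\<in>UNIV. X x $ a * dmat a (Apot d) x $ k $ d)
         + (\<Sum>a\<in>UNIV. \<Sum>d\<in>UNIV. X x $ a * dmat d (Apot a) x $ k $ d)" for k
    note dX = C1D(1)[OF X x] and dW = C1D(1)[OF C1_Wpot x] and dA = C1D(1)[OF C1_Apot x]
    have pU: "partial a (U k a) x = partial a (\<lambda>x. X x $ k) x * Wpot a x + X x $ k * partial a (Wpot a) x
       - (partial a (\<lambda>x. X x $ a) x * Wpot k x + X x $ a * partial a (Wpot k) x)
       + (\<Sum>i\<in>UNIV. partial a (\<lambda>x. X x $ i) x * Apot i x $ k $ a + X x $ i * dmat a (Apot i) x $ k $ a)" for k a
      unfolding U_def[abs_def]
      by (simp add: partial_add partial_diff partial_mult partial_sum dX dW dA partial_Apot)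
    have sU: "(\<Sum>a\<in>UNIV. partial a (U k a) x) = P k + first_order X k x" for k
    proof -
      have "(\<Sum>a\<in>UNIV. \<Sum>i\<in>UNIV. X x $ i * dmat a (Apot i) x $ k $ a) = (\<Sum>a\<in>UNIV. \<Sum>d\<in>UNIV. X x $ a * dmat d (Apot a) x $ k $ d)"
        by (rule sum.swap)
      then show ?thesis
        unfolding pU P_def first_order_def partial_Wpot[OF x]
        by (simp add: sum.distrib sum_subtractf sum_distrib_left sum_distrib_right)
    qed
    have N: "area_density G x *\<^sub>R outer_normal G x = wt x *\<^sub>R (matrix_inv (G x) *v euclidean_normal x)"
      using conormal_density[of G x, OF spd x0] x by (simp add: wt_def)
    have "X x \<bullet> (einstein G x *v outer_normal G x) * area_density G x = X x \<bullet> (einstein G x *v (area_density G x *\<^sub>R outer_normal G x))"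
      by (simp add: matrix_vector_mult_scaleR)
    also have "\<dots> = wt x * (X x \<bullet> (einstein G x *v (matrix_inv (G x) *v euclidean_normal x)))"
      unfolding N by (simp add: matrix_vector_mult_scaleR)
    also have "\<dots> = - (\<Sum>k\<in>UNIV. euclidean_normal x $ k * P k) / 2 + quad X x"
    proof -
      have "X x \<bullet> euclidean_normal x = (\<Sum>k\<in>UNIV. X x $ k * euclidean_normal x $ k)" by (simp add: inner_vec_def)
      then show ?thesis
        unfolding einstein_divergence[OF x] P_def quad_def by simp
    qed
    also have "(\<Sum>k\<in>UNIV. euclidean_normal x $ k * P k) =
       (\<Sum>k\<in>UNIV. euclidean_normal x $ k * (\<Sum>a\<in>UNIV. partial a (U k a) x)) - (\<Sum>k\<in>UNIV. euclidean_normal x $ k * first_order X k x)"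
      unfolding sU by (simp add: distrib_left sum.distrib)
    also have "(\<Sum>k\<in>UNIV. euclidean_normal x $ k * (\<Sum>a\<in>UNIV. partial a (U k a) x)) = inverse r * (\<Sum>k\<in>UNIV. \<Sum>a\<in>UNIV. x $ k * partial a (U k a) x)"
      unfolding euclidean_normal_eq[OF nx] sum_distrib_left by (simp add: mult.assoc)
    finally show ?thesis by (simp add: field_simps)
  qed
  have c1: "continuous_on (sphere 0 r) (\<lambda>x. \<Sum>k\<in>UNIV. \<Sum>a\<in>UNIV. x $ k * partial a (U k a) x)"
    by (intro continuous_on_sphere_E[OF _ r] continuous_intros C1D(2)[OF C1U])
  have c2: "continuous_on (sphere 0 r) (\<lambda>x. 1/2 * (\<Sum>k\<in>UNIV. euclidean_normal x $ k * first_order X k x) + quad X x)"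
    by (intro continuous_on_sphere_E[OF _ r] continuous_intros continuous_euclidean_normal continuous_first_order continuous_quad X C1D(3)[OF X])
  have "einstein_flux G X r = sphere_integral r (\<lambda>x. - inverse (2 * r) * (\<Sum>k\<in>UNIV. \<Sum>a\<in>UNIV. x $ k * partial a (U k a) x)
       + (1/2 * (\<Sum>k\<in>UNIV. euclidean_normal x $ k * first_order X k x) + quad X x))"
    unfolding einstein_flux_def by (rule sphere_integral_cong) (rule pt)
  also have "\<dots> = - inverse (2 * r) * sphere_integral r (\<lambda>x. \<Sum>k\<in>UNIV. \<Sum>a\<in>UNIV. x $ k * partial a (U k a) x)
       + sphere_integral r (\<lambda>x. 1/2 * (\<Sum>k\<in>UNIV. euclidean_normal x $ k * first_order X k x) + quad X x)"
    by (simp only: sphere_integral_add[OF r0 continuous_on_mult_left[OF c1] c2] sphere_integral_cmult[OF r0 c1])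
  also have "sphere_integral r (\<lambda>x. \<Sum>k\<in>UNIV. \<Sum>a\<in>UNIV. x $ k * partial a (U k a) x) = 0"
    by (rule sphere_integral_antisym_divergence[OF r0 C1U sphere_subset_E[OF r] open_S anti])
  finally show ?thesis by simp
qed

text \<open>The derivative of the field is the identity, and the three terms contribute 1, - n and
  1.\<close>

lemma first_order_radial:
  "first_order (\<lambda>x. x) k x = (2 - real CARD('n)) * Wpot k x"
proof -
  have "(\<Sum>a\<in>UNIV. partial a (\<lambda>x. x $ k) x * Wpot a x) = Wpot k x"
    by (simp add: partial_coord if_distrib[of "\<lambda>a. a * _"] cong: if_cong)
  moreover have "(\<Sum>a\<in>UNIV. \<Sum>i\<in>UNIV. partial a (\<lambda>x. x $ i) x * Apot i x $ k $ a) = Wpot k x"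
    by (simp add: partial_coord if_distrib[of "\<lambda>a. a * _"] Wpot_def cong: if_cong)
  ultimately show ?thesis
    by (simp add: first_order_def partial_coord algebra_simps)
qed

lemma sphere_integral_tendsto_0_bigo:
  assumes "continuous_on E f" "f \<in> O[at_infinity](\<lambda>x. norm x powr (- a))" "a > real CARD('n) - 1"
  shows "((\<lambda>r. sphere_integral r f) \<longlongrightarrow> 0) at_top"
  using sphere_integral_tendsto_0[OF R0 assms(1) decay_0I[OF assms(2)]] assms(3) by simp

text \<open>The coefficient combines the 2 - n of \<open>first_order_radial\<close> with the 1/2 of
  \<open>einstein_flux_eq\<close>. Replacing \<open>Wpot\<close> by \<open>Vlin\<close> costs order
  2 \<tau> + 1, the same as the quadratic remainder.\<close>

lemma ricci_mass_flux_asymp: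
  assumes a: "2 * \<tau> + 1 > real CARD('n) - 1"
  shows "((\<lambda>r. ricci_mass_flux G r + (real CARD('n) - 2) / 2 * mass_flux G r) \<longlongrightarrow> 0) at_top"
proof -
  define c where "c = (2 - real CARD('n)) / 2"
  define f where "f x = c * (\<Sum>k\<in>UNIV. (Wpot k x - Vlin k x) * euclidean_normal x $ k) + quad (\<lambda>x. x) x" for x
  have "decay \<delta> (2 * \<tau> + 1) 1 (\<lambda>x. (Wpot k x - Vlin k x) * euclidean_normal x $ k)" for k
    using decay_mult[OF decay_Wpot decay_euclidean_normal] by simp
  moreover have "decay \<delta> (2 * \<tau> + 1) 1 (quad (\<lambda>x. x))"
    using decay_quad[of "-1" "-1" "\<lambda>x. x", OF decay_coord] by (simp add: algebra_simps)
  ultimately have "decay \<delta> (2 * \<tau> + 1) 1 f"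
    unfolding f_def[abs_def] by (intro decay_add decay_cmult decay_sum)
  moreover have "continuous_on E f"
    unfolding f_def[abs_def]
    by (intro continuous_intros C1D(3)[OF C1_Wpot] continuous_Vlin continuous_euclidean_normal continuous_quad)
  ultimately have lim: "((\<lambda>r. sphere_integral r f) \<longlongrightarrow> 0) at_top"
    using a by (intro sphere_integral_tendsto_0_bigo[where a = "2 * \<tau> + 1"]) (auto simp: decay_def)
  have "sphere_integral r f = ricci_mass_flux G r + (real CARD('n) - 2) / 2 * mass_flux G r" if r: "R0 < r" for r
  proof -
    have r0: "r > 0" using r R0 by simp
    have cs: "continuous_on (sphere 0 r) (\<lambda>x. c * (\<Sum>k\<in>UNIV. Wpot k x * euclidean_normal x $ k) + quad (\<lambda>x. x) x)"
      "continuous_on (sphere 0 r) (\<lambda>x. \<Sum>k\<in>UNIV. Vlin k x * euclidean_normal x $ k)"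
      by (intro continuous_on_sphere_E[OF _ r] continuous_intros C1D(3)[OF C1_Wpot] continuous_Vlin continuous_euclidean_normal continuous_quad)+
    have "f = (\<lambda>x. (c * (\<Sum>k\<in>UNIV. Wpot k x * euclidean_normal x $ k) + quad (\<lambda>x. x) x) - c * (\<Sum>k\<in>UNIV. Vlin k x * euclidean_normal x $ k))"
      by (simp add: fun_eq_iff f_def left_diff_distrib sum_subtractf right_diff_distrib)
    then have "sphere_integral r f = sphere_integral r (\<lambda>x. c * (\<Sum>k\<in>UNIV. Wpot k x * euclidean_normal x $ k) + quad (\<lambda>x. x) x) - c * mass_flux G r"
      using sphere_integral_diff[OF r0 cs(1) continuous_on_mult_left[OF cs(2), of c]]
      by (simp only: sphere_integral_cmult[OF r0 cs(2)] mass_flux_eq[OF r])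
    moreover have "ricci_mass_flux G r = sphere_integral r (\<lambda>x. c * (\<Sum>k\<in>UNIV. Wpot k x * euclidean_normal x $ k) + quad (\<lambda>x. x) x)"
    proof -
      have "1/2 * (\<Sum>k\<in>UNIV. euclidean_normal x $ k * first_order (\<lambda>x. x) k x) = c * (\<Sum>k\<in>UNIV. Wpot k x * euclidean_normal x $ k)" for x
        by (simp add: first_order_radial c_def sum_distrib_left mult_ac)
      then show ?thesis
        unfolding ricci_mass_flux_def by (subst einstein_flux_eq[OF C1_coord r]) simp
    qed
    ultimately show ?thesis by (simp add: c_def field_simps)
  qed
  then show ?thesis
    by (intro Lim_transform_eventually[OF lim] eventually_mono[OF eventually_gt_at_top[of R0]])
qed

text \<open>Convergence is shown for the flux of \<open>Wpot\<close>, whose divergence is known from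
  \<open>scal_divergence\<close>; this comparison carries it over to the classical flux.\<close>

lemma Wflux_asymp:
  assumes a: "2 * \<tau> + 1 > real CARD('n) - 1"
  shows "((\<lambda>r. sphere_integral r (\<lambda>x. \<Sum>k\<in>UNIV. Wpot k x * euclidean_normal x $ k) - mass_flux G r) \<longlongrightarrow> 0) at_top"
proof -
  define f where "f x = (\<Sum>k\<in>UNIV. (Wpot k x - Vlin k x) * euclidean_normal x $ k)" for x
  have "decay \<delta> (2 * \<tau> + 1) 1 (\<lambda>x. (Wpot k x - Vlin k x) * euclidean_normal x $ k)" for k
    using decay_mult[OF decay_Wpot decay_euclidean_normal] by simp
  then have "decay \<delta> (2 * \<tau> + 1) 1 f" unfolding f_def[abs_def] by (rule decay_sum)
  moreover have "continuous_on E f"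
    unfolding f_def[abs_def]
    by (intro continuous_intros C1D(3)[OF C1_Wpot] continuous_Vlin continuous_euclidean_normal)
  ultimately have lim: "((\<lambda>r. sphere_integral r f) \<longlongrightarrow> 0) at_top"
    using a by (intro sphere_integral_tendsto_0_bigo[where a = "2 * \<tau> + 1"]) (auto simp: decay_def)
  have "sphere_integral r f = sphere_integral r (\<lambda>x. \<Sum>k\<in>UNIV. Wpot k x * euclidean_normal x $ k) - mass_flux G r" if r: "R0 < r" for r
  proof -
    have r0: "r > 0" using r R0 by simp
    have "continuous_on (sphere 0 r) (\<lambda>x. \<Sum>k\<in>UNIV. Wpot k x * euclidean_normal x $ k)"
      "continuous_on (sphere 0 r) (\<lambda>x. \<Sum>k\<in>UNIV. Vlin k x * euclidean_normal x $ k)"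
      by (intro continuous_on_sphere_E[OF _ r] continuous_intros C1D(3)[OF C1_Wpot] continuous_Vlin continuous_euclidean_normal)+
    from sphere_integral_diff[OF r0 this] show ?thesis
      by (simp add: f_def[abs_def] left_diff_distrib sum_subtractf mass_flux_eq[OF r])
  qed
  then show ?thesis
    by (intro Lim_transform_eventually[OF lim] eventually_mono[OF eventually_gt_at_top[of R0]])
qed

lemma mass_flux_converges:
  assumes a: "2 * \<tau> + 2 > real CARD('n)"
    and int: "(\<integral>\<^sup>+x. indicator E x * ennreal \<bar>wt x * scal G x\<bar> \<partial>lborel) < \<infinity>"
  shows "\<exists>l. (mass_flux G \<longlongrightarrow> l) at_top"
proof -
  \<comment> \<open>The quadratic term of \<open>scal_divergence\<close>, moved to the side of the
    divergence; its order 2 \<tau> + 2 exceeds n, so it is integrable at infinity.\<close>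
  define Q where "Q x = - (1/2) * (\<Sum>a\<in>UNIV. \<Sum>d\<in>UNIV. Qrem a d x $ a $ d)" for x
  have "decay \<delta> (2 * \<tau> + 2) 1 Q"
    unfolding Q_def[abs_def] by (intro decay_cmult decay_sum decay_Qrem)
  then obtain C where "eventually (\<lambda>x. norm (Q x) \<le> C * norm (norm x powr (- (2 * \<tau> + 2)))) at_infinity"
    unfolding decay_def bigo_def by auto
  then obtain R1 where R1: "\<And>x. R1 \<le> norm x \<Longrightarrow> \<bar>Q x\<bar> \<le> C * norm x powr (- (2 * \<tau> + 2))"
    by (auto simp: eventually_at_infinity)
  define R where "R = max R0 R1"
  have R: "R0 \<le> R" "R1 \<le> R" "R > 0" using R0 by (auto simp: R_def)
  have sub: "{x. R < norm x} \<subseteq> E" using R by auto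
  have "\<exists>l. ((\<lambda>r. sphere_integral r (\<lambda>x. \<Sum>k\<in>UNIV. Wpot k x * euclidean_normal x $ k)) \<longlongrightarrow> l) at_top"
  proof (rule flux_converges[OF R(3)])
    show "continuous_on {x. R < norm x} (\<lambda>x. wt x * scal G x)"
      by (intro continuous_on_subset[OF _ sub] continuous_on_mult C1D(3)[OF C1_wt] continuous_scal)
    show "continuous_on {x. R < norm x} Q"
      unfolding Q_def[abs_def] by (intro continuous_on_subset[OF _ sub] continuous_intros continuous_Qrem)
    have "(\<integral>\<^sup>+x. indicator {x. R < norm x} x * ennreal \<bar>wt x * scal G x\<bar> \<partial>lborel) \<le> (\<integral>\<^sup>+x. indicator E x * ennreal \<bar>wt x * scal G x\<bar> \<partial>lborel)"
      using sub by (intro nn_integral_mono mult_right_mono) (auto simp: indicator_def)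
    then show "(\<integral>\<^sup>+x. indicator {x. R < norm x} x * ennreal \<bar>wt x * scal G x\<bar> \<partial>lborel) < \<infinity>"
      using int by (rule le_less_trans)
    show "\<bar>Q x\<bar> \<le> C * norm x powr - (2 * \<tau> + 2)" if "R < norm x" for x using R1 R that by simp
    show "real CARD('n) < 2 * \<tau> + 2" by (rule a)
    fix r assume r: "R < r"
    have "((\<lambda>\<rho>. sphere_integral \<rho> (\<lambda>x. \<Sum>k\<in>UNIV. Wpot k x * euclidean_normal x $ k)) has_real_derivative
       sphere_integral r (\<lambda>x. \<Sum>k\<in>UNIV. partial k (Wpot k) x)) (at r)"
      by (rule sphere_flux_derivative[of R0]) (use R0 r R C1_Wpot in auto)
    also have "sphere_integral r (\<lambda>x. \<Sum>k\<in>UNIV. partial k (Wpot k) x) = sphere_integral r (\<lambda>x. wt x * scal G x + Q x)"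
    proof (rule sphere_integral_cong)
      fix x :: "real^'n" assume "norm x = r"
      then have x: "x \<in> E" using r R by simp
      show "(\<Sum>k\<in>UNIV. partial k (Wpot k) x) = wt x * scal G x + Q x"
        by (simp add: partial_Wpot[OF x] scal_divergence[OF x] Q_def)
    qed
    finally show "((\<lambda>\<rho>. sphere_integral \<rho> (\<lambda>x. \<Sum>k\<in>UNIV. Wpot k x * euclidean_normal x $ k)) has_real_derivative
       sphere_integral r (\<lambda>x. wt x * scal G x + Q x)) (at r)" .
  qed
  then obtain l where "((\<lambda>r. sphere_integral r (\<lambda>x. \<Sum>k\<in>UNIV. Wpot k x * euclidean_normal x $ k)) \<longlongrightarrow> l) at_top" by blast
  from tendsto_diff[OF this Wflux_asymp] a show ?thesis by auto
qed

section \<open>The center of mass\<close>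

text \<open>The generator of special conformal transformations in direction
  \<open>\<alpha>\<close>.\<close>

definition conformal_field :: "'n \<Rightarrow> real^'n \<Rightarrow> real^'n" where
  "conformal_field \<alpha> x = (norm x)\<^sup>2 *\<^sub>R axis \<alpha> 1 - (2 * x $ \<alpha>) *\<^sub>R x"

lemma conformal_field_nth: "(\<lambda>x. conformal_field \<alpha> x $ k) = (\<lambda>x. (if k = \<alpha> then 1 else 0) * (\<Sum>m\<in>UNIV. x $ m * x $ m) - 2 * (x $ \<alpha> * x $ k))"
  by (auto simp: fun_eq_iff conformal_field_def axis_def power2_norm_eq_inner inner_vec_def)

lemma C1_conformal_field: "C1_on (\<lambda>x. conformal_field \<alpha> x $ k) S"
  unfolding conformal_field_nth by (intro C1_diff C1_mult C1_sum C1_const C1_coord)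

lemma decay_conformal_field: "decay \<delta> (-2) 1 (\<lambda>x. conformal_field \<alpha> x $ k)"
proof -
  have "decay \<delta> (-2) 1 (\<lambda>x::real^'n. x $ i * x $ j)" for i j
    using decay_mult[OF decay_coord decay_coord, of \<delta> i j] by simp
  then show ?thesis
    unfolding conformal_field_nth by (intro decay_diff decay_cmult decay_sum)
qed

lemma partial_conformal_field: "partial a (\<lambda>x. conformal_field \<alpha> x $ k) x =
  (if k = \<alpha> then 2 * x $ a else 0) - (if a = \<alpha> then 2 * x $ k else 0) - (if a = k then 2 * x $ \<alpha> else 0)"
proof -
  have "partial a (\<lambda>x. \<Sum>m\<in>UNIV. x $ m * x $ m) x = 2 * x $ a"
    by (simp add: partial_sum partial_mult partial_coord sum.distrib if_distrib[of "\<lambda>t. _ * t"] if_distrib[of "\<lambda>t. t * _"] cong: if_cong)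
  moreover have "partial a (\<lambda>x. x $ \<alpha> * x $ k) x = (if a = \<alpha> then x $ k else 0) + (if a = k then x $ \<alpha> else 0)"
    by (simp add: partial_mult partial_coord)
  ultimately show ?thesis
    unfolding conformal_field_nth by (subst partial_diff) (auto simp: partial_cmult)
qed

text \<open>The derivative of the field is an infinitesimal rotation plus -2 x_\<alpha> times the
  identity. The identity part contributes as in the radial case, which explains -2 x_\<alpha> (2 -
  n) = (2 n - 4) x_\<alpha>; the other terms come from the rotation.\<close>

lemma first_order_conformal_field:
  "first_order (conformal_field \<alpha>) k x = (if k = \<alpha> then 2 * (\<Sum>a\<in>UNIV. x $ a * Wpot a x) else 0) - 2 * x $ k * Wpot \<alpha> x
     + (2 * real CARD('n) - 4) * x $ \<alpha> * Wpot k x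
     + 2 * (\<Sum>a\<in>UNIV. x $ a * Apot \<alpha> x $ k $ a) - 2 * (\<Sum>i\<in>UNIV. x $ i * Apot i x $ k $ \<alpha>)"
proof -
  have 1: "(\<Sum>a\<in>UNIV. partial a (\<lambda>x. conformal_field \<alpha> x $ k) x * Wpot a x)
     = (if k = \<alpha> then 2 * (\<Sum>a\<in>UNIV. x $ a * Wpot a x) else 0) - 2 * x $ k * Wpot \<alpha> x - 2 * x $ \<alpha> * Wpot k x"
    by (simp add: partial_conformal_field left_diff_distrib sum_subtractf sum_distrib_left mult.assoc if_distrib[of "\<lambda>t. t * _"] cong: if_cong)
  have 2: "(\<Sum>a\<in>UNIV. partial a (\<lambda>x. conformal_field \<alpha> x $ a) x) = - 2 * real CARD('n) * x $ \<alpha>"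
    by (simp add: partial_conformal_field sum_subtractf)
  have "(\<Sum>i\<in>UNIV. partial a (\<lambda>x. conformal_field \<alpha> x $ i) x * Apot i x $ k $ a)
     = 2 * (x $ a * Apot \<alpha> x $ k $ a) - (if a = \<alpha> then 2 * (\<Sum>i\<in>UNIV. x $ i * Apot i x $ k $ \<alpha>) else 0) - 2 * x $ \<alpha> * Apot a x $ k $ a" for a
    by (simp add: partial_conformal_field left_diff_distrib sum_subtractf sum_distrib_left mult.assoc if_distrib[of "\<lambda>t. t * _"] cong: if_cong)
  then have 3: "(\<Sum>a\<in>UNIV. \<Sum>i\<in>UNIV. partial a (\<lambda>x. conformal_field \<alpha> x $ i) x * Apot i x $ k $ a)
     = 2 * (\<Sum>a\<in>UNIV. x $ a * Apot \<alpha> x $ k $ a) - 2 * (\<Sum>i\<in>UNIV. x $ i * Apot i x $ k $ \<alpha>) - 2 * x $ \<alpha> * Wpot k x"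
    by (simp add: sum_subtractf Wpot_def sum_distrib_left)
  show ?thesis
    unfolding first_order_def 1 2 3 by (simp add: algebra_simps)
qed

lemma flux_density_conformal_field:
  assumes nx: "norm x = r" and r: "r > 0"
  shows "1/2 * (\<Sum>k\<in>UNIV. euclidean_normal x $ k * first_order (conformal_field \<alpha>) k x) =
    (real CARD('n) - 1) * (x $ \<alpha> * (\<Sum>k\<in>UNIV. Wpot k x * euclidean_normal x $ k)) - norm x * Wpot \<alpha> x
    - (\<Sum>k\<in>UNIV. \<Sum>i\<in>UNIV. euclidean_normal x $ k * x $ i * Apot i x $ k $ \<alpha>)"
proof -
  define xW where "xW = (\<Sum>a\<in>UNIV. x $ a * Wpot a x)"
  define xA where "xA = (\<Sum>k\<in>UNIV. x $ k * (\<Sum>i\<in>UNIV. x $ i * Apot i x $ k $ \<alpha>))"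
  \<comment> \<open>A skew matrix contracted twice with \<open>x\<close>.\<close>
  have z: "(\<Sum>k\<in>UNIV. x $ k * (\<Sum>a\<in>UNIV. x $ a * Apot \<alpha> x $ k $ a)) = 0"
  proof -
    have "(\<Sum>k\<in>UNIV. \<Sum>a\<in>UNIV. x $ k * (x $ a * Apot \<alpha> x $ k $ a)) = (\<Sum>k\<in>UNIV. \<Sum>a\<in>UNIV. - (x $ a * (x $ k * Apot \<alpha> x $ a $ k)))"
    proof (intro sum.cong refl)
      fix k a show "x $ k * (x $ a * Apot \<alpha> x $ k $ a) = - (x $ a * (x $ k * Apot \<alpha> x $ a $ k))"
        using Apot_antisym[of \<alpha> x k a] by simp
    qed
    also have "\<dots> = - (\<Sum>k\<in>UNIV. \<Sum>a\<in>UNIV. x $ k * (x $ a * Apot \<alpha> x $ k $ a))"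
      by (subst sum.swap) (simp add: sum_negf)
    finally show ?thesis by (simp add: sum_distrib_left)
  qed
  have rr: "(\<Sum>k\<in>UNIV. x $ k * x $ k) = r * r"
    using dot_square_norm[of x] nx by (simp add: inner_vec_def power2_eq_square)
  have t1: "(\<Sum>k\<in>UNIV. x $ k * (if k = \<alpha> then 2 * xW else 0)) = 2 * (x $ \<alpha> * xW)"
    by (simp add: if_distrib[of "\<lambda>t. _ * t"] cong: if_cong)
  have t2: "(\<Sum>k\<in>UNIV. x $ k * (2 * x $ k * Wpot \<alpha> x)) = 2 * (r * r * Wpot \<alpha> x)"
    unfolding rr[symmetric] by (simp add: sum_distrib_left sum_distrib_right mult_ac)
  have t3: "(\<Sum>k\<in>UNIV. x $ k * ((2 * real CARD('n) - 4) * x $ \<alpha> * Wpot k x)) = (2 * real CARD('n) - 4) * (x $ \<alpha> * xW)"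
    unfolding xW_def by (simp add: sum_distrib_left mult_ac)
  have t4: "(\<Sum>k\<in>UNIV. x $ k * (2 * (\<Sum>a\<in>UNIV. x $ a * Apot \<alpha> x $ k $ a))) = 0"
    using z by (simp add: mult.left_commute[of _ 2] flip: sum_distrib_left)
  have t5: "(\<Sum>k\<in>UNIV. x $ k * (2 * (\<Sum>i\<in>UNIV. x $ i * Apot i x $ k $ \<alpha>))) = 2 * xA"
    unfolding xA_def by (simp add: mult.left_commute[of _ 2] flip: sum_distrib_left)
  \<comment> \<open>The coefficient 2 n - 2 is the sum of 2 n - 4 from the dilation part
    (\<open>t3\<close>) and 2 from the rotation part (\<open>t1\<close>).\<close>
  have T: "(\<Sum>k\<in>UNIV. x $ k * first_order (conformal_field \<alpha>) k x) = (2 * real CARD('n) - 2) * (x $ \<alpha> * xW) - 2 * (r * r * Wpot \<alpha> x) - 2 * xA"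
    unfolding first_order_conformal_field xW_def[symmetric]
    unfolding distrib_left right_diff_distrib sum.distrib sum_subtractf
    using t1 t2 t3 t4 t5 by (simp add: algebra_simps)
  have e1: "(\<Sum>k\<in>UNIV. euclidean_normal x $ k * first_order (conformal_field \<alpha>) k x) = inverse r * (\<Sum>k\<in>UNIV. x $ k * first_order (conformal_field \<alpha>) k x)"
    unfolding euclidean_normal_eq[OF nx] sum_distrib_left by (simp add: mult.assoc)
  have e2: "(\<Sum>k\<in>UNIV. Wpot k x * euclidean_normal x $ k) = inverse r * xW"
    unfolding euclidean_normal_eq[OF nx] xW_def sum_distrib_left by (simp add: mult_ac)
  have e3: "(\<Sum>k\<in>UNIV. \<Sum>i\<in>UNIV. euclidean_normal x $ k * x $ i * Apot i x $ k $ \<alpha>) = inverse r * xA"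
    unfolding euclidean_normal_eq[OF nx] xA_def sum_distrib_left by (simp add: mult.assoc)
  show ?thesis unfolding e1 e2 e3 T nx using r by (simp add: field_simps)
qed

definition hpert :: "'n \<Rightarrow> 'n \<Rightarrow> real^'n \<Rightarrow> real" where
  "hpert i j x = G x $ i $ j - mat 1 $ i $ j"

definition htrace :: "real^'n \<Rightarrow> real" where
  "htrace x = (\<Sum>d\<in>UNIV. hpert d d x)"

lemma C1_hpert: "C1_on (hpert i j) E"
  unfolding hpert_def[abs_def] by (intro C1_diff C1_G C1_const)

lemma C1_htrace: "C1_on htrace E"
  unfolding htrace_def[abs_def] by (intro C1_sum C1_hpert)

lemma partial_hpert: "x \<in> E \<Longrightarrow> partial a (hpert i j) x = partial a (\<lambda>x. G x $ i $ j) x"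
  unfolding hpert_def[abs_def] by (subst partial_diff) (use C1D(1)[OF C1_G] in auto)

lemma hpert_sym: "x \<in> E \<Longrightarrow> hpert i j x = hpert j i x"
  using transpose_G[of x] unfolding hpert_def by (metis transpose_component transpose_mat)

text \<open>Positive and negative terms are paired with a common factor \<open>x $ k\<close>, so
  that every bracket differentiates along a rotation field and can be integrated by parts on the
  sphere.\<close>

lemma center_linear_density:
  assumes x: "x \<in> E" and nx: "norm x = r" and r: "r > 0"
  shows "x $ \<alpha> * (\<Sum>k\<in>UNIV. Vlin k x * euclidean_normal x $ k) - norm x * Vlin \<alpha> x
      - (\<Sum>k\<in>UNIV. \<Sum>i\<in>UNIV. euclidean_normal x $ k * x $ i * Alin i k \<alpha> x)
    = inverse r * ((\<Sum>k\<in>UNIV. \<Sum>d\<in>UNIV. x $ k * (x $ \<alpha> * partial d (hpert d k) x - x $ d * partial \<alpha> (hpert d k) x))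
      + (\<Sum>k\<in>UNIV. \<Sum>d\<in>UNIV. x $ k * (x $ d * partial k (hpert d \<alpha>) x - x $ k * partial d (hpert d \<alpha>) x))
      + (\<Sum>k\<in>UNIV. x $ k * (x $ k * partial \<alpha> htrace x - x $ \<alpha> * partial k htrace x)))"
proof -
  have pT: "partial k htrace x = (\<Sum>d\<in>UNIV. partial k (hpert d d) x)" for k
    unfolding htrace_def[abs_def] by (rule partial_sum) (rule C1D(1)[OF C1_hpert x])
  define Y where "Y k = (\<Sum>d\<in>UNIV. partial d (hpert d k) x)" for k
  have V: "Vlin k x = Y k - partial k htrace x" for k
    by (simp add: Vlin_def Alin_def Y_def pT partial_hpert[OF x] sum_subtractf)
  have A: "Alin i k \<alpha> x = partial \<alpha> (hpert i k) x - partial k (hpert i \<alpha>) x" for i k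
    by (simp add: Alin_def partial_hpert[OF x])
  have rr: "(\<Sum>k\<in>UNIV. x $ k * x $ k) = r * r"
    using dot_square_norm[of x] nx by (simp add: inner_vec_def power2_eq_square)
  have s1: "(\<Sum>k\<in>UNIV. \<Sum>d\<in>UNIV. x $ k * (x $ \<alpha> * partial d (hpert d k) x)) = x $ \<alpha> * (\<Sum>k\<in>UNIV. x $ k * Y k)"
    by (simp add: Y_def sum_distrib_left mult.left_commute)
  have s2: "(\<Sum>k\<in>UNIV. \<Sum>d\<in>UNIV. x $ k * (x $ k * partial d (hpert d \<alpha>) x)) = r * r * Y \<alpha>"
    unfolding rr[symmetric] by (subst sum.swap) (simp add: Y_def sum_distrib_left sum_distrib_right mult.assoc)
  have s3: "(\<Sum>k\<in>UNIV. x $ k * (x $ k * partial \<alpha> htrace x)) = r * r * partial \<alpha> htrace x"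
    unfolding rr[symmetric] by (simp add: sum_distrib_left sum_distrib_right mult.assoc)
  have s4: "(\<Sum>k\<in>UNIV. x $ k * (x $ \<alpha> * partial k htrace x)) = x $ \<alpha> * (\<Sum>k\<in>UNIV. x $ k * partial k htrace x)"
    by (simp add: sum_distrib_left mult.left_commute)
  have l1: "(\<Sum>k\<in>UNIV. Vlin k x * euclidean_normal x $ k) = inverse r * ((\<Sum>k\<in>UNIV. x $ k * Y k) - (\<Sum>k\<in>UNIV. x $ k * partial k htrace x))"
    unfolding euclidean_normal_eq[OF nx] V by (simp add: sum_distrib_left sum_subtractf algebra_simps)
  have l2: "(\<Sum>k\<in>UNIV. \<Sum>i\<in>UNIV. euclidean_normal x $ k * x $ i * Alin i k \<alpha> x)
     = inverse r * ((\<Sum>k\<in>UNIV. \<Sum>d\<in>UNIV. x $ k * (x $ d * partial \<alpha> (hpert d k) x)) - (\<Sum>k\<in>UNIV. \<Sum>d\<in>UNIV. x $ k * (x $ d * partial k (hpert d \<alpha>) x)))"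
    unfolding euclidean_normal_eq[OF nx] A by (simp add: sum_distrib_left sum_subtractf right_diff_distrib mult.assoc)
  have l3: "norm x * Vlin \<alpha> x = inverse r * (r * r * Y \<alpha> - r * r * partial \<alpha> htrace x)"
    using r by (simp add: nx V field_simps)
  show ?thesis
    unfolding l1 l2 l3 right_diff_distrib sum_subtractf s1 s2 s3 s4 by (simp add: algebra_simps)
qed

text \<open>The derivatives combine into rotation fields, which are skew on spheres. Rotating the
  coordinate factors instead produces the terms without derivatives in the classical center.\<close>

lemma center_linear:
  assumes r: "R0 < r"
  shows "sphere_integral r (\<lambda>x. x $ \<alpha> * (\<Sum>k\<in>UNIV. Vlin k x * euclidean_normal x $ k) - norm x * Vlin \<alpha> x
      - (\<Sum>k\<in>UNIV. \<Sum>i\<in>UNIV. euclidean_normal x $ k * x $ i * Alin i k \<alpha> x))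
    = (real CARD('n) - 2) * sphere_integral r (\<lambda>x. htrace x * euclidean_normal x $ \<alpha> - (\<Sum>d\<in>UNIV. hpert \<alpha> d x * euclidean_normal x $ d))"
proof -
  have r0: "r > 0" using r R0 by simp
  note sE = sphere_subset_E[OF r]
  have ch: "continuous_on (sphere 0 r) (hpert i j)" "continuous_on (sphere 0 r) (partial a (hpert i j))"
    "continuous_on (sphere 0 r) htrace" "continuous_on (sphere 0 r) (partial a htrace)" for i j a
    using continuous_on_sphere_C1[OF C1_hpert sE] continuous_on_sphere_C1[OF C1_htrace sE] by auto
  define Z1 where "Z1 k d x = x $ k * (x $ \<alpha> * partial d (hpert d k) x - x $ d * partial \<alpha> (hpert d k) x)" for k d x
  define Z2 where "Z2 k d x = x $ k * (x $ d * partial k (hpert d \<alpha>) x - x $ k * partial d (hpert d \<alpha>) x)" for k d x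
  define Z3 where "Z3 k x = x $ k * (x $ k * partial \<alpha> htrace x - x $ \<alpha> * partial k htrace x)" for k x
  \<comment> \<open>\<open>Y1\<close>, \<open>Y2\<close> and \<open>Y3\<close> are
    \<open>Z1\<close>, \<open>Z2\<close> and \<open>Z3\<close> with the rotation field applied to
    the coordinate factor \<open>x $ k\<close> instead of the metric perturbation.\<close>
  define Y1 where "Y1 k d x = (if d = k then x $ \<alpha> * hpert d k x else 0) - (if k = \<alpha> then x $ d * hpert d \<alpha> x else 0)" for k d x
  define Y2 where "Y2 k d x = x $ d * hpert d \<alpha> x - (if d = k then x $ d * hpert d \<alpha> x else 0)" for k d x
  define Y3 where "Y3 k x = (if k = \<alpha> then x $ \<alpha> * htrace x else 0) - x $ \<alpha> * htrace x" for k x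
  have cZ: "continuous_on (sphere 0 r) (Z1 k d)" "continuous_on (sphere 0 r) (Z2 k d)" "continuous_on (sphere 0 r) (Z3 k)" for k d
    unfolding Z1_def[abs_def] Z2_def[abs_def] Z3_def[abs_def] by (intro continuous_intros ch)+
  have cY: "continuous_on (sphere 0 r) (Y1 k d)" "continuous_on (sphere 0 r) (Y2 k d)" "continuous_on (sphere 0 r) (Y3 k)" for k d
  proof -
    have 1: "continuous_on (sphere 0 r) (\<lambda>x. x $ i * hpert j l x)" "continuous_on (sphere 0 r) (\<lambda>x. x $ i * htrace x)" for i j l
      by (intro continuous_intros ch)+
    have 2: "continuous_on (sphere 0 r) (\<lambda>x. if b then x $ i * hpert j l x else 0)" "continuous_on (sphere 0 r) (\<lambda>x. if b then x $ i * htrace x else 0)" for b i j l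
      by (cases b; simp add: 1)+
    show "continuous_on (sphere 0 r) (Y1 k d)" "continuous_on (sphere 0 r) (Y2 k d)" "continuous_on (sphere 0 r) (Y3 k)"
      unfolding Y1_def[abs_def] Y2_def[abs_def] Y3_def[abs_def] by (intro continuous_on_diff 1 2)+
  qed
  have i1: "sphere_integral r (Z1 k d) = - sphere_integral r (Y1 k d)" for k d
    using sphere_integral_rotation_parts[OF r0 C1_hpert C1_coord sE, of k \<alpha> d d k]
    unfolding Z1_def[abs_def] Y1_def[abs_def]
    by (cases "k = \<alpha>") (auto simp: partial_coord left_diff_distrib if_distrib[of "\<lambda>t. _ * t"] if_distrib[of "\<lambda>t. t * _"] cong: if_cong)
  have i2: "sphere_integral r (Z2 k d) = - sphere_integral r (Y2 k d)" for k d
    using sphere_integral_rotation_parts[OF r0 C1_hpert C1_coord sE, of k d k d \<alpha>]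
    unfolding Z2_def[abs_def] Y2_def[abs_def]
    by (cases "d = k") (auto simp: partial_coord left_diff_distrib)
  have i3: "sphere_integral r (Z3 k) = - sphere_integral r (Y3 k)" for k
    using sphere_integral_rotation_parts[OF r0 C1_htrace C1_coord sE, of k k \<alpha>]
    unfolding Z3_def[abs_def] Y3_def[abs_def]
    by (cases "k = \<alpha>") (auto simp: partial_coord left_diff_distrib)
  have "sphere_integral r (\<lambda>x. (\<Sum>k\<in>UNIV. \<Sum>d\<in>UNIV. Z1 k d x) + (\<Sum>k\<in>UNIV. \<Sum>d\<in>UNIV. Z2 k d x) + (\<Sum>k\<in>UNIV. Z3 k x))
     = - ((\<Sum>k\<in>UNIV. \<Sum>d\<in>UNIV. sphere_integral r (Y1 k d)) + (\<Sum>k\<in>UNIV. \<Sum>d\<in>UNIV. sphere_integral r (Y2 k d)) + (\<Sum>k\<in>UNIV. sphere_integral r (Y3 k)))"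
    by (simp add: sphere_integral_add[OF r0] sphere_integral_sum[OF r0] continuous_on_sum continuous_on_add cZ i1 i2 i3 sum_negf)
  also have "\<dots> = - sphere_integral r (\<lambda>x. (\<Sum>k\<in>UNIV. \<Sum>d\<in>UNIV. Y1 k d x) + (\<Sum>k\<in>UNIV. \<Sum>d\<in>UNIV. Y2 k d x) + (\<Sum>k\<in>UNIV. Y3 k x))"
    by (simp add: sphere_integral_add[OF r0] sphere_integral_sum[OF r0] continuous_on_sum continuous_on_add cY)
  also have "sphere_integral r (\<lambda>x. (\<Sum>k\<in>UNIV. \<Sum>d\<in>UNIV. Y1 k d x) + (\<Sum>k\<in>UNIV. \<Sum>d\<in>UNIV. Y2 k d x) + (\<Sum>k\<in>UNIV. Y3 k x))
     = sphere_integral r (\<lambda>x. - (r * (real CARD('n) - 2)) * (htrace x * euclidean_normal x $ \<alpha> - (\<Sum>d\<in>UNIV. hpert \<alpha> d x * euclidean_normal x $ d)))"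
  proof (rule sphere_integral_cong)
    fix x :: "real^'n" assume nx: "norm x = r"
    then have x: "x \<in> E" using r by simp
    \<comment> \<open>The trace contributes 1 + (1 - n) and the contracted term -1 + (n - 1): this
      is the origin of the factor n - 2.\<close>
    define H where "H = (\<Sum>d\<in>UNIV. x $ d * hpert d \<alpha> x)"
    have y1: "(\<Sum>k\<in>UNIV. \<Sum>d\<in>UNIV. Y1 k d x) = x $ \<alpha> * htrace x - H"
    proof -
      have "(\<Sum>k\<in>UNIV. \<Sum>d\<in>UNIV. if k = \<alpha> then x $ d * hpert d \<alpha> x else 0) = H"
        unfolding H_def by (subst sum.swap) simp
      then show ?thesis by (simp add: Y1_def sum_subtractf htrace_def sum_distrib_left)
    qed
    have y2: "(\<Sum>k\<in>UNIV. \<Sum>d\<in>UNIV. Y2 k d x) = (real CARD('n) - 1) * H"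
      by (simp add: Y2_def sum_subtractf H_def[symmetric] left_diff_distrib)
    have y3: "(\<Sum>k\<in>UNIV. Y3 k x) = (1 - real CARD('n)) * (x $ \<alpha> * htrace x)"
      by (simp add: Y3_def sum_subtractf left_diff_distrib)
    have H: "(\<Sum>d\<in>UNIV. hpert \<alpha> d x * euclidean_normal x $ d) = inverse r * H"
      unfolding H_def sum_distrib_left euclidean_normal_eq[OF nx] by (intro sum.cong refl) (simp add: hpert_sym[OF x, of \<alpha>])
    show "(\<Sum>k\<in>UNIV. \<Sum>d\<in>UNIV. Y1 k d x) + (\<Sum>k\<in>UNIV. \<Sum>d\<in>UNIV. Y2 k d x) + (\<Sum>k\<in>UNIV. Y3 k x)
      = - (r * (real CARD('n) - 2)) * (htrace x * euclidean_normal x $ \<alpha> - (\<Sum>d\<in>UNIV. hpert \<alpha> d x * euclidean_normal x $ d))"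
    proof -
      have e: "euclidean_normal x $ \<alpha> = inverse r * x $ \<alpha>" using euclidean_normal_eq[OF nx] by simp
      show ?thesis unfolding y1 y2 y3 H e using r0 by (simp add: divide_simps) (simp add: algebra_simps)
    qed
  qed
  also have "\<dots> = - (r * (real CARD('n) - 2)) * sphere_integral r (\<lambda>x. htrace x * euclidean_normal x $ \<alpha> - (\<Sum>d\<in>UNIV. hpert \<alpha> d x * euclidean_normal x $ d))"
    by (intro sphere_integral_cmult r0 continuous_intros ch continuous_on_sphere_E[OF continuous_euclidean_normal r])
  finally have int: "sphere_integral r (\<lambda>x. (\<Sum>k\<in>UNIV. \<Sum>d\<in>UNIV. Z1 k d x) + (\<Sum>k\<in>UNIV. \<Sum>d\<in>UNIV. Z2 k d x) + (\<Sum>k\<in>UNIV. Z3 k x))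
     = r * (real CARD('n) - 2) * sphere_integral r (\<lambda>x. htrace x * euclidean_normal x $ \<alpha> - (\<Sum>d\<in>UNIV. hpert \<alpha> d x * euclidean_normal x $ d))"
    by simp
  have "sphere_integral r (\<lambda>x. x $ \<alpha> * (\<Sum>k\<in>UNIV. Vlin k x * euclidean_normal x $ k) - norm x * Vlin \<alpha> x
      - (\<Sum>k\<in>UNIV. \<Sum>i\<in>UNIV. euclidean_normal x $ k * x $ i * Alin i k \<alpha> x))
    = sphere_integral r (\<lambda>x. inverse r * ((\<Sum>k\<in>UNIV. \<Sum>d\<in>UNIV. Z1 k d x) + (\<Sum>k\<in>UNIV. \<Sum>d\<in>UNIV. Z2 k d x) + (\<Sum>k\<in>UNIV. Z3 k x)))"
    unfolding Z1_def Z2_def Z3_def by (rule sphere_integral_cong, rule center_linear_density) (use r r0 in auto)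
  also have "\<dots> = inverse r * sphere_integral r (\<lambda>x. (\<Sum>k\<in>UNIV. \<Sum>d\<in>UNIV. Z1 k d x) + (\<Sum>k\<in>UNIV. \<Sum>d\<in>UNIV. Z2 k d x) + (\<Sum>k\<in>UNIV. Z3 k x))"
    by (intro sphere_integral_cmult r0 continuous_on_add continuous_on_sum cZ)
  finally show ?thesis unfolding int using r0 by simp
qed

lemma center_flux_eq:
  assumes r: "R0 < r"
  shows "center_flux G \<alpha> r = sphere_integral r (\<lambda>x. x $ \<alpha> * (\<Sum>k\<in>UNIV. Vlin k x * euclidean_normal x $ k)
    + (htrace x * euclidean_normal x $ \<alpha> - (\<Sum>d\<in>UNIV. hpert \<alpha> d x * euclidean_normal x $ d)))"
  unfolding center_flux_def
proof (rule sphere_integral_cong)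
  fix x :: "real^'n" assume "norm x = r"
  then have x: "x \<in> E" using r by simp
  have V: "(- euclidean_delta G x - d_trace G x) $ k = Vlin k x" for k
    using C1D(1)[OF C1_G x] by (simp add: euclidean_delta_def d_trace_def Vlin_def Alin_def trace_def partial_sum sum_subtractf)
  define v where "v = - euclidean_delta G x - d_trace G x"
  have 1: "v \<bullet> euclidean_normal x = (\<Sum>k\<in>UNIV. Vlin k x * euclidean_normal x $ k)"
    unfolding v_def inner_vec_def inner_real_def V ..
  define w where "w = (G x - mat 1) $ \<alpha>"
  have 2: "w \<bullet> euclidean_normal x = (\<Sum>d\<in>UNIV. hpert \<alpha> d x * euclidean_normal x $ d)"
    by (simp add: inner_vec_def hpert_def w_def)
  have 3: "trace (G x - mat 1) = htrace x" by (simp add: trace_def htrace_def hpert_def)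
  have 4: "axis \<alpha> 1 \<bullet> euclidean_normal x = euclidean_normal x $ \<alpha>" by (simp add: inner_axis')
  show "(x $ \<alpha> *\<^sub>R (- euclidean_delta G x - d_trace G x) - (G x - mat 1) $ \<alpha> + trace (G x - mat 1) *\<^sub>R axis \<alpha> 1) \<bullet> euclidean_normal x
     = x $ \<alpha> * (\<Sum>k\<in>UNIV. Vlin k x * euclidean_normal x $ k)
    + (htrace x * euclidean_normal x $ \<alpha> - (\<Sum>d\<in>UNIV. hpert \<alpha> d x * euclidean_normal x $ d))"
    unfolding v_def[symmetric] w_def[symmetric] 3 inner_add_left inner_diff_left inner_scaleR_left 1 2 4 by simp
qed

text \<open>All errors are odd of order 2 \<tau>, which alone need not exceed n - 1; their parity
  defect has order 2 \<tau> + \<delta>, and that is what the sphere integral sees.\<close>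

lemma ricci_center_flux_asymp:
  assumes a: "2 * \<tau> + \<delta> > real CARD('n) - 1"
  shows "((\<lambda>r. ricci_center_flux G \<alpha> r - (real CARD('n) - 2) * center_flux G \<alpha> r) \<longlongrightarrow> 0) at_top"
proof -
  let ?n = "real CARD('n)"
  define full where "full x = (?n - 1) * (x $ \<alpha> * (\<Sum>k\<in>UNIV. Wpot k x * euclidean_normal x $ k)) - norm x * Wpot \<alpha> x
    - (\<Sum>k\<in>UNIV. \<Sum>i\<in>UNIV. euclidean_normal x $ k * x $ i * Apot i x $ k $ \<alpha>) + quad (conformal_field \<alpha>) x" for x
  define l1 where "l1 x = x $ \<alpha> * (\<Sum>k\<in>UNIV. Vlin k x * euclidean_normal x $ k)" for x
  \<comment> \<open>Of the n - 1 copies of \<open>l1\<close> in the linearised density one is placed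
    here, which is what \<open>center_linear\<close> requires. The integral of \<open>l2\<close> is
    n - 2 times that of \<open>l3\<close>, so the other n - 2 copies complete the classical density
    l1 + l3.\<close>
  define l2 where "l2 x = x $ \<alpha> * (\<Sum>k\<in>UNIV. Vlin k x * euclidean_normal x $ k) - norm x * Vlin \<alpha> x
      - (\<Sum>k\<in>UNIV. \<Sum>i\<in>UNIV. euclidean_normal x $ k * x $ i * Alin i k \<alpha> x)" for x
  define l3 where "l3 x = htrace x * euclidean_normal x $ \<alpha> - (\<Sum>d\<in>UNIV. hpert \<alpha> d x * euclidean_normal x $ d)" for x
  define f where "f x = (?n - 1) * (x $ \<alpha> * (\<Sum>k\<in>UNIV. (Wpot k x - Vlin k x) * euclidean_normal x $ k)) - norm x * (Wpot \<alpha> x - Vlin \<alpha> x)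
    - (\<Sum>k\<in>UNIV. \<Sum>i\<in>UNIV. euclidean_normal x $ k * x $ i * (Apot i x $ k $ \<alpha> - Alin i k \<alpha> x)) + quad (conformal_field \<alpha>) x" for x
  have "decay \<delta> (2 * \<tau> + 1) 1 (\<lambda>x. (Wpot k x - Vlin k x) * euclidean_normal x $ k)" for k
    using decay_mult[OF decay_Wpot decay_euclidean_normal] by simp
  then have "decay \<delta> (2 * \<tau> + 1) 1 (\<lambda>x. \<Sum>k\<in>UNIV. (Wpot k x - Vlin k x) * euclidean_normal x $ k)" by (rule decay_sum)
  from decay_mult[OF decay_coord this, of \<alpha>]
  have d1: "decay \<delta> (2 * \<tau>) (-1) (\<lambda>x. x $ \<alpha> * (\<Sum>k\<in>UNIV. (Wpot k x - Vlin k x) * euclidean_normal x $ k))" by simp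
  have "decay \<delta> (-1) 1 (\<lambda>x::real^'n. norm x)" by (simp add: decay_def)
  from decay_mult[OF this decay_Wpot, of \<alpha>]
  have d2: "decay \<delta> (2 * \<tau>) (-1) (\<lambda>x. norm x * (Wpot \<alpha> x - Vlin \<alpha> x))" by simp
  have d3: "decay \<delta> (2 * \<tau>) (-1) (\<lambda>x. euclidean_normal x $ k * x $ i * (Apot i x $ k $ \<alpha> - Alin i k \<alpha> x))" for k i
    using decay_mult[OF decay_mult[OF decay_euclidean_normal decay_coord] decay_Apot_linear, of k i i k \<alpha>] by simp
  have d4: "decay \<delta> (2 * \<tau>) (-1) (quad (conformal_field \<alpha>))" using decay_quad[OF decay_conformal_field] by simp
  have "decay \<delta> (2 * \<tau>) (-1) f"
    unfolding f_def[abs_def] by (intro decay_add decay_diff decay_cmult decay_sum d1 d2 d3 d4)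
  moreover have "continuous_on E f"
    unfolding f_def[abs_def]
    by (intro continuous_intros C1D(3)[OF C1_Wpot] C1D(3)[OF C1_Apot] continuous_Vlin continuous_Alin continuous_euclidean_normal continuous_quad C1D(3)[OF C1_conformal_field])
  ultimately have lim: "((\<lambda>r. sphere_integral r f) \<longlongrightarrow> 0) at_top"
    using a by (intro sphere_integral_tendsto_0[OF R0])
  have "sphere_integral r f = ricci_center_flux G \<alpha> r - (?n - 2) * center_flux G \<alpha> r" if r: "R0 < r" for r
  proof -
    have r0: "r > 0" using r R0 by simp
    have cs: "continuous_on (sphere 0 r) full" "continuous_on (sphere 0 r) l1" "continuous_on (sphere 0 r) l2" "continuous_on (sphere 0 r) l3"
      unfolding full_def[abs_def] l1_def[abs_def] l2_def[abs_def] l3_def[abs_def]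
      by (intro continuous_on_sphere_E[OF _ r] continuous_intros C1D(3)[OF C1_Wpot] C1D(3)[OF C1_Apot] C1D(3)[OF C1_hpert] C1D(3)[OF C1_htrace]
          continuous_Vlin continuous_Alin continuous_euclidean_normal continuous_quad C1D(3)[OF C1_conformal_field])+
    have "f x = full x - ((?n - 2) * l1 x + l2 x)" for x
      by (simp add: f_def full_def l1_def l2_def left_diff_distrib right_diff_distrib sum_subtractf)
    then have "sphere_integral r f = sphere_integral r (\<lambda>x. full x - ((?n - 2) * l1 x + l2 x))" by (intro sphere_integral_cong)
    also have "\<dots> = sphere_integral r full - ((?n - 2) * sphere_integral r l1 + sphere_integral r l2)"
      by (simp only: sphere_integral_diff[OF r0] sphere_integral_add[OF r0] sphere_integral_cmult[OF r0] continuous_on_add continuous_on_mult_left cs)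
    also have "sphere_integral r l2 = (?n - 2) * sphere_integral r l3"
      unfolding l2_def l3_def by (rule center_linear[OF r])
    finally have sf: "sphere_integral r f = sphere_integral r full - ((?n - 2) * sphere_integral r l1 + (?n - 2) * sphere_integral r l3)" .
    have cf: "center_flux G \<alpha> r = sphere_integral r l1 + sphere_integral r l3"
      unfolding center_flux_eq[OF r] l1_def[symmetric] l3_def[symmetric] by (rule sphere_integral_add[OF r0 cs(2) cs(4)])
    have "ricci_center_flux G \<alpha> r = einstein_flux G (conformal_field \<alpha>) r"
      by (simp add: ricci_center_flux_def conformal_field_def[abs_def])
    also have "\<dots> = sphere_integral r full"
      unfolding einstein_flux_eq[OF C1_conformal_field r]
      by (rule sphere_integral_cong) (simp only: flux_density_conformal_field[OF _ r0] full_def)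
    finally have rf: "ricci_center_flux G \<alpha> r = sphere_integral r full" .
    show ?thesis unfolding sf cf rf by (simp add: algebra_simps)
  qed
  then show ?thesis
    by (intro Lim_transform_eventually[OF lim] eventually_mono[OF eventually_gt_at_top[of R0]])
qed

end

section \<open>Scalar curvature and volume in the chart at infinity\<close>

lemma metric_field_chart:
  assumes A: "smooth_structure \<A>" and g: "C3_metric \<A> g" and c: "c \<in> \<A>" and V: "open V" "V \<subseteq> chart_image c"
  shows "metric_field (g c) V"
proof
  show "open V" by (rule V)
  show "sym_posdef (g c x)" if "x \<in> V" for x
    using g c V(2) that unfolding C3_metric_def sym_posdef_def by blast
  show "Ck_on 2 (\<lambda>x. g c x $ i $ j) V" for i j
  proof -
    have "Ck_on 3 (\<lambda>x. g c x $ i $ j) (chart_image c)" using g c unfolding C3_metric_def by blast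
    then have "Ck_on 2 (\<lambda>x. g c x $ i $ j) (chart_image c)" by (rule Ck_on_mono) simp
    then show ?thesis using V(2) by (rule Ck_on_subset)
  qed
qed

text \<open>The transition map is an isometric map between the coordinate metrics on the overlap.
  This makes the chart chosen by \<open>chart_at\<close> irrelevant for the integrand of
  \<open>integrable_scal\<close>.\<close>

lemma scal_chart_independent:
  fixes \<A> :: "('m::{t2_space,second_countable_topology}, 'n::finite) chart set"
  assumes A: "smooth_structure \<A>" and g: "C3_metric \<A> g" and c: "c \<in> \<A>" and d: "d \<in> \<A>"
    and p: "p \<in> fst c" "p \<in> fst d"
  shows "scal (g c) (snd c p) = scal (g d) (snd d p)"
proof -
  have cc: "is_chart c" and dd: "is_chart d" and tr: "smooth_transition c d"
    using A c d by (auto simp: smooth_structure_def)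
  have hom: "homeomorphism (fst c) (chart_image c) (snd c) (chart_inv c)"
    and opc: "open (fst c)" "open (chart_image c)" using cc by (auto simp: is_chart_def)
  have opd: "open (fst d)" "open (chart_image d)" using dd by (auto simp: is_chart_def)
  define V where "V = snd c ` (fst c \<inter> fst d)"
  have VS: "V \<subseteq> chart_image c" by (auto simp: V_def chart_image_def)
  have "openin (top_of_set (fst c)) (fst c \<inter> fst d)"
    using opc opd by (simp add: openin_open_Int)
  then have "openin (top_of_set (chart_image c)) V"
    unfolding V_def using homeomorphism_imp_open_map[OF hom] by blast
  then have V: "open V" using opc(2) by (simp add: openin_open_eq)
  have inv: "chart_inv c (snd c q) = q" if "q \<in> fst c" for q
    using homeomorphism_apply1[OF hom that] .
  interpret isometric_map "g c" "g d" V "chart_image d" "transition c d"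
  proof (intro isometric_map.intro isometric_map_axioms.intro)
    show "metric_field (g c) V" by (rule metric_field_chart[OF A g c V VS])
    show "metric_field (g d) (chart_image d)" by (rule metric_field_chart[OF A g d opd(2) order_refl])
    show "transition c d x \<in> chart_image d" if "x \<in> V" for x
      using that inv by (auto simp: V_def transition_def chart_image_def)
    show "Ck_on 3 (\<lambda>x. transition c d x $ k) V" for k
      using tr unfolding smooth_transition_def V_def by blast
    show "g c x $ i $ j = (\<Sum>k\<in>UNIV. \<Sum>l\<in>UNIV. partial i (\<lambda>y. transition c d y $ k) x *
        partial j (\<lambda>y. transition c d y $ l) x * g d (transition c d x) $ k $ l)" if "x \<in> V" for x i j
      using g c d that unfolding C3_metric_def V_def by blast
  qed
  have "snd c p \<in> V" using p by (auto simp: V_def)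
  from scal_invariant[OF this] show ?thesis by (simp add: transition_def inv[OF p(1)])
qed

text \<open>Pushed forward along the chart, the Riemannian volume has density sqrt (det g) with
  respect to Lebesgue measure on the image, which turns integrability on the manifold into
  integrability in coordinates.\<close>

lemma integrable_scal_chart:
  fixes \<A> :: "('m::{t2_space,second_countable_topology}, 'n::finite) chart set"
  assumes A: "smooth_structure \<A>" and g: "C3_metric \<A> g" and int: "integrable_scal \<A> g" and c: "\<Phi> \<in> \<A>"
  shows "(\<integral>\<^sup>+x. indicator (chart_image \<Phi>) x * ennreal \<bar>sqrt (det (g \<Phi> x)) * scal (g \<Phi>) x\<bar> \<partial>lborel) < \<infinity>"
proof -
  let ?D = "fst \<Phi>" and ?S = "chart_image \<Phi>"
  have chart: "is_chart \<Phi>" using A c by (auto simp: smooth_structure_def)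
  then have D: "open ?D" and S: "open ?S" and hom: "homeomorphism ?D ?S (snd \<Phi>) (chart_inv \<Phi>)"
    by (auto simp: is_chart_def)
  interpret M: metric_field "g \<Phi>" ?S by (rule metric_field_chart[OF A g c S order_refl])
  obtain \<mu> where vol: "riemannian_volume \<A> g \<mu>"
    and f: "integrable \<mu> (\<lambda>p. scal (g (chart_at \<A> p)) (snd (chart_at \<A> p) p))"
    using int by (auto simp: integrable_scal_def)
  define F where "F p = scal (g (chart_at \<A> p)) (snd (chart_at \<A> p) p)" for p
  have FD: "F p = scal (g \<Phi>) (snd \<Phi> p)" if "p \<in> ?D" for p
  proof -
    have "p \<in> (\<Union>c\<in>\<A>. fst c)" using A unfolding smooth_structure_def by simp
    then have "\<exists>d. d \<in> \<A> \<and> p \<in> fst d" by blast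
    then have d: "chart_at \<A> p \<in> \<A>" "p \<in> fst (chart_at \<A> p)"
      using someI_ex[of "\<lambda>c. c \<in> \<A> \<and> p \<in> fst c"] unfolding chart_at_def by simp_all
    show ?thesis
      unfolding F_def by (rule scal_chart_independent[OF A g d(1) c d(2) that])
  qed
  have sets: "sets \<mu> = sets borel" using vol by (simp add: riemannian_volume_def)
  then have space: "space \<mu> = UNIV" using sets_eq_imp_space_eq[of \<mu> borel] by simp
  \<comment> \<open>The chart map carries meaning only on its domain, so its measurability is stated
    for the restricted space.\<close>
  have setsD: "sets (restrict_space \<mu> ?D) = sets (restrict_space borel ?D)"
    by (rule sets_restrict_space_cong[OF sets])
  have cont: "continuous_on ?D (snd \<Phi>)" using hom by (simp add: homeomorphism_def)
  have meas: "snd \<Phi> \<in> restrict_space \<mu> ?D \<rightarrow>\<^sub>M borel"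
    using borel_measurable_continuous_on_restrict[OF cont] by (simp only: measurable_cong_sets[OF setsD refl])
  have D\<mu>: "?D \<in> sets \<mu>" using D sets by simp
  define w where "w x = indicator ?S x * sqrt (det (g \<Phi> x))" for x
  define h where "h x = indicator ?S x * scal (g \<Phi>) x" for x
  have w[measurable]: "w \<in> borel_measurable borel"
    using borel_measurable_continuous_on_indicator[OF borel_open[OF S] C1D(3)[OF M.C1_sqrt_det]]
    by (simp add: w_def[abs_def])
  have h[measurable]: "h \<in> borel_measurable borel"
    using borel_measurable_continuous_on_indicator[OF borel_open[OF S] M.continuous_scal]
    by (simp add: h_def[abs_def])
  have N: "distr (restrict_space \<mu> ?D) borel (snd \<Phi>) = density lborel (\<lambda>x. ennreal (w x))"
  proof (rule measure_eqI)
    fix B assume "B \<in> sets (distr (restrict_space \<mu> ?D) borel (snd \<Phi>))"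
    then have B: "B \<in> sets borel" by simp
    define A where "A = snd \<Phi> -` B \<inter> ?D"
    have "A \<in> sets (restrict_space \<mu> ?D)"
      using measurable_sets[OF meas B] by (simp add: A_def space_restrict_space space)
    then have A: "A \<in> sets borel" "A \<subseteq> ?D"
      using D\<mu> space sets by (auto simp: sets_restrict_space_iff)
    have img: "snd \<Phi> ` A = B \<inter> ?S" by (auto simp: A_def chart_image_def)
    have "emeasure (distr (restrict_space \<mu> ?D) borel (snd \<Phi>)) B = emeasure (restrict_space \<mu> ?D) A"
      using emeasure_distr[OF meas B] by (simp add: A_def space_restrict_space space)
    also have "\<dots> = emeasure \<mu> A"
      using A(2) D\<mu> by (intro emeasure_restrict_space) (simp_all add: space)
    also have "\<dots> = (\<integral>\<^sup>+x\<in>snd \<Phi> ` A. ennreal (sqrt (det (g \<Phi> x))) \<partial>lborel)"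
      using vol c A unfolding riemannian_volume_def by blast
    also have "\<dots> = (\<integral>\<^sup>+x. ennreal (w x) * indicator B x \<partial>lborel)"
      unfolding img by (intro nn_integral_cong) (auto simp: w_def indicator_def)
    also have "\<dots> = emeasure (density lborel (\<lambda>x. ennreal (w x))) B"
      using B by (subst emeasure_density) auto
    finally show "emeasure (distr (restrict_space \<mu> ?D) borel (snd \<Phi>)) B = emeasure (density lborel (\<lambda>x. ennreal (w x))) B" .
  qed simp
  have "(\<integral>\<^sup>+x. indicator ?S x * ennreal \<bar>sqrt (det (g \<Phi> x)) * scal (g \<Phi>) x\<bar> \<partial>lborel) = (\<integral>\<^sup>+x. ennreal (w x) * ennreal \<bar>h x\<bar> \<partial>lborel)"
  proof (intro nn_integral_cong)
    fix x
    show "indicator ?S x * ennreal \<bar>sqrt (det (g \<Phi> x)) * scal (g \<Phi>) x\<bar> = ennreal (w x) * ennreal \<bar>h x\<bar>"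
    proof (cases "x \<in> ?S")
      case True
      then have "det (g \<Phi> x) > 0" by (rule M.det_pos)
      then show ?thesis using True by (simp add: w_def h_def abs_mult ennreal_mult)
    qed (simp add: w_def h_def)
  qed
  also have "\<dots> = (\<integral>\<^sup>+x. ennreal \<bar>h x\<bar> \<partial>density lborel (\<lambda>x. ennreal (w x)))"
    by (subst nn_integral_density) auto
  also have "\<dots> = (\<integral>\<^sup>+p. ennreal \<bar>h (snd \<Phi> p)\<bar> \<partial>restrict_space \<mu> ?D)"
    unfolding N[symmetric] by (rule nn_integral_distr[OF meas]) measurable
  also have "\<dots> = (\<integral>\<^sup>+p. ennreal \<bar>h (snd \<Phi> p)\<bar> * indicator ?D p \<partial>\<mu>)"
    using D\<mu> space by (subst nn_integral_restrict_space) auto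
  also have "\<dots> \<le> (\<integral>\<^sup>+p. ennreal \<bar>F p\<bar> \<partial>\<mu>)"
  proof (intro nn_integral_mono)
    fix p
    show "ennreal \<bar>h (snd \<Phi> p)\<bar> * indicator ?D p \<le> ennreal \<bar>F p\<bar>"
      by (cases "p \<in> ?D") (simp_all add: h_def FD chart_image_def)
  qed
  also have "\<dots> < \<infinity>"
    using f unfolding integrable_iff_bounded F_def by simp
  finally show ?thesis .
qed

section \<open>Equality of the classical and the Ricci invariants\<close>

text \<open>The derivative of the odd part is the even part of the derivative; thus the RT bound on
  it says that derivatives of the metric have parity -1 up to one order.\<close>

lemma partial_odd_part:
  assumes "f differentiable at x" "f differentiable at (- x)"
  shows "partial k (odd_part f) x = (partial k f x + partial k f (- x)) / 2"
proof -
  have d: "(\<lambda>x. f (- x)) differentiable at x"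
    by (rule differentiable_compose[of f "\<lambda>x. - x", OF assms(2)]) simp
  have "partial k (\<lambda>x. 1/2 * (f x - f (- x))) x = 1/2 * (partial k f x - partial k (\<lambda>x. f (- x)) x)"
    by (simp only: partial_cmult[OF differentiable_diff[OF assms(1) d]] partial_diff[OF assms(1) d])
  moreover have "odd_part f = (\<lambda>x. 1/2 * (f x - f (- x)))" by (simp add: odd_part_def fun_eq_iff)
  ultimately show ?thesis by (simp add: partial_reflect[OF assms(2)])
qed

lemma af_end_chart:
  fixes \<A> :: "('m::{t2_space,second_countable_topology}, 'n::finite) chart set"
  assumes af: "asymptotically_flat \<A> g \<Phi> \<tau>"
  obtains R0 where "{x. R0 < norm x} \<subseteq> chart_image \<Phi>" "af_end (g \<Phi>) R0 \<tau> 0"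
    "RT_conditions (g \<Phi>) \<tau> \<Longrightarrow> af_end (g \<Phi>) R0 \<tau> 1"
proof -
  let ?G = "g \<Phi>"
  have A: "smooth_structure \<A>" "C3_metric \<A> g" "\<Phi> \<in> \<A>" and tau: "\<tau> > 0"
    and G: "\<And>i j. (\<lambda>x. ?G x $ i $ j - mat 1 $ i $ j) \<in> O[at_infinity](\<lambda>x. norm x powr (-\<tau>))"
    and dG: "\<And>k i j. partial k (\<lambda>x. ?G x $ i $ j) \<in> O[at_infinity](\<lambda>x. norm x powr (-\<tau> - 1))"
    using af by (auto simp: asymptotically_flat_def)
  obtain p R where R: "R > 0" "chart_image \<Phi> = - cball p R"
    using af by (auto simp: asymptotically_flat_def)
  \<comment> \<open>The excised ball may be centred at \<open>p\<close>; enlarging its radius by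
    \<open>norm p\<close> reaches an exterior region centred at the origin, which is invariant under
    reflection.\<close>
  define R0 where "R0 = norm p + R"
  have R0: "R0 > 0" using R(1) by (simp add: R0_def add_nonneg_pos)
  have sub: "{x :: real^'n. R0 < norm x} \<subseteq> chart_image \<Phi>"
  proof
    fix x :: "real^'n" assume "x \<in> {x. R0 < norm x}"
    then have "norm p + R < norm x" by (simp add: R0_def)
    moreover have "norm x \<le> norm p + dist p x"
      using norm_triangle_ineq[of p "x - p"] by (simp add: dist_norm norm_minus_commute)
    ultimately show "x \<in> chart_image \<Phi>" using R(2) by simp
  qed
  have "open {x::real^'n. R0 < norm x}" by (intro open_Collect_less continuous_intros)
  then have mf: "metric_field ?G {x. R0 < norm x}" using metric_field_chart[OF A _ sub] by blast
  have dG': "partial k (\<lambda>x. ?G x $ i $ j) \<in> O[at_infinity](\<lambda>x. norm x powr (- (\<tau> + 1)))" for k i j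
    using dG[of k i j] by simp
  have d0: "decay 0 \<tau> 1 (\<lambda>x. ?G x $ i $ j - mat 1 $ i $ j)" for i j
    by (rule decay_0I[OF G]) simp
  have d1: "decay 0 (\<tau> + 1) (-1) (partial k (\<lambda>x. ?G x $ i $ j))" for k i j
    by (rule decay_0I[OF dG']) simp
  show thesis
  proof (rule that[OF sub])
    show "af_end ?G R0 \<tau> 0"
      by (intro af_end.intro af_end_axioms.intro mf R0 tau d0 d1)
    assume RT: "RT_conditions ?G \<tau>"
    have odd: "odd_part (\<lambda>x. ?G x $ i $ j) \<in> O[at_infinity](\<lambda>x. norm x powr (-\<tau> - 1))"
      and dodd: "partial k (odd_part (\<lambda>x. ?G x $ i $ j)) \<in> O[at_infinity](\<lambda>x. norm x powr (-\<tau> - 2))" for i j k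
      using RT by (auto simp: RT_conditions_def)
    \<comment> \<open>The parity error is twice the odd part; the Euclidean metric cancels in
      it.\<close>
    have 0: "decay 1 \<tau> 1 (\<lambda>x. ?G x $ i $ j - mat 1 $ i $ j)" for i j
    proof -
      have "(\<lambda>x. 2 * odd_part (\<lambda>x. ?G x $ i $ j) x) \<in> O[at_infinity](\<lambda>x. norm x powr (-\<tau> - 1))"
        using odd[of i j] by simp
      also have "(\<lambda>x. 2 * odd_part (\<lambda>x. ?G x $ i $ j) x) = (\<lambda>x. (?G x $ i $ j - mat 1 $ i $ j) - 1 * (?G (- x) $ i $ j - mat 1 $ i $ j))"
        by (simp add: odd_part_def fun_eq_iff)
      finally show ?thesis using G[of i j] unfolding decay_def by blast
    qed
    have 1: "decay 1 (\<tau> + 1) (-1) (partial k (\<lambda>x. ?G x $ i $ j))" for k i j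
    proof -
      interpret metric_field ?G "{x. R0 < norm x}" by (rule mf)
      have e: "- (\<tau> + 1) - 1 = - \<tau> - 2" by simp
      have "(\<lambda>x. 2 * partial k (odd_part (\<lambda>x. ?G x $ i $ j)) x) \<in> O[at_infinity](\<lambda>x. norm x powr (-\<tau> - 2))"
        using dodd[of k i j] by simp
      also have "?this \<longleftrightarrow> (\<lambda>x. partial k (\<lambda>x. ?G x $ i $ j) x - (-1) * partial k (\<lambda>x. ?G x $ i $ j) (- x)) \<in> O[at_infinity](\<lambda>x. norm x powr (-\<tau> - 2))"
      proof (rule landau_o.big.in_cong, rule eventually_mono[OF eventually_norm_gt[of R0]])
        fix x :: "real^'n" assume "R0 < norm x"
        then show "2 * partial k (odd_part (\<lambda>x. ?G x $ i $ j)) x = partial k (\<lambda>x. ?G x $ i $ j) x - (-1) * partial k (\<lambda>x. ?G x $ i $ j) (- x)"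
          by (simp add: partial_odd_part C1D(1)[OF C1_G])
      qed
      finally show ?thesis
        using dG'[of k i j] unfolding decay_def e by blast
    qed
    show "af_end ?G R0 \<tau> 1"
      by (intro af_end.intro af_end_axioms.intro mf R0 tau 0 1)
  qed
qed

text \<open>The prefactors of the definitions compensate the ratios of the fluxes, - (n - 2) / 2 for
  the mass and n - 2 for the center. Existence of the classical center limit is a premise, as its
  definition presupposes it; existence of the Ricci limit is derived.\<close>

theorem theorem2p3:
  fixes \<A> :: "('m::{t2_space,second_countable_topology}, 'n::finite) chart set"
    and g :: "('m, 'n) chart \<Rightarrow> real^'n \<Rightarrow> real^'n^'n"
    and \<Phi> :: "('m, 'n) chart"
    and \<tau> :: real
  assumes "CARD('n) \<ge> 3"
    and "asymptotically_flat \<A> g \<Phi> \<tau>"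
    and "integrable_scal \<A> g"
    and "\<tau> > (real CARD('n) - 2) / 2"
  shows "(limit_exists (mass_flux (g \<Phi>)) \<and>
          limit_exists (ricci_mass_flux (g \<Phi>)) \<and>
          mass (g \<Phi>) = ricci_mass (g \<Phi>)) \<and>
         (mass (g \<Phi>) \<noteq> 0 \<and> RT_conditions (g \<Phi>) \<tau> \<longrightarrow>
          (\<forall>\<alpha>. limit_exists (center_flux (g \<Phi>) \<alpha>) \<longrightarrow>
               limit_exists (ricci_center_flux (g \<Phi>) \<alpha>) \<and>
               center_of_mass (g \<Phi>) \<alpha> = ricci_center_of_mass (g \<Phi>) \<alpha>))"
proof -
  let ?G = "g \<Phi>" and ?n = "real CARD('n)"
  have n: "?n \<ge> 3" using assms(1) by simp
  obtain R0 where sub: "{x. R0 < norm x} \<subseteq> chart_image \<Phi>" and end0: "af_end ?G R0 \<tau> 0"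
    and end1: "RT_conditions ?G \<tau> \<Longrightarrow> af_end ?G R0 \<tau> 1"
    using af_end_chart[OF assms(2)] by blast
  have A: "smooth_structure \<A>" "C3_metric \<A> g" "\<Phi> \<in> \<A>"
    using assms(2) by (auto simp: asymptotically_flat_def)
  interpret af_end ?G R0 \<tau> 0 by (rule end0)
  have "(\<integral>\<^sup>+x. indicator E x * ennreal \<bar>wt x * scal ?G x\<bar> \<partial>lborel)
      \<le> (\<integral>\<^sup>+x. indicator (chart_image \<Phi>) x * ennreal \<bar>sqrt (det (?G x)) * scal ?G x\<bar> \<partial>lborel)"
    unfolding wt_def using sub by (intro nn_integral_mono mult_right_mono) (auto simp: indicator_def)
  then have "(\<integral>\<^sup>+x. indicator E x * ennreal \<bar>wt x * scal ?G x\<bar> \<partial>lborel) < \<infinity>"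
    using integrable_scal_chart[OF A(1,2) assms(3) A(3)] by (rule le_less_trans)
  then obtain m where m: "(mass_flux ?G \<longlongrightarrow> m) at_top"
    using mass_flux_converges assms(4) by (auto simp: field_simps)
  have "((\<lambda>r. (ricci_mass_flux ?G r + (?n - 2) / 2 * mass_flux ?G r) - (?n - 2) / 2 * mass_flux ?G r)
      \<longlongrightarrow> 0 - (?n - 2) / 2 * m) at_top"
    using assms(4) by (intro tendsto_diff ricci_mass_flux_asymp tendsto_mult_left m) (auto simp: field_simps)
  then have mR: "(ricci_mass_flux ?G \<longlongrightarrow> - ((?n - 2) / 2 * m)) at_top" by simp
  have "mass ?G = ricci_mass ?G"
    using n by (simp add: mass_def ricci_mass_def tendsto_Lim[OF _ m] tendsto_Lim[OF _ mR] divide_simps)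
  moreover have "limit_exists (ricci_center_flux ?G \<alpha>) \<and> center_of_mass ?G \<alpha> = ricci_center_of_mass ?G \<alpha>"
    if RT: "RT_conditions ?G \<tau>" and c: "limit_exists (center_flux ?G \<alpha>)" for \<alpha>
  proof -
    \<comment> \<open>The same end read with \<open>\<delta>\<close> equal to 1, for which the
      threshold 2 \<tau> + \<delta> > n - 1 is the assumed bound on \<tau>.\<close>
    interpret RT: af_end ?G R0 \<tau> 1 by (rule end1[OF RT])
    obtain l where l: "(center_flux ?G \<alpha> \<longlongrightarrow> l) at_top" using c by (auto simp: limit_exists_def)
    have "((\<lambda>r. (ricci_center_flux ?G \<alpha> r - (?n - 2) * center_flux ?G \<alpha> r) + (?n - 2) * center_flux ?G \<alpha> r)
        \<longlongrightarrow> 0 + (?n - 2) * l) at_top"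
      using assms(4) by (intro tendsto_add RT.ricci_center_flux_asymp tendsto_mult_left l) (auto simp: field_simps)
    then have lR: "(ricci_center_flux ?G \<alpha> \<longlongrightarrow> (?n - 2) * l) at_top" by simp
    have "center_of_mass ?G \<alpha> = ricci_center_of_mass ?G \<alpha>"
      using n by (simp add: center_of_mass_def ricci_center_of_mass_def tendsto_Lim[OF _ l] tendsto_Lim[OF _ lR])
    then show ?thesis using lR by (auto simp: limit_exists_def)
  qed
  ultimately show ?thesis using m mR by (auto simp: limit_exists_def)
qed

end
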